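(* Let $c>0$, $\alpha\in(0,1)$ and $\nu>0$. Then for any $\beta\in(0,1-\alpha)$ and any $\mu\in(0,\nu)$ there exist constants $C_1=C_1(c,\alpha,\beta)>0$ and $C_2=C_2(c,\alpha,\nu,\mu)>0$, depending only on the indicated parameters, such that the following holds. Let $f,w\in L^2([-1,1])$ with $\|\mathcal{F}_c[f]-w\|_{L^2([-1,1])}\le\delta M$ for some $\delta\in(0,1)$ and $M>0$, and suppose that $f\in\mathcal{H}^\nu([-1,1])$. Let $n^*=n^*(c,\alpha,\delta)$ be as defined in the context. Then $$\|f-\mathcal{F}_{n^*,c}^{-1}[w]\|_{L^2([-1,1])}\le C_1M\delta^\beta+C_2\|f\|_{\mathcal{H}^\nu([-1,1])}\left(\log\delta^{-1}\right)^{-\mu}.$$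
   Context: $\mathbb{N}=\{0,1,\ldots\}$; $e$ is Euler's number. $\mathcal{H}^\nu([-1,1])$ is the standard ($L^2$-based) Sobolev space on the interval. For $c>0$, the compact operator $\mathcal{F}_c$ on $L^2([-1,1])$ is $\mathcal{F}_c[f](x):=\int_{-1}^1e^{icxy}f(y)\,dy$. Its eigenfunctions $(\psi_{j,c})_{j\in\mathbb{N}}$ (prolate spheroidal wave functions) are real-valued and form an orthonormal basis of $L^2([-1,1])$; the corresponding eigenvalues $(\mu_{j,c})_{j\in\mathbb{N}}$ are simple and non-zero, ordered so that $0<|\mu_{j+1,c}|<|\mu_{j,c}|$. For $n\in\mathbb{N}$, $$\mathcal{F}_{n,c}^{-1}[w](y):=\sum_{j=0}^n\frac{1}{\mu_{j,c}}\psi_{j,c}(y)\int_{-1}^1\psi_{j,c}(x)w(x)\,dx.$$ For $\alpha,\delta\in(0,1)$, $n^*=n^*(c,\alpha,\delta):=\left\lfloor3+\tau\frac{ec}{4}\right\rfloor$, where $\tau=\tau(c,\alpha,\delta)\ge1$ is the solution of $\tau\log\tau=\frac{4}{ec}\alpha\log(\delta^{-1})$. *)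

theory Defs
  imports "HOL-Analysis.Analysis"
begin

section \<open>Square-integrable functions\<close>

text \<open>
  Elements of \<open>L\<^sup>2\<close> are represented by complex-valued functions; identities between
  them are understood almost everywhere.
\<close>

definition square_integrable :: "real measure \<Rightarrow> (real \<Rightarrow> complex) \<Rightarrow> bool" where
  "square_integrable M f \<longleftrightarrow>
     f \<in> borel_measurable M \<and> integrable M (\<lambda>x. (cmod (f x))\<^sup>2)"

definition l2norm :: "real measure \<Rightarrow> (real \<Rightarrow> complex) \<Rightarrow> real" where
  "l2norm M f = sqrt (\<integral>x. (cmod (f x))\<^sup>2 \<partial>M)"

abbreviation leb_I :: "real measure" where
  "leb_I \<equiv> lebesgue_on {-1..1}"

section \<open>The Sobolev spaces\<close>

text \<open>
  The (unitary) Fourier--Plancherel transform on the real line, as the \<open>L\<^sup>2\<close>-limit of the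
  truncated Fourier integrals. It determines \<open>h\<close> up to a null set. The convergence is stated
  with the nonnegative integral, which does not silently vanish in the non-integrable case.
\<close>

definition has_fourier_transform :: "(real \<Rightarrow> complex) \<Rightarrow> (real \<Rightarrow> complex) \<Rightarrow> bool" where
  "has_fourier_transform g h \<longleftrightarrow>
     square_integrable lebesgue g \<and> square_integrable lebesgue h \<and>
     ((\<lambda>R::real. \<integral>\<^sup>+\<xi>. ennreal ((cmod (h \<xi> -
          complex_of_real (1 / sqrt (2 * pi)) *
          (\<integral>x. exp (- \<i> * complex_of_real (x * \<xi>)) * g x \<partial>lebesgue_on {-R..R})))\<^sup>2) \<partial>lebesgue)
        \<longlongrightarrow> 0) at_top"

text \<open>
  \<open>\<H>\<^sup>\<nu>([-1,1])\<close> consists of the restrictions to \<open>[-1,1]\<close> of the functions \<open>g \<in> L\<^sup>2(\<real>)\<close> whose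
  Fourier transform \<open>h\<close> satisfies \<open>\<integral> (1 + \<xi>\<^sup>2)\<^sup>\<nu> |h(\<xi>)|\<^sup>2 d\<xi> < \<infinity>\<close>, with the quotient norm,
  i.e. the infimum of \<open>\<parallel>g\<parallel>\<close> in \<open>\<H>\<^sup>\<nu>(\<real>)\<close> over all extensions \<open>g\<close> of \<open>f\<close>.
\<close>

definition sobolev_extension_norms :: "real \<Rightarrow> (real \<Rightarrow> complex) \<Rightarrow> real set" where
  "sobolev_extension_norms \<nu> f =
     {sqrt (\<integral>\<xi>. (1 + \<xi>\<^sup>2) powr \<nu> * (cmod (h \<xi>))\<^sup>2 \<partial>lebesgue) | g h.
        (AE x in leb_I. g x = f x) \<and> has_fourier_transform g h \<and>
        integrable lebesgue (\<lambda>\<xi>. (1 + \<xi>\<^sup>2) powr \<nu> * (cmod (h \<xi>))\<^sup>2)}"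

definition sobolev_space :: "real \<Rightarrow> (real \<Rightarrow> complex) set" where
  "sobolev_space \<nu> = {f. sobolev_extension_norms \<nu> f \<noteq> {}}"

definition sobolev_norm :: "real \<Rightarrow> (real \<Rightarrow> complex) \<Rightarrow> real" where
  "sobolev_norm \<nu> f = Inf (sobolev_extension_norms \<nu> f)"

section \<open>Prolate spheroidal wave functions\<close>

definition Fop :: "real \<Rightarrow> (real \<Rightarrow> complex) \<Rightarrow> real \<Rightarrow> complex" where
  "Fop c f x = (\<integral>y. exp (\<i> * complex_of_real (c * x * y)) * f y \<partial>leb_I)"

definition pswf_coeff :: "(nat \<Rightarrow> real \<Rightarrow> real) \<Rightarrow> (real \<Rightarrow> complex) \<Rightarrow> nat \<Rightarrow> complex" where
  "pswf_coeff \<psi> w j = (\<integral>x. complex_of_real (\<psi> j x) * w x \<partial>leb_I)"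

text \<open>
  \<open>\<psi>\<close> and \<open>ev\<close> are the eigenfunctions and eigenvalues of \<open>Fop c\<close>. The eigenfunctions are
  determined only up to sign (and null sets), hence a predicate rather than a function of \<open>c\<close>.
  Since \<open>\<psi>\<close> is an orthonormal basis and the \<open>|ev j|\<close> are strictly decreasing, every
  eigenvalue occurs among the \<open>ev j\<close> and is simple and non-zero.
\<close>

definition is_pswf_system :: "real \<Rightarrow> (nat \<Rightarrow> real \<Rightarrow> real) \<Rightarrow> (nat \<Rightarrow> complex) \<Rightarrow> bool" where
  "is_pswf_system c \<psi> ev \<longleftrightarrow>
     (\<forall>j. square_integrable leb_I (\<lambda>x. complex_of_real (\<psi> j x))) \<and>
     (\<forall>j k. (\<integral>x. \<psi> j x * \<psi> k x \<partial>leb_I) = (if j = k then 1 else 0)) \<and>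
     (\<forall>f. square_integrable leb_I f \<longrightarrow>
        (\<lambda>n. l2norm leb_I (\<lambda>x. f x - (\<Sum>j\<le>n. pswf_coeff \<psi> f j * complex_of_real (\<psi> j x))))
          \<longlonglongrightarrow> 0) \<and>
     (\<forall>j. AE x in leb_I. Fop c (\<lambda>y. complex_of_real (\<psi> j y)) x = ev j * complex_of_real (\<psi> j x)) \<and>
     (\<forall>j. 0 < cmod (ev (Suc j)) \<and> cmod (ev (Suc j)) < cmod (ev j))"

definition Finv ::
  "(nat \<Rightarrow> real \<Rightarrow> real) \<Rightarrow> (nat \<Rightarrow> complex) \<Rightarrow> nat \<Rightarrow> (real \<Rightarrow> complex) \<Rightarrow> real \<Rightarrow> complex" where
  "Finv \<psi> ev n w y = (\<Sum>j\<le>n. 1 / ev j * complex_of_real (\<psi> j y) * pswf_coeff \<psi> w j)"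

definition tau :: "real \<Rightarrow> real \<Rightarrow> real \<Rightarrow> real" where
  "tau c \<alpha> \<delta> = (THE t. t \<ge> 1 \<and> t * ln t = 4 / (exp 1 * c) * \<alpha> * ln (1 / \<delta>))"

definition nstar :: "real \<Rightarrow> real \<Rightarrow> real \<Rightarrow> nat" where
  "nstar c \<alpha> \<delta> = nat \<lfloor>3 + tau c \<alpha> \<delta> * (exp 1 * c / 4)\<rfloor>"

end

theory Submission
  imports Defs "HOL-Probability.Probability" "HOL-Computational_Algebra.Polynomial" "HOL-Real_Asymp.Real_Asymp"
begin

text \<open>
  The kernel of \<open>Fop c\<close> is symmetric, so the expansion coefficients of \<open>Fop c f\<close>
  in the eigenfunctions are those of \<open>f\<close> times the eigenvalues. Hence the error is the truncation error
  \<open>f - P\<^sub>n f\<close> of the eigenfunction expansion plus the image of the noise \<open>Fop c f - w\<close> under the truncated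
  inverse, and the latter has norm at most \<open>\<delta> M / \<bar>ev n\<bar>\<close> (\<open>error_decomposition\<close>). So the eigenvalues have to
  be bounded from below, and the expansion of a Sobolev function has to converge like a power of \<open>n\<close>.

  Both bounds come from one inequality, \<open>cmod_moment_le\<close>. Up to the factor \<open>(\<i> c)\<^sup>k / k!\<close>, the moments
  \<open>\<integral> y\<^sup>k h(y) dy\<close> are the Taylor coefficients of \<open>Fop c h\<close> at \<open>0\<close>. A Taylor polynomial with \<open>N\<close> terms
  approximates \<open>Fop c h\<close> on \<open>[-1,1]\<close> up to \<open>2 c\<^sup>N / N! \<parallel>h\<parallel>\<close>, and the coefficients of a polynomial with
  \<open>N\<close> terms are at most \<open>(4e)\<^sup>N\<close> times its \<open>L\<^sup>2\<close> norm. Hence if \<open>Fop c h\<close> is small, so are the moments of \<open>h\<close>.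

  \<^item> \<^emph>\<open>Eigenvalues\<close> (\<open>inverse_ev_le\<close>). Some polynomial \<open>p \<noteq> 0\<close> of degree at most \<open>n\<close> is orthogonal to the first \<open>n\<close>
    eigenfunctions, so \<open>\<parallel>Fop c p\<parallel> \<le> \<bar>ev n\<bar> \<parallel>p\<parallel>\<close>. But \<open>\<parallel>p\<parallel>\<^sup>2\<close> is a combination of moments of \<open>p\<close>, so
    \<open>\<bar>ev n\<bar>\<close> cannot be small: \<open>1 / \<bar>ev n\<bar>\<close> grows at most like \<open>A\<^sup>n n!\<close>, that is, like \<open>exp (n ln n)\<close> to leading order
    in the exponent. The choice of \<open>n\<^sup>*\<close> makes \<open>n\<^sup>* ln n\<^sup>*\<close> asymptotically equal to \<open>\<alpha> ln (1/\<delta>)\<close>. Terms of lower order in the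
    exponent are absorbed by the gap between \<open>\<beta>\<close> and \<open>1 - \<alpha>\<close>.

  \<^item> \<^emph>\<open>Expansion\<close> (\<open>approximation_error_sobolev\<close>). If \<open>u\<close> is orthogonal to \<open>\<psi> 0, \<dots>, \<psi> n\<close>, then
    \<open>Fop c u\<close> is superexponentially small, hence so are the first moments of \<open>u\<close>, and the Fourier transform of \<open>u\<close> is
    exponentially small at all frequencies up to a constant multiple of \<open>n\<close>. By Parseval's identity, the pairing of
    \<open>u\<close> with \<open>f\<close> only sees frequencies of \<open>f\<close> beyond that multiple, up to an exponentially small error.
    This gives \<open>\<parallel>f - P\<^sub>n f\<parallel> \<le> C n\<^sup>-\<^sup>\<nu>\<close> times the Sobolev norm of \<open>f\<close>. As \<open>n\<^sup>*\<close> is of order \<open>ln (1/\<delta>) / ln (ln (1/\<delta>))\<close>,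
    an iterated logarithm is lost, which is why \<open>\<mu> < \<nu>\<close>.

  Two facts on Fourier integrals of functions with bounded support are used: Plancherel's inequality and
  Parseval's identity against a continuous function on \<open>[-1,1]\<close>. Both follow by
  inserting a Gaussian weight on the frequency side, which turns into convolution with a narrow Gaussian.
\<close>

section \<open>Square-integrable functions\<close>

lemma square_integrable_measurable: "square_integrable M f \<Longrightarrow> f \<in> borel_measurable M"
  by (simp add: square_integrable_def)

lemma l2norm_nonneg [simp]: "0 \<le> l2norm M f"
  by (simp add: l2norm_def)

lemma l2norm_power2: "(l2norm M f)\<^sup>2 = (\<integral>x. (cmod (f x))\<^sup>2 \<partial>M)"
  by (simp add: l2norm_def)

lemma square_integrable_add:
  assumes "square_integrable M f" "square_integrable M g"
  shows "square_integrable M (\<lambda>x. f x + g x)"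
proof -
  have [measurable]: "f \<in> borel_measurable M" "g \<in> borel_measurable M"
    using assms by (auto simp: square_integrable_def)
  have "integrable M (\<lambda>x. 2 * (cmod (f x))\<^sup>2 + 2 * (cmod (g x))\<^sup>2)"
    using assms by (auto simp: square_integrable_def)
  then have "integrable M (\<lambda>x. (cmod (f x + g x))\<^sup>2)"
  proof (rule Bochner_Integration.integrable_bound)
    show "AE x in M. norm ((cmod (f x + g x))\<^sup>2) \<le> norm (2 * (cmod (f x))\<^sup>2 + 2 * (cmod (g x))\<^sup>2)"
    proof (rule AE_I2)
      fix x
      have "(cmod (f x + g x))\<^sup>2 \<le> (cmod (f x) + cmod (g x))\<^sup>2"
        by (intro power_mono norm_triangle_ineq) auto
      also have "\<dots> \<le> 2 * (cmod (f x))\<^sup>2 + 2 * (cmod (g x))\<^sup>2"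
        using sum_squares_bound[of "cmod (f x)" "cmod (g x)"] by (simp add: power2_sum)
      finally show "norm ((cmod (f x + g x))\<^sup>2) \<le> norm (2 * (cmod (f x))\<^sup>2 + 2 * (cmod (g x))\<^sup>2)"
        by simp
    qed
  qed simp
  then show ?thesis by (simp add: square_integrable_def)
qed

lemma square_integrable_cmult:
  "square_integrable M f \<Longrightarrow> square_integrable M (\<lambda>x. a * f x)"
  by (auto simp: square_integrable_def norm_mult power_mult_distrib)

lemma square_integrable_diff:
  assumes "square_integrable M f" "square_integrable M g"
  shows "square_integrable M (\<lambda>x. f x - g x)"
  using square_integrable_add[OF assms(1) square_integrable_cmult[OF assms(2), of "-1"]] by simp

lemma square_integrable_zero: "square_integrable M (\<lambda>x. 0)"
  by (simp add: square_integrable_def)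

lemma square_integrable_sum:
  "(\<And>j. j \<in> A \<Longrightarrow> square_integrable M (f j)) \<Longrightarrow> square_integrable M (\<lambda>x. \<Sum>j\<in>A. f j x)"
  by (induction A rule: infinite_finite_induct)
     (auto intro: square_integrable_add square_integrable_zero)

lemma square_integrable_cnj: "square_integrable M f \<Longrightarrow> square_integrable M (\<lambda>x. cnj (f x))"
  using measurable_compose[of f M borel cnj borel]
  by (auto simp: square_integrable_def borel_measurable_continuous_onI continuous_intros)

lemma l2norm_minus_commute: "l2norm M (\<lambda>x. f x - g x) = l2norm M (\<lambda>x. g x - f x)"
  by (simp add: l2norm_def norm_minus_commute)

lemma square_integrable_bounded:
  assumes "finite_measure M" "f \<in> borel_measurable M" "\<And>x. x \<in> space M \<Longrightarrow> cmod (f x) \<le> B"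
  shows "square_integrable M f"
proof -
  interpret finite_measure M by fact
  have [measurable]: "f \<in> borel_measurable M" by fact
  have "integrable M (\<lambda>x. (cmod (f x))\<^sup>2)"
  proof (rule integrable_const_bound[where B = "B\<^sup>2"])
    show "AE x in M. norm ((cmod (f x))\<^sup>2) \<le> B\<^sup>2"
      using assms(3) by (intro AE_I2) (simp add: power_mono)
  qed simp
  then show ?thesis using assms by (simp add: square_integrable_def)
qed

lemma integrable_mult_square_integrable:
  assumes "square_integrable M f" "square_integrable M g"
  shows "integrable M (\<lambda>x. f x * g x)"
proof -
  have [measurable]: "f \<in> borel_measurable M" "g \<in> borel_measurable M"
    using assms by (auto simp: square_integrable_def)
  have "integrable M (\<lambda>x. (cmod (f x))\<^sup>2 + (cmod (g x))\<^sup>2)"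
    using assms by (auto simp: square_integrable_def)
  then show ?thesis
  proof (rule Bochner_Integration.integrable_bound)
    show "AE x in M. norm (f x * g x) \<le> norm ((cmod (f x))\<^sup>2 + (cmod (g x))\<^sup>2)"
    proof (rule AE_I2)
      fix x
      have "2 * (cmod (f x) * cmod (g x)) \<le> (cmod (f x))\<^sup>2 + (cmod (g x))\<^sup>2"
        using sum_squares_bound[of "cmod (f x)" "cmod (g x)"] by simp
      moreover have "0 \<le> cmod (f x) * cmod (g x)" by simp
      ultimately have "cmod (f x) * cmod (g x) \<le> (cmod (f x))\<^sup>2 + (cmod (g x))\<^sup>2"
        by linarith
      then show "norm (f x * g x) \<le> norm ((cmod (f x))\<^sup>2 + (cmod (g x))\<^sup>2)"
        by (simp add: norm_mult)
    qed
  qed simp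
qed

lemma integral_cmod_mult_le_l2norm:
  assumes "square_integrable M f" "square_integrable M g"
  shows "(\<integral>x. cmod (f x) * cmod (g x) \<partial>M) \<le> l2norm M f * l2norm M g"
proof -
  have [measurable]: "f \<in> borel_measurable M" "g \<in> borel_measurable M"
    using assms by (auto simp: square_integrable_def)
  have int: "integrable M (\<lambda>x. cmod (f x) * cmod (g x))"
    using integrable_norm[OF integrable_mult_square_integrable[OF assms]] by (simp add: norm_mult)
  have "(\<integral>\<^sup>+x. ennreal (cmod (f x)) * ennreal (cmod (g x)) \<partial>M)\<^sup>2
      \<le> (\<integral>\<^sup>+x. (ennreal (cmod (f x)))\<^sup>2 \<partial>M) * (\<integral>\<^sup>+x. (ennreal (cmod (g x)))\<^sup>2 \<partial>M)"
    by (rule Cauchy_Schwarz_nn_integral) auto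
  also have "(\<integral>\<^sup>+x. ennreal (cmod (f x)) * ennreal (cmod (g x)) \<partial>M)
      = ennreal (\<integral>x. cmod (f x) * cmod (g x) \<partial>M)"
    using nn_integral_eq_integral[OF int] by (simp add: ennreal_mult)
  also have "(\<integral>\<^sup>+x. (ennreal (cmod (f x)))\<^sup>2 \<partial>M) = ennreal ((l2norm M f)\<^sup>2)"
    using nn_integral_eq_integral[of M "\<lambda>x. (cmod (f x))\<^sup>2"] assms
    by (simp add: ennreal_power l2norm_power2 square_integrable_def)
  also have "(\<integral>\<^sup>+x. (ennreal (cmod (g x)))\<^sup>2 \<partial>M) = ennreal ((l2norm M g)\<^sup>2)"
    using nn_integral_eq_integral[of M "\<lambda>x. (cmod (g x))\<^sup>2"] assms
    by (simp add: ennreal_power l2norm_power2 square_integrable_def)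
  finally have "(\<integral>x. cmod (f x) * cmod (g x) \<partial>M)\<^sup>2 \<le> (l2norm M f * l2norm M g)\<^sup>2"
    by (simp add: ennreal_power ennreal_mult[symmetric] power_mult_distrib)
  then show ?thesis
    by (rule power2_le_imp_le) simp
qed

lemma Cauchy_Schwarz_l2norm:
  assumes "square_integrable M f" "square_integrable M g"
  shows "cmod (\<integral>x. f x * g x \<partial>M) \<le> l2norm M f * l2norm M g"
  using integral_norm_bound[of M "\<lambda>x. f x * g x"] integral_cmod_mult_le_l2norm[OF assms]
  by (simp add: norm_mult)

lemma l2norm_triangle:
  assumes "square_integrable M f" "square_integrable M g"
  shows "l2norm M (\<lambda>x. f x + g x) \<le> l2norm M f + l2norm M g"
proof (rule power2_le_imp_le)
  have int: "integrable M (\<lambda>x. (cmod (f x))\<^sup>2)" "integrable M (\<lambda>x. (cmod (g x))\<^sup>2)"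
    "integrable M (\<lambda>x. cmod (f x) * cmod (g x))"
    using assms integrable_norm[OF integrable_mult_square_integrable[OF assms]]
    by (auto simp: square_integrable_def norm_mult)
  have "(l2norm M (\<lambda>x. f x + g x))\<^sup>2
      \<le> (\<integral>x. (cmod (f x))\<^sup>2 + (cmod (g x))\<^sup>2 + 2 * (cmod (f x) * cmod (g x)) \<partial>M)"
    unfolding l2norm_power2
  proof (rule integral_mono)
    show "integrable M (\<lambda>x. (cmod (f x + g x))\<^sup>2)"
      using square_integrable_add[OF assms] by (simp add: square_integrable_def)
    show "integrable M (\<lambda>x. (cmod (f x))\<^sup>2 + (cmod (g x))\<^sup>2 + 2 * (cmod (f x) * cmod (g x)))"
      using int by simp
    fix x
    have "(cmod (f x + g x))\<^sup>2 \<le> (cmod (f x) + cmod (g x))\<^sup>2"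
      by (intro power_mono norm_triangle_ineq) auto
    then show "(cmod (f x + g x))\<^sup>2 \<le> (cmod (f x))\<^sup>2 + (cmod (g x))\<^sup>2 + 2 * (cmod (f x) * cmod (g x))"
      by (simp add: power2_sum)
  qed
  also have "\<dots> = (l2norm M f)\<^sup>2 + (l2norm M g)\<^sup>2 + 2 * (\<integral>x. cmod (f x) * cmod (g x) \<partial>M)"
    using int by (simp add: l2norm_power2)
  also have "\<dots> \<le> (l2norm M f + l2norm M g)\<^sup>2"
    using integral_cmod_mult_le_l2norm[OF assms] by (simp add: power2_sum)
  finally show "(l2norm M (\<lambda>x. f x + g x))\<^sup>2 \<le> (l2norm M f + l2norm M g)\<^sup>2" .
qed simp

lemma l2norm_triangle_diff:
  assumes "square_integrable M f" "square_integrable M g"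
  shows "l2norm M f \<le> l2norm M g + l2norm M (\<lambda>x. f x - g x)"
  using l2norm_triangle[OF assms(2) square_integrable_diff[OF assms]] by simp

text \<open>
  The complex form of the norm allows inner products to be computed by linearity.
\<close>

lemma complex_l2norm_power2: "complex_of_real ((l2norm M f)\<^sup>2) = (\<integral>x. cnj (f x) * f x \<partial>M)"
proof -
  have "complex_of_real ((l2norm M f)\<^sup>2) = (\<integral>x. complex_of_real ((cmod (f x))\<^sup>2) \<partial>M)"
    by (simp add: l2norm_power2 del: of_real_power)
  also have "\<dots> = (\<integral>x. cnj (f x) * f x \<partial>M)"
    by (intro Bochner_Integration.integral_cong refl) (simp add: complex_norm_square mult.commute del: of_real_power)
  finally show ?thesis .
qed

section \<open>Square-integrable functions on an interval\<close>

lemma finite_measure_leb_on [simp]: "finite_measure (lebesgue_on {a..b::real})"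
  by (rule finite_measure_lebesgue_on) auto

lemma measure_leb_I: "measure leb_I (space leb_I) = 2"
  by (simp add: measure_restrict_space)

lemma borel_measurable_leb_on: "f \<in> borel_measurable borel \<Longrightarrow> f \<in> borel_measurable (lebesgue_on A)"
  by (rule measurable_restrict_space1) (simp add: measurable_completion)

lemma integrable_of_square_integrable:
  assumes "finite_measure M" "square_integrable M f"
  shows "integrable M f"
  using integrable_mult_square_integrable[OF assms(2) square_integrable_bounded[OF assms(1), of "\<lambda>_. 1" 1]]
  by simp

lemma l2norm_one_leb_I: "l2norm leb_I (\<lambda>_. 1) = sqrt 2"
  using measure_leb_I by (simp add: l2norm_def)

text \<open>
  Cauchy--Schwarz against the constant \<open>1\<close>; the factor is the square root of the length of the interval.
\<close>

lemma l1_le_l2norm_leb_I: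
  assumes "square_integrable leb_I f"
  shows "(\<integral>x. cmod (f x) \<partial>leb_I) \<le> sqrt 2 * l2norm leb_I f"
  using integral_cmod_mult_le_l2norm[OF assms square_integrable_bounded[of _ "\<lambda>_. 1" 1]]
  by (simp add: l2norm_one_leb_I mult.commute)

lemma l2norm_leb_I_le_bound:
  assumes "f \<in> borel_measurable leb_I" "\<And>x. x \<in> {-1..1} \<Longrightarrow> cmod (f x) \<le> B"
  shows "l2norm leb_I f \<le> sqrt 2 * B"
proof -
  have "0 \<le> B" using assms(2)[of 0] norm_ge_zero[of "f 0"] by (simp del: norm_ge_zero)
  have sq: "square_integrable leb_I f"
    by (rule square_integrable_bounded) (use assms in auto)
  have "(l2norm leb_I f)\<^sup>2 \<le> (\<integral>x. B\<^sup>2 \<partial>leb_I)"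
    unfolding l2norm_power2
    by (rule integral_mono) (use sq assms \<open>0 \<le> B\<close> finite_measure.integrable_const[OF finite_measure_leb_on] in \<open>auto simp: square_integrable_def intro: power_mono\<close>)
  also have "\<dots> = (sqrt 2 * B)\<^sup>2"
    using measure_leb_I by (simp add: power_mult_distrib)
  finally show ?thesis
    by (rule power2_le_imp_le) (use \<open>0 \<le> B\<close> in simp)
qed

lemma id_borel_measurable_leb_on: "(\<lambda>x. x) \<in> borel_measurable (lebesgue_on A)"
  by (rule borel_measurable_leb_on) simp

lemma borel_measurable_continuous_leb_on:
  "continuous_on UNIV f \<Longrightarrow> (f :: real \<Rightarrow> complex) \<in> borel_measurable (lebesgue_on A)"
  by (intro borel_measurable_leb_on borel_measurable_continuous_onI)

lemma continuous_bounded_on_I: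
  assumes "continuous_on UNIV v"
  shows "\<exists>B. \<forall>y\<in>{-1..1::real}. cmod (v y) \<le> B"
proof -
  have "compact (v ` {-1..1})"
    by (intro compact_continuous_image continuous_on_subset[OF assms]) auto
  then show ?thesis by (meson bounded_iff compact_imp_bounded imageI)
qed

lemma square_integrable_continuous_leb_I:
  assumes "continuous_on UNIV f"
  shows "square_integrable leb_I f"
proof -
  obtain B where "\<And>x. x \<in> {-1..1} \<Longrightarrow> cmod (f x) \<le> B"
    using continuous_bounded_on_I[OF assms] by blast
  then show ?thesis
    by (intro square_integrable_bounded[where B=B] borel_measurable_continuous_leb_on assms) auto
qed

section \<open>Coefficients of a polynomial in terms of its norm\<close>

text \<open>
  Multiplication by \<open>X - a\<close> with \<open>\<bar>a\<bar> \<le> 1\<close> at most doubles the largest coefficient.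
\<close>

lemma cmod_coeff_prod_linear_le:
  fixes a :: "'i \<Rightarrow> complex"
  assumes "finite A" "\<And>i. i \<in> A \<Longrightarrow> cmod (a i) \<le> 1"
  shows "cmod (coeff (\<Prod>i\<in>A. [:- a i, 1:]) k) \<le> 2 ^ card A"
  using assms
proof (induction A arbitrary: k rule: finite_induct)
  case empty
  then show ?case by (cases k) auto
next
  case (insert i A)
  define p where "p = (\<Prod>i\<in>A. [:- a i, 1:])"
  have IH: "cmod (coeff p k) \<le> 2 ^ card A" for k
    using insert unfolding p_def by auto
  have "coeff ([:- a i, 1:] * p) k = - a i * coeff p k + (case k of 0 \<Rightarrow> 0 | Suc l \<Rightarrow> coeff p l)"
    by (simp add: mult_pCons_left coeff_pCons split: nat.split)
  also have "cmod \<dots> \<le> cmod (- a i * coeff p k) + cmod (case k of 0 \<Rightarrow> 0 | Suc l \<Rightarrow> coeff p l)"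
    by (rule norm_triangle_ineq)
  also have "\<dots> \<le> 1 * 2 ^ card A + 2 ^ card A"
    unfolding norm_mult norm_minus_cancel
    by (intro add_mono mult_mono) (use IH insert.prems in \<open>auto split: nat.split\<close>)
  finally show ?case
    using insert.hyps by (simp add: p_def)
qed

lemma poly_eq_Lagrange_sum:
  fixes p :: "complex poly"
  assumes "finite A" "inj_on x A" "degree p < card A"
  shows "p = (\<Sum>j\<in>A. smult (poly p (x j) / (\<Prod>i\<in>A-{j}. x j - x i)) (\<Prod>i\<in>A-{j}. [:- x i, 1:]))"
    (is "p = ?q")
proof (rule poly_eqI_degree[where A = "x ` A"])
  fix z assume "z \<in> x ` A"
  then obtain l where l: "l \<in> A" "z = x l" by auto
  have "poly ?q z = (\<Sum>j\<in>A. if j = l then poly p (x l) else 0)"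
    unfolding poly_sum
  proof (rule sum.cong[OF refl])
    fix j assume j: "j \<in> A"
    show "poly (smult (poly p (x j) / (\<Prod>i\<in>A-{j}. x j - x i)) (\<Prod>i\<in>A-{j}. [:- x i, 1:])) z
      = (if j = l then poly p (x l) else 0)"
    proof (cases "j = l")
      case True
      have "(\<Prod>i\<in>A-{l}. x l - x i) \<noteq> 0"
        using assms l by (auto simp: inj_on_def)
      then show ?thesis using True l by (simp add: poly_prod)
    next
      case False
      then have "(\<Prod>i\<in>A-{j}. x l - x i) = 0"
        using assms(1) l by (intro prod_zero) auto
      then show ?thesis using False l by (simp add: poly_prod)
    qed
  qed
  also have "\<dots> = poly p z"
    using l assms(1) by simp
  finally show "poly p z = poly ?q z" ..
next
  show "degree p < card (x ` A)"
    using assms by (simp add: card_image)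
  have "degree ?q \<le> card A - 1"
  proof (rule degree_sum_le[OF assms(1)])
    fix j assume j: "j \<in> A"
    have "degree (\<Prod>i\<in>A-{j}. [:- x i, 1:]) \<le> (\<Sum>i\<in>A-{j}. degree [:- x i, 1:])"
      using assms(1) by (metis (no_types, lifting) comp_apply degree_prod_sum_le finite_Diff sum.cong)
    also have "\<dots> = card A - 1"
      using j assms(1) by simp
    finally show "degree (smult (poly p (x j) / (\<Prod>i\<in>A-{j}. x j - x i)) (\<Prod>i\<in>A-{j}. [:- x i, 1:]))
      \<le> card A - 1"
      by (intro order_trans[OF degree_smult_le])
  qed
  then show "degree ?q < card (x ` A)"
    using assms by (simp add: card_image)
qed

lemma prod_abs_diff_nodes:
  assumes "j \<le> N"
  shows "(\<Prod>i\<in>{..N}-{j}. \<bar>real j - real i\<bar>) = fact j * fact (N - j)"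
proof -
  have "{..N}-{j} = {..<j} \<union> {j<..N}" using assms by auto
  then have "(\<Prod>i\<in>{..N}-{j}. \<bar>real j - real i\<bar>)
      = (\<Prod>i\<in>{..<j}. \<bar>real j - real i\<bar>) * (\<Prod>i\<in>{j<..N}. \<bar>real j - real i\<bar>)"
    using prod.union_disjoint[of "{..<j}" "{j<..N}" "\<lambda>i. \<bar>real j - real i\<bar>"] by force
  also have "(\<Prod>i\<in>{..<j}. \<bar>real j - real i\<bar>) = (\<Prod>i\<in>{1..j}. real i)"
    by (rule prod.reindex_bij_witness[of _ "\<lambda>i. j - i" "\<lambda>i. j - i"]) auto
  also have "\<dots> = fact j" by (simp add: fact_prod)
  also have "(\<Prod>i\<in>{j<..N}. \<bar>real j - real i\<bar>) = (\<Prod>i\<in>{1..N-j}. real i)"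
    by (rule prod.reindex_bij_witness[of _ "\<lambda>i. j + i" "\<lambda>i. i - j"]) auto
  also have "\<dots> = fact (N - j)" by (simp add: fact_prod)
  finally show ?thesis .
qed

text \<open>
  The left-hand side divided by \<open>N!\<close> is a single term of the exponential series of \<open>e\<^sup>N\<close>.
\<close>

lemma power_self_le_exp_fact: "real N ^ N \<le> exp 1 ^ N * fact N"
proof -
  have "real N ^ N / fact N \<le> exp (real N)"
  proof -
    have "(\<Sum>k\<in>{N}. real N ^ k /\<^sub>R fact k) \<le> (\<Sum>k. real N ^ k /\<^sub>R fact k)"
      by (rule sum_le_suminf) (use summable_exp_generic[of "real N"] in auto)
    then show ?thesis by (simp add: exp_def divide_inverse mult.commute)
  qed
  also have "\<dots> = exp 1 ^ N" by (simp flip: exp_of_nat_mult)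
  finally show ?thesis by (simp add: divide_le_eq)
qed

text \<open>
  Interpolate \<open>p\<close> at the \<open>N + 1\<close> equidistant nodes \<open>-1 + 2 j / N\<close>. The numerator of the \<open>j\<close>-th Lagrange polynomial has
  coefficients at most \<open>2\<^sup>N\<close>, and the denominator is \<open>(2/N)\<^sup>N j! (N - j)!\<close>. The sum over \<open>j\<close> of \<open>1 / (j! (N - j)!)\<close>
  is \<open>2\<^sup>N / N!\<close>, so altogether one gets \<open>(2 N)\<^sup>N / N! \<le> (2e)\<^sup>N\<close>. What matters below is that the bound is
  only exponential in \<open>N\<close>, hence negligible against factorials.
\<close>

lemma cmod_coeff_le_sup:
  fixes p :: "complex poly"
  assumes N: "N \<ge> 1" "degree p \<le> N"
    and B: "\<And>x::real. \<bar>x\<bar> \<le> 1 \<Longrightarrow> cmod (poly p (of_real x)) \<le> B"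
  shows "cmod (coeff p k) \<le> (2 * exp 1) ^ N * B"
proof -
  have B0: "0 \<le> B" using B[of 0] norm_ge_zero[of "poly p (of_real 0)"] by (simp del: norm_ge_zero)
  define y where "y j = -1 + 2 * real j / real N" for j
  define x where "x j = complex_of_real (y j)" for j
  have xy: "cmod (x j - x i) = 2 / real N * \<bar>real j - real i\<bar>" for i j
  proof -
    have "y j - y i = 2 / real N * (real j - real i)"
      using N by (simp add: y_def field_simps)
    then show ?thesis
      by (simp only: x_def norm_of_real abs_mult abs_divide abs_numeral abs_of_nat flip: of_real_diff)
  qed
  have y1: "\<bar>y j\<bar> \<le> 1" if "j \<le> N" for j
    using that N by (auto simp: y_def abs_le_iff field_simps)
  have inj: "inj_on x {..N}"
    using N by (auto simp: inj_on_def x_def y_def)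
  have "p = (\<Sum>j\<in>{..N}. smult (poly p (x j) / (\<Prod>i\<in>{..N}-{j}. x j - x i)) (\<Prod>i\<in>{..N}-{j}. [:- x i, 1:]))"
    by (rule poly_eq_Lagrange_sum) (use inj N in auto)
  from arg_cong[OF this, of "\<lambda>q. coeff q k"]
  have "coeff p k = (\<Sum>j\<le>N. poly p (x j) / (\<Prod>i\<in>{..N}-{j}. x j - x i) * coeff (\<Prod>i\<in>{..N}-{j}. [:- x i, 1:]) k)"
    unfolding coeff_sum coeff_smult .
  also have "cmod \<dots> \<le> (\<Sum>j\<le>N. B * 2 ^ N * (real N / 2) ^ N / fact N * (N choose j))"
  proof (rule sum_norm_le)
    fix j assume "j \<in> {..N}"
    then have j: "j \<le> N" by simp
    have "cmod (\<Prod>i\<in>{..N}-{j}. x j - x i) = (\<Prod>i\<in>{..N}-{j}. 2 / real N * \<bar>real j - real i\<bar>)"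
      by (simp only: prod_norm[symmetric] xy)
    also have "\<dots> = (2 / real N) ^ N * (fact j * fact (N - j))"
      using j by (simp only: prod.distrib prod_abs_diff_nodes prod_constant) simp
    finally have den: "cmod (\<Prod>i\<in>{..N}-{j}. x j - x i) = (2 / real N) ^ N * (fact j * fact (N - j))" .
    have bin: "1 / (fact j * fact (N - j)) = real (N choose j) / fact N"
      using binomial_fact[OF j, where 'a = real] by simp
    have "cmod (coeff (\<Prod>i\<in>{..N}-{j}. [:- x i, 1:]) k) \<le> 2 ^ card ({..N}-{j})"
      by (rule cmod_coeff_prod_linear_le) (use y1 in \<open>auto simp: x_def\<close>)
    also have "\<dots> = 2 ^ N" using j by simp
    finally have num: "cmod (coeff (\<Prod>i\<in>{..N}-{j}. [:- x i, 1:]) k) \<le> 2 ^ N" .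
    have "cmod (poly p (x j) / (\<Prod>i\<in>{..N}-{j}. x j - x i) * coeff (\<Prod>i\<in>{..N}-{j}. [:- x i, 1:]) k)
      = cmod (poly p (x j)) * cmod (coeff (\<Prod>i\<in>{..N}-{j}. [:- x i, 1:]) k) / ((2 / real N) ^ N * (fact j * fact (N - j)))"
      by (simp add: norm_mult norm_divide den)
    also have "\<dots> \<le> B * 2 ^ N / ((2 / real N) ^ N * (fact j * fact (N - j)))"
      by (intro divide_right_mono mult_mono num) (use B[OF y1[OF j]] B0 in \<open>auto simp: x_def\<close>)
    also have "\<dots> = B * 2 ^ N * (real N / 2) ^ N * (1 / (fact j * fact (N - j)))"
      by (simp add: power_divide)
    also have "\<dots> = B * 2 ^ N * (real N / 2) ^ N / fact N * (N choose j)"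
      unfolding bin by simp
    finally show "cmod (poly p (x j) / (\<Prod>i\<in>{..N}-{j}. x j - x i) * coeff (\<Prod>i\<in>{..N}-{j}. [:- x i, 1:]) k)
      \<le> B * 2 ^ N * (real N / 2) ^ N / fact N * (N choose j)" .
  qed
  also have "\<dots> = B * 2 ^ N * (real N / 2) ^ N / fact N * 2 ^ N"
    by (simp only: sum_distrib_left[symmetric] choose_row_sum of_nat_power of_nat_numeral flip: of_nat_sum)
  also have "\<dots> = 2 ^ N * (real N ^ N / fact N) * B"
    by (simp add: power_divide)
  also have "\<dots> \<le> 2 ^ N * exp 1 ^ N * B"
    by (intro mult_right_mono mult_left_mono B0) (use power_self_le_exp_fact[of N] in \<open>auto simp: divide_le_eq\<close>)
  finally show ?thesis by (simp add: power_mult_distrib)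
qed

text \<open>
  The primitive of \<open>p\<close> that vanishes at \<open>-1\<close> is a polynomial of degree at most \<open>N\<close> which is bounded on \<open>[-1,1]\<close> by the \<open>L\<^sup>1\<close> norm
  of \<open>p\<close>. So the \<open>L\<^sup>2\<close> bound reduces to the supremum bound for the primitive, at the price of a
  factor \<open>k + 1 \<le> N\<close> from differentiation.
\<close>

lemma cmod_coeff_le_l2norm:
  assumes k: "k < N"
  shows "cmod (t k) \<le> (4 * exp 1) ^ N * l2norm leb_I (\<lambda>x. \<Sum>k<N. t k * of_real x ^ k)"
proof -
  define p where "p x = (\<Sum>k<N. t k * complex_of_real x ^ k)" for x
  define S where "S z = (\<Sum>k<N. t k / of_nat (Suc k) * z ^ Suc k)" for z :: complex
  have contp: "continuous_on A p" for A
    unfolding p_def by (intro continuous_intros)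
  have sq: "square_integrable leb_I p"
    by (rule square_integrable_continuous_leb_I[OF contp])
  have deriv: "((\<lambda>x. S (of_real x)) has_vector_derivative p x) (at x within A)" for x A
  proof -
    have "((\<lambda>z. t k / of_nat (Suc k) * z ^ Suc k) has_field_derivative t k * complex_of_real x ^ k)
        (at (of_real x))" for k
    proof -
      have "((\<lambda>z. t k / of_nat (Suc k) * z ^ Suc k) has_field_derivative
          t k / of_nat (Suc k) * (of_nat (Suc k) * complex_of_real x ^ k)) (at (of_real x))"
        by (rule derivative_eq_intros refl | simp)+
      moreover have "complex_of_nat (Suc k) \<noteq> 0" by (simp only: of_nat_eq_0_iff)
      ultimately show ?thesis by (simp del: of_nat_Suc power_Suc)
    qed
    then have "(S has_field_derivative p x) (at (of_real x))"
      unfolding S_def p_def by (intro DERIV_sum)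
    then show ?thesis
      using has_vector_derivative_real_field has_vector_derivative_at_within by blast
  qed
  have bound: "cmod (S (of_real x) - S (-1)) \<le> sqrt 2 * l2norm leb_I p" if "\<bar>x\<bar> \<le> 1" for x
  proof -
    have x: "-1 \<le> x" "x \<le> 1" using that by auto
    have hi: "(p has_integral (S (of_real x) - S (of_real (-1)))) {-1..x}"
      by (intro fundamental_theorem_of_calculus x deriv)
    have "cmod (S (of_real x) - S (of_real (-1))) = cmod (integral {-1..x} p)"
      using hi by (simp add: integral_unique)
    also have "\<dots> \<le> integral {-1..x} (\<lambda>y. cmod (p y))"
      by (rule integral_norm_bound_integral)
         (auto intro!: integrable_continuous_interval continuous_intros contp)
    also have "\<dots> \<le> integral {-1..1} (\<lambda>y. cmod (p y))"
      by (rule integral_subset_le)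
         (use x in \<open>auto intro!: integrable_continuous_interval continuous_intros contp\<close>)
    also have "\<dots> = (\<integral>y. cmod (p y) \<partial>leb_I)"
      by (rule lebesgue_integral_eq_integral[symmetric])
         (auto intro!: integrable_norm integrable_of_square_integrable sq)
    also have "\<dots> \<le> sqrt 2 * l2norm leb_I p"
      by (rule l1_le_l2norm_leb_I[OF sq])
    finally show ?thesis by simp
  qed
  \<comment> \<open>The primitive as a polynomial: the coefficient of \<open>X ^ Suc k\<close> is \<open>t k / Suc k\<close>.\<close>
  define q where "q = (\<Sum>k<N. monom (t k / of_nat (Suc k)) (Suc k)) - [:S (-1):]"
  have "poly q z = S z - S (-1)" for z
    by (simp add: q_def S_def poly_sum poly_monom)
  moreover have "degree q \<le> N"
    unfolding q_def
    by (intro degree_diff_le degree_sum_le) (auto intro: order_trans[OF degree_monom_le])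
  ultimately have *: "cmod (coeff q (Suc k)) \<le> (2 * exp 1) ^ N * (sqrt 2 * l2norm leb_I p)"
    using k bound by (intro cmod_coeff_le_sup) auto
  have "coeff q (Suc k) = (\<Sum>l<N. if l = k then t l / of_nat (Suc l) else 0)"
    by (auto simp: q_def coeff_sum coeff_monom intro!: sum.cong)
  also have "\<dots> = t k / of_nat (Suc k)"
    using k by simp
  finally have "t k = of_nat (Suc k) * coeff q (Suc k)"
    by (simp del: of_nat_Suc)
  then have "cmod (t k) = real (Suc k) * cmod (coeff q (Suc k))"
    by (simp only: norm_mult norm_of_nat)
  also have "\<dots> \<le> real N * ((2 * exp 1) ^ N * (sqrt 2 * l2norm leb_I p))"
    using k by (intro mult_mono *) auto
  also have "\<dots> \<le> real N * ((2 * exp 1) ^ N * (2 * l2norm leb_I p))"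
    by (intro mult_left_mono mult_right_mono) (auto intro: real_le_lsqrt)
  also have "\<dots> = real (2 * N) * ((2 * exp 1) ^ N * l2norm leb_I p)" by simp
  also have "\<dots> \<le> 2 ^ N * ((2 * exp 1) ^ N * l2norm leb_I p)"
  proof (rule mult_right_mono)
    have "N \<ge> 1" using k by simp
    then have "2 * N \<le> 2 ^ N"
    proof (induction N rule: dec_induct)
      case (step n)
      have "2 * 1 \<le> (2::nat) ^ n" using step by linarith
      then show ?case using step.IH by simp
    qed simp
    then have "real (2 * N) \<le> real (2 ^ N)" by (rule of_nat_mono)
    then show "real (2 * N) \<le> 2 ^ N" by simp
  qed simp
  also have "\<dots> = (4 * exp 1) ^ N * l2norm leb_I p"
    using power_mult_distrib[of 2 "2 * exp (1::real)" N] by simp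
  finally show ?thesis unfolding p_def .
qed

section \<open>The finite Fourier transform and its Taylor expansion\<close>

definition moment :: "(real \<Rightarrow> complex) \<Rightarrow> nat \<Rightarrow> complex" where
  "moment h k = (\<integral>y. of_real y ^ k * h y \<partial>leb_I)"

lemma integrable_continuous_mult:
  assumes "continuous_on UNIV f" "square_integrable leb_I h"
  shows "integrable leb_I (\<lambda>y. f y * h y)"
  by (intro integrable_mult_square_integrable square_integrable_continuous_leb_I assms)

lemma integrable_Fop:
  "square_integrable leb_I h \<Longrightarrow> integrable leb_I (\<lambda>y. exp (\<i> * complex_of_real (c * x * y)) * h y)"
  by (intro integrable_continuous_mult continuous_intros)

lemma integrable_moment:
  "square_integrable leb_I h \<Longrightarrow> integrable leb_I (\<lambda>y. of_real y ^ k * h y)"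
  by (intro integrable_continuous_mult continuous_intros)

definition fourier_int :: "real \<Rightarrow> (real \<Rightarrow> complex) \<Rightarrow> real \<Rightarrow> complex" where
  "fourier_int R a \<xi> = (\<integral>x. exp (\<i> * complex_of_real (x * \<xi>)) * a x \<partial>lebesgue_on {-R..R})"

lemma integrable_fourier_int:
  assumes "integrable (lebesgue_on {-R..R}) a"
  shows "integrable (lebesgue_on {-R..R}) (\<lambda>x. exp (\<i> * complex_of_real (x * \<xi>)) * a x)"
proof (rule Bochner_Integration.integrable_bound[OF assms])
  have [measurable]: "a \<in> borel_measurable (lebesgue_on {-R..R})" using assms by auto
  note id_borel_measurable_leb_on[measurable]
  show "(\<lambda>x. exp (\<i> * complex_of_real (x * \<xi>)) * a x) \<in> borel_measurable (lebesgue_on {-R..R})"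
    by measurable
qed (simp add: norm_mult)

lemma continuous_on_fourier_int:
  assumes a: "integrable (lebesgue_on {-R..R}) a"
  shows "continuous_on UNIV (fourier_int R a)"
proof (rule continuous_at_imp_continuous_on, intro ballI)
  fix \<xi>
  have "(\<lambda>n. fourier_int R a (X n)) \<longlonglongrightarrow> fourier_int R a \<xi>" if X: "X \<longlonglongrightarrow> \<xi>" for X
    unfolding fourier_int_def
  proof (rule integral_dominated_convergence[where w = "\<lambda>y. cmod (a y)"])
    show "AE x in lebesgue_on {-R..R}. (\<lambda>n. exp (\<i> * complex_of_real (x * X n)) * a x) \<longlonglongrightarrow>
        exp (\<i> * complex_of_real (x * \<xi>)) * a x"
      by (intro AE_I2 tendsto_intros X)
    show "AE x in lebesgue_on {-R..R}. norm (exp (\<i> * complex_of_real (x * X n)) * a x) \<le> cmod (a x)" for n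
      by (simp add: norm_mult)
  qed (use integrable_fourier_int[OF a] a in auto)
  then show "isCont (fourier_int R a) \<xi>"
    by (simp add: continuous_at_sequentially o_def)
qed

lemma Fop_eq_fourier_int: "Fop c h x = fourier_int 1 h (c * x)"
  by (simp add: Fop_def fourier_int_def mult_ac)

lemma continuous_on_Fop:
  assumes "square_integrable leb_I h"
  shows "continuous_on UNIV (Fop c h)"
proof -
  have "integrable leb_I h" by (rule integrable_of_square_integrable[OF _ assms]) simp
  then have "continuous_on UNIV (fourier_int 1 h)" by (intro continuous_on_fourier_int) simp
  then show ?thesis
    unfolding Fop_eq_fourier_int[abs_def]
    by (rule continuous_on_compose2) (auto intro!: continuous_intros)
qed

lemma square_integrable_Fop: "square_integrable leb_I h \<Longrightarrow> square_integrable leb_I (Fop c h)"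
  by (rule square_integrable_continuous_leb_I[OF continuous_on_Fop])

text \<open>
  The kernel \<open>exp (\<i> c x y)\<close> is expanded in powers of \<open>x y\<close> under the integral, so that the moments of \<open>h\<close> appear as
  Taylor coefficients. The bound holds for all real \<open>x\<close>: it serves both for the operator on \<open>[-1,1]\<close> and for the Fourier transform
  of \<open>h\<close> at frequencies outside that interval.
\<close>

lemma cmod_Fop_minus_Taylor_le:
  assumes h: "square_integrable leb_I h" and N: "N \<ge> 1"
  shows "cmod (Fop c h x - (\<Sum>k<N. (\<i> * of_real (c * x)) ^ k / fact k * moment h k))
    \<le> \<bar>c * x\<bar> ^ N / fact N * (sqrt 2 * l2norm leb_I h)"
proof -
  obtain n where n: "N = Suc n" using N by (cases N) auto
  have "(\<Sum>k<N. (\<i> * of_real (c * x)) ^ k / fact k * moment h k)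
      = (\<integral>y. (\<Sum>k<N. (\<i> * of_real (c * x)) ^ k / fact k * (of_real y ^ k * h y)) \<partial>leb_I)"
    unfolding moment_def using integrable_moment[OF h]
    by (subst Bochner_Integration.integral_sum) auto
  then have "Fop c h x - (\<Sum>k<N. (\<i> * of_real (c * x)) ^ k / fact k * moment h k)
      = (\<integral>y. exp (\<i> * complex_of_real (c * x * y)) * h y
          - (\<Sum>k<N. (\<i> * of_real (c * x)) ^ k / fact k * (of_real y ^ k * h y)) \<partial>leb_I)"
    unfolding Fop_def using integrable_moment[OF h] integrable_Fop[OF h]
    by (subst Bochner_Integration.integral_diff) auto
  also have "\<dots> = (\<integral>y. (exp (\<i> * complex_of_real (c * x * y))
      - (\<Sum>k\<le>n. (\<i> * of_real (c * x * y)) ^ k / fact k)) * h y \<partial>leb_I)"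
    by (intro Bochner_Integration.integral_cong refl)
       (simp add: n lessThan_Suc_atMost left_diff_distrib right_diff_distrib sum_distrib_left sum_distrib_right power_mult_distrib mult_ac)
  also have "cmod \<dots> \<le> (\<integral>y. \<bar>c * x\<bar> ^ N / fact N * cmod (h y) \<partial>leb_I)"
  proof (rule order_trans[OF integral_norm_bound integral_mono[OF integrable_norm]])
    show "integrable leb_I (\<lambda>y. (exp (\<i> * complex_of_real (c * x * y))
      - (\<Sum>k\<le>n. (\<i> * of_real (c * x * y)) ^ k / fact k)) * h y)"
      by (intro integrable_continuous_mult continuous_intros h) auto
    show "integrable leb_I (\<lambda>y. \<bar>c * x\<bar> ^ N / fact N * cmod (h y))"
      by (intro integrable_mult_right integrable_norm integrable_of_square_integrable h) simp
    fix y assume "y \<in> space leb_I"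
    then have y: "\<bar>y\<bar> \<le> 1" by (simp add: abs_le_iff)
    have "cmod (exp (\<i> * complex_of_real (c * x * y)) - (\<Sum>k\<le>n. (\<i> * of_real (c * x * y)) ^ k / fact k))
        \<le> \<bar>c * x * y\<bar> ^ N / fact N"
      unfolding n by (rule iexp_approx1)
    also have "\<dots> \<le> \<bar>c * x\<bar> ^ N / fact N"
      using y by (intro divide_right_mono power_mono) (auto simp: abs_mult intro: mult_left_le)
    finally show "norm ((exp (\<i> * complex_of_real (c * x * y))
      - (\<Sum>k\<le>n. (\<i> * of_real (c * x * y)) ^ k / fact k)) * h y) \<le> \<bar>c * x\<bar> ^ N / fact N * cmod (h y)"
      unfolding norm_mult by (rule mult_right_mono) simp
  qed
  also have "\<dots> = \<bar>c * x\<bar> ^ N / fact N * (\<integral>y. cmod (h y) \<partial>leb_I)" by simp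
  also have "\<dots> \<le> \<bar>c * x\<bar> ^ N / fact N * (sqrt 2 * l2norm leb_I h)"
    by (intro mult_left_mono l1_le_l2norm_leb_I h) simp
  finally show ?thesis .
qed

lemma l2norm_Fop_minus_Taylor_le:
  assumes h: "square_integrable leb_I h" and N: "N \<ge> 1" and c: "c > 0"
  shows "l2norm leb_I (\<lambda>x. Fop c h x - (\<Sum>k<N. (\<i> * of_real (c * x)) ^ k / fact k * moment h k))
    \<le> 2 * c ^ N / fact N * l2norm leb_I h"
proof -
  have "l2norm leb_I (\<lambda>x. Fop c h x - (\<Sum>k<N. (\<i> * of_real (c * x)) ^ k / fact k * moment h k))
    \<le> sqrt 2 * (c ^ N / fact N * (sqrt 2 * l2norm leb_I h))"
  proof (rule l2norm_leb_I_le_bound)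
    show "(\<lambda>x. Fop c h x - (\<Sum>k<N. (\<i> * of_real (c * x)) ^ k / fact k * moment h k)) \<in> borel_measurable leb_I"
      by (intro borel_measurable_continuous_leb_on continuous_intros continuous_on_Fop h) auto
    fix x :: real assume x: "x \<in> {-1..1}"
    have "\<bar>c * x\<bar> ^ N \<le> c ^ N"
      using x c by (intro power_mono) (auto simp: abs_mult abs_le_iff intro!: mult_left_le)
    then have "\<bar>c * x\<bar> ^ N / fact N * (sqrt 2 * l2norm leb_I h) \<le> c ^ N / fact N * (sqrt 2 * l2norm leb_I h)"
      by (intro mult_right_mono divide_right_mono) auto
    then show "cmod (Fop c h x - (\<Sum>k<N. (\<i> * of_real (c * x)) ^ k / fact k * moment h k))
      \<le> c ^ N / fact N * (sqrt 2 * l2norm leb_I h)"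
      using cmod_Fop_minus_Taylor_le[OF h N, of c x] by linarith
  qed
  also have "\<dots> = 2 * c ^ N / fact N * l2norm leb_I h" by simp
  finally show ?thesis .
qed

text \<open>
  This is the central inequality: the Taylor polynomial of \<open>Fop c h\<close> differs from \<open>Fop c h\<close> by little, so its norm is controlled
  by that of \<open>Fop c h\<close>, and therefore so are its coefficients. The number \<open>N\<close> of terms is free, so that \<open>N!\<close> can be
  made to dominate the other factors.
\<close>

lemma cmod_moment_le:
  assumes h: "square_integrable leb_I h" and k: "k < N" and c: "c > 0"
  shows "c ^ k / fact k * cmod (moment h k)
    \<le> (4 * exp 1) ^ N * (l2norm leb_I (Fop c h) + 2 * c ^ N / fact N * l2norm leb_I h)"
proof -
  define T where "T x = (\<Sum>k<N. (\<i> * of_real (c * x)) ^ k / fact k * moment h k)" for x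
  define t where "t k = (\<i> * of_real c) ^ k / fact k * moment h k" for k
  have Tt: "T = (\<lambda>x. \<Sum>k<N. t k * of_real x ^ k)"
    by (simp add: fun_eq_iff T_def t_def power_mult_distrib mult_ac)
  have sqT: "square_integrable leb_I T"
    unfolding T_def by (intro square_integrable_continuous_leb_I continuous_intros) auto
  have "l2norm leb_I T \<le> l2norm leb_I (Fop c h) + l2norm leb_I (\<lambda>x. T x - Fop c h x)"
    by (intro l2norm_triangle_diff sqT square_integrable_Fop h)
  also have "l2norm leb_I (\<lambda>x. T x - Fop c h x) = l2norm leb_I (\<lambda>x. Fop c h x - T x)"
    by (rule l2norm_minus_commute)
  also have "\<dots> \<le> 2 * c ^ N / fact N * l2norm leb_I h"
    unfolding T_def by (rule l2norm_Fop_minus_Taylor_le) (use assms in auto)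
  finally have "l2norm leb_I T \<le> l2norm leb_I (Fop c h) + 2 * c ^ N / fact N * l2norm leb_I h"
    by simp
  moreover have "cmod (t k) \<le> (4 * exp 1) ^ N * l2norm leb_I T"
    unfolding Tt by (rule cmod_coeff_le_l2norm[OF k])
  ultimately have "cmod (t k) \<le> (4 * exp 1) ^ N * (l2norm leb_I (Fop c h) + 2 * c ^ N / fact N * l2norm leb_I h)"
    by (meson exp_ge_zero mult_left_mono mult_nonneg_nonneg order_trans zero_le_numeral zero_le_power)
  then show ?thesis
    using c by (simp add: t_def norm_mult norm_divide norm_power)
qed

section \<open>Underdetermined linear systems\<close>

text \<open>
  Induction on the number of equations: if the last equation is not void, it is solved for one unknown, which is eliminated from the
  other ones. The pivot column \<open>m\<close> is exchanged with the last one by a transposition, so that the remaining unknowns are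
  again indexed by an initial segment.
\<close>

lemma exists_nontrivial_solution:
  fixes L :: "nat \<Rightarrow> nat \<Rightarrow> complex"
  shows "\<exists>a. (\<exists>k\<le>n. a k \<noteq> 0) \<and> (\<forall>i<n. (\<Sum>k\<le>n. L i k * a k) = 0)"
proof (induction n arbitrary: L)
  case 0
  then show ?case by (intro exI[of _ "\<lambda>_. 1"]) simp
next
  case (Suc n)
  show ?case
  proof (cases "\<forall>k\<le>Suc n. L n k = 0")
    case True
    obtain a where a: "\<exists>k\<le>n. a k \<noteq> 0" "\<forall>i<n. (\<Sum>k\<le>n. L i k * a k) = 0"
      using Suc.IH[of L] by blast
    show ?thesis
    proof (intro exI[of _ "a(Suc n := 0)"] conjI allI impI)
      show "\<exists>k\<le>Suc n. (a(Suc n := 0)) k \<noteq> 0"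
        using a(1) by (metis Suc_n_not_le_n fun_upd_apply le_SucI)
      fix i assume "i < Suc n"
      then consider "i < n" | "i = n" by linarith
      then show "(\<Sum>k\<le>Suc n. L i k * (a(Suc n := 0)) k) = 0"
      proof cases
        case 1
        have "(\<Sum>k\<le>n. L i k * (a(Suc n := 0)) k) = (\<Sum>k\<le>n. L i k * a k)"
          by (intro sum.cong) auto
        then show ?thesis using a(2) 1 by simp
      next
        case 2
        then show ?thesis using True by (intro sum.neutral) auto
      qed
    qed
  next
    case False
    then obtain m where m: "m \<le> Suc n" "L n m \<noteq> 0" by auto
    define e where "e = Transposition.transpose m (Suc n)"
    have e: "bij_betw e {..Suc n} {..Suc n}"
      unfolding e_def using m(1) by (intro bij_betwI[where g = "Transposition.transpose m (Suc n)"]) (auto simp: Transposition.transpose_def)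
    have em: "e (Suc n) = m" by (simp add: e_def)
    define L' where "L' i k = L i (e k) - L i m * L n (e k) / L n m" for i k
    obtain b where b: "\<exists>k\<le>n. b k \<noteq> 0" "\<forall>i<n. (\<Sum>k\<le>n. L' i k * b k) = 0"
      using Suc.IH[of L'] by blast
    \<comment> \<open>The value of the eliminated unknown is dictated by the last equation.\<close>
    define b' where "b' = b(Suc n := - (\<Sum>k\<le>n. L n (e k) * b k) / L n m)"
    have sum_b': "(\<Sum>k\<le>Suc n. L i (e k) * b' k)
        = (\<Sum>k\<le>n. L i (e k) * b k) - L i m * (\<Sum>k\<le>n. L n (e k) * b k) / L n m" for i
    proof -
      have "(\<Sum>k\<le>n. L i (e k) * b' k) = (\<Sum>k\<le>n. L i (e k) * b k)"
        by (intro sum.cong) (auto simp: b'_def)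
      then show ?thesis by (simp add: b'_def em)
    qed
    have zero: "(\<Sum>k\<le>Suc n. L i (e k) * b' k) = 0" if "i < Suc n" for i
    proof (cases "i = n")
      case True
      then show ?thesis using m by (simp only: sum_b') simp
    next
      case False
      then have "0 = (\<Sum>k\<le>n. L' i k * b k)" using b(2) that by auto
      also have "\<dots> = (\<Sum>k\<le>n. L i (e k) * b k) - L i m * (\<Sum>k\<le>n. L n (e k) * b k) / L n m"
        by (simp add: L'_def left_diff_distrib sum_subtractf sum_distrib_left sum_divide_distrib mult.assoc)
      finally show ?thesis by (simp only: sum_b')
    qed
    define a where "a k = b' (e k)" for k
    have ee: "e (e k) = k" for k by (simp add: e_def)
    show ?thesis
    proof (intro exI[of _ a] conjI allI impI)
      obtain k where "k \<le> n" "b k \<noteq> 0" using b(1) by auto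
      then have "e k \<le> Suc n \<and> a (e k) \<noteq> 0"
        using bij_betwE[OF e] by (auto simp: a_def ee b'_def)
      then show "\<exists>k\<le>Suc n. a k \<noteq> 0" by blast
      fix i assume i: "i < Suc n"
      have "(\<Sum>k\<le>Suc n. L i k * a k) = (\<Sum>k\<le>Suc n. L i (e k) * a (e k))"
        using sum.reindex_bij_betw[OF e, of "\<lambda>k. L i k * a k"] by simp
      then show "(\<Sum>k\<le>Suc n. L i k * a k) = 0"
        using zero[OF i] by (simp add: a_def ee)
    qed
  qed
qed

section \<open>Expansion in eigenfunctions\<close>

lemma integrable_pair_mult_bounded_kernel:
  fixes a :: "'a \<Rightarrow> complex" and b :: "'b \<Rightarrow> complex"
  assumes "sigma_finite_measure M1" "sigma_finite_measure M2"
    and a: "integrable M1 a" and b: "integrable M2 b"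
    and k: "k \<in> borel_measurable (M1 \<Otimes>\<^sub>M M2)" "\<And>z. cmod (k z) \<le> 1"
  shows "integrable (M1 \<Otimes>\<^sub>M M2) (\<lambda>(x, y). k (x, y) * (a x * b y))"
proof -
  interpret pair_sigma_finite M1 M2
    using assms by (simp add: pair_sigma_finite_def)
  have [measurable]: "a \<in> borel_measurable M1" "b \<in> borel_measurable M2"
    "k \<in> borel_measurable (M1 \<Otimes>\<^sub>M M2)"
    using a b k by auto
  have "integrable (M1 \<Otimes>\<^sub>M M2) (\<lambda>(x, y). a x * b y)"
  proof (rule Fubini_integrable)
    show "integrable M1 (\<lambda>x. \<integral>y. norm (case (x, y) of (x, y) \<Rightarrow> a x * b y) \<partial>M2)"
      using integrable_mult_left[OF integrable_norm[OF a], of "\<integral>y. norm (b y) \<partial>M2"]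
      by (simp add: norm_mult)
    show "AE x in M1. integrable M2 (\<lambda>y. case (x, y) of (x, y) \<Rightarrow> a x * b y)"
      using b by simp
  qed measurable
  then show ?thesis
  proof (rule Bochner_Integration.integrable_bound)
    show "AE z in M1 \<Otimes>\<^sub>M M2. norm (case z of (x, y) \<Rightarrow> k (x, y) * (a x * b y))
        \<le> norm (case z of (x, y) \<Rightarrow> a x * b y)"
      using k(2) by (intro AE_I2) (auto simp: norm_mult intro!: mult_left_le_one_le)
  qed measurable
qed

text \<open>
  The kernel \<open>exp (\<i> c x y)\<close> is symmetric in \<open>x\<close> and \<open>y\<close>, and Fubini applies since it is bounded.
\<close>

lemma integral_Fop_symmetric:
  assumes "square_integrable leb_I f" "square_integrable leb_I g"
  shows "(\<integral>x. g x * Fop c f x \<partial>leb_I) = (\<integral>y. Fop c g y * f y \<partial>leb_I)"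
proof -
  interpret finite_measure leb_I by simp
  interpret P: pair_sigma_finite leb_I leb_I ..
  define k where "k = (\<lambda>(x, y). exp (\<i> * complex_of_real (c * x * y)))"
  note id_borel_measurable_leb_on[measurable]
  have [measurable]: "k \<in> borel_measurable (leb_I \<Otimes>\<^sub>M leb_I)"
    unfolding k_def by measurable
  have int: "integrable (leb_I \<Otimes>\<^sub>M leb_I) (\<lambda>(x, y). k (x, y) * (g x * f y))"
    by (rule integrable_pair_mult_bounded_kernel)
       (use assms integrable_of_square_integrable[OF finite_measure_leb_on]
        in \<open>auto intro: sigma_finite_measure_axioms simp: k_def\<close>)
  have "(\<integral>x. g x * Fop c f x \<partial>leb_I) = (\<integral>x. (\<integral>y. k (x, y) * (g x * f y) \<partial>leb_I) \<partial>leb_I)"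
    unfolding Fop_def integral_mult_right_zero[symmetric]
    by (intro Bochner_Integration.integral_cong refl) (simp add: k_def mult_ac)
  also have "\<dots> = (\<integral>y. (\<integral>x. k (x, y) * (g x * f y) \<partial>leb_I) \<partial>leb_I)"
    using P.Fubini_integral[of "\<lambda>x y. k (x, y) * (g x * f y)"] int by simp
  also have "\<dots> = (\<integral>y. Fop c g y * f y \<partial>leb_I)"
    unfolding Fop_def integral_mult_left_zero[symmetric]
    by (intro Bochner_Integration.integral_cong refl) (simp add: k_def mult_ac)
  finally show ?thesis .
qed

lemma moment_sum:
  assumes "finite A" "\<And>j. j \<in> A \<Longrightarrow> square_integrable leb_I (g j)"
  shows "moment (\<lambda>x. \<Sum>j\<in>A. a j * g j x) k = (\<Sum>j\<in>A. a j * moment (g j) k)"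
proof -
  have "moment (\<lambda>x. \<Sum>j\<in>A. a j * g j x) k = (\<integral>x. (\<Sum>j\<in>A. a j * (of_real x ^ k * g j x)) \<partial>leb_I)"
    unfolding moment_def sum_distrib_left
    by (intro Bochner_Integration.integral_cong refl) (simp add: mult_ac)
  also have "\<dots> = (\<Sum>j\<in>A. a j * moment (g j) k)"
    unfolding moment_def using integrable_moment assms
    by (subst Bochner_Integration.integral_sum) auto
  finally show ?thesis .
qed

locale pswf =
  fixes c :: real and \<psi> :: "nat \<Rightarrow> real \<Rightarrow> real" and ev :: "nat \<Rightarrow> complex"
  assumes c_pos: "c > 0" and pswf_system: "is_pswf_system c \<psi> ev"
begin

abbreviation \<Psi> :: "nat \<Rightarrow> real \<Rightarrow> complex" where "\<Psi> j x \<equiv> complex_of_real (\<psi> j x)"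

lemma square_integrable_\<Psi>: "square_integrable leb_I (\<Psi> j)"
  and orthonormal: "(\<integral>x. \<psi> j x * \<psi> k x \<partial>leb_I) = (if j = k then 1 else 0)"
  and expansion: "square_integrable leb_I f \<Longrightarrow>
    (\<lambda>n. l2norm leb_I (\<lambda>x. f x - (\<Sum>j\<le>n. pswf_coeff \<psi> f j * \<Psi> j x))) \<longlonglongrightarrow> 0"
  and eigenfunction: "AE x in leb_I. Fop c (\<Psi> j) x = ev j * \<Psi> j x"
  using pswf_system unfolding is_pswf_system_def by blast+

lemma ev_antimono: "i \<le> j \<Longrightarrow> cmod (ev j) \<le> cmod (ev i)"
proof (erule lift_Suc_antimono_le[of "\<lambda>i. cmod (ev i)", rotated])
  show "cmod (ev (Suc i)) \<le> cmod (ev i)" for i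
    using pswf_system unfolding is_pswf_system_def by (blast intro: less_imp_le)
qed

lemma ev_pos: "0 < cmod (ev j)"
proof -
  have "0 < cmod (ev (Suc j))" "cmod (ev (Suc j)) < cmod (ev j)"
    using pswf_system by (simp_all add: is_pswf_system_def)
  then show ?thesis by (rule less_trans)
qed

lemma square_integrable_comb: "square_integrable leb_I (\<lambda>x. \<Sum>j\<in>A. a j * \<Psi> j x)"
  by (intro square_integrable_sum square_integrable_cmult square_integrable_\<Psi>)

lemma pswf_coeff_diff:
  assumes "square_integrable leb_I f" "square_integrable leb_I g"
  shows "pswf_coeff \<psi> (\<lambda>x. f x - g x) j = pswf_coeff \<psi> f j - pswf_coeff \<psi> g j"
  unfolding pswf_coeff_def right_diff_distrib
  by (intro Bochner_Integration.integral_diff integrable_mult_square_integrable square_integrable_\<Psi> assms)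

lemma pswf_coeff_sum:
  assumes "\<And>k. k \<in> A \<Longrightarrow> square_integrable leb_I (g k)"
  shows "pswf_coeff \<psi> (\<lambda>x. \<Sum>k\<in>A. a k * g k x) j = (\<Sum>k\<in>A. a k * pswf_coeff \<psi> (g k) j)"
proof -
  have int: "integrable leb_I (\<lambda>x. \<Psi> j x * g k x)" if "k \<in> A" for k
    by (intro integrable_mult_square_integrable square_integrable_\<Psi> assms that)
  have "pswf_coeff \<psi> (\<lambda>x. \<Sum>k\<in>A. a k * g k x) j = (\<integral>x. (\<Sum>k\<in>A. a k * (\<Psi> j x * g k x)) \<partial>leb_I)"
    unfolding pswf_coeff_def sum_distrib_left
    by (intro Bochner_Integration.integral_cong refl) (simp add: mult_ac)
  also have "\<dots> = (\<Sum>k\<in>A. a k * pswf_coeff \<psi> (g k) j)"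
    unfolding pswf_coeff_def using int by (subst Bochner_Integration.integral_sum) auto
  finally show ?thesis .
qed

lemma pswf_coeff_\<Psi>: "pswf_coeff \<psi> (\<Psi> k) j = (if k = j then 1 else 0)"
proof -
  have "pswf_coeff \<psi> (\<Psi> k) j = complex_of_real (\<integral>x. \<psi> j x * \<psi> k x \<partial>leb_I)"
    unfolding pswf_coeff_def of_real_mult[symmetric] by (rule integral_complex_of_real)
  then show ?thesis by (simp add: orthonormal)
qed

lemma pswf_coeff_comb:
  assumes "finite A"
  shows "pswf_coeff \<psi> (\<lambda>x. \<Sum>k\<in>A. a k * \<Psi> k x) j = (if j \<in> A then a j else 0)"
  using assms by (simp add: pswf_coeff_sum[OF square_integrable_\<Psi>] pswf_coeff_\<Psi> if_distrib cong: if_cong)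

lemma integral_comb_mult:
  assumes "square_integrable leb_I f"
  shows "(\<integral>x. (\<Sum>j\<in>A. a j * \<Psi> j x) * f x \<partial>leb_I) = (\<Sum>j\<in>A. a j * pswf_coeff \<psi> f j)"
proof -
  have int: "integrable leb_I (\<lambda>x. \<Psi> k x * f x)" for k
    by (intro integrable_mult_square_integrable square_integrable_\<Psi> assms)
  have "(\<integral>x. (\<Sum>j\<in>A. a j * \<Psi> j x) * f x \<partial>leb_I) = (\<integral>x. (\<Sum>j\<in>A. a j * (\<Psi> j x * f x)) \<partial>leb_I)"
    unfolding sum_distrib_right mult.assoc ..
  also have "\<dots> = (\<Sum>j\<in>A. a j * pswf_coeff \<psi> f j)"
    unfolding pswf_coeff_def using int by (subst Bochner_Integration.integral_sum) auto
  finally show ?thesis .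
qed

lemma l2norm_comb:
  assumes "finite A"
  shows "(l2norm leb_I (\<lambda>x. \<Sum>j\<in>A. a j * \<Psi> j x))\<^sup>2 = (\<Sum>j\<in>A. (cmod (a j))\<^sup>2)"
proof -
  have "complex_of_real ((l2norm leb_I (\<lambda>x. \<Sum>j\<in>A. a j * \<Psi> j x))\<^sup>2)
      = (\<integral>x. (\<Sum>j\<in>A. cnj (a j) * \<Psi> j x) * (\<Sum>j\<in>A. a j * \<Psi> j x) \<partial>leb_I)"
    unfolding complex_l2norm_power2 by simp
  also have "\<dots> = (\<Sum>j\<in>A. cnj (a j) * a j)"
    unfolding integral_comb_mult[OF square_integrable_comb] pswf_coeff_comb[OF assms]
    by (intro sum.cong) auto
  also have "\<dots> = complex_of_real (\<Sum>j\<in>A. (cmod (a j))\<^sup>2)"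
    by (simp add: complex_norm_square mult.commute del: of_real_power)
  finally show ?thesis by (simp only: of_real_eq_iff)
qed

text \<open>
  The partial sums converge to \<open>f\<close> in norm, hence their norms converge to that of \<open>f\<close>.
\<close>

lemma Parseval_pswf:
  assumes f: "square_integrable leb_I f"
  shows "(\<lambda>n. \<Sum>j\<le>n. (cmod (pswf_coeff \<psi> f j))\<^sup>2) \<longlonglongrightarrow> (l2norm leb_I f)\<^sup>2"
proof -
  define P where "P n = (\<lambda>x. \<Sum>j\<le>n. pswf_coeff \<psi> f j * \<Psi> j x)" for n
  have sqP: "square_integrable leb_I (P n)" for n
    unfolding P_def by (rule square_integrable_comb)
  have lim: "(\<lambda>n. l2norm leb_I (\<lambda>x. f x - P n x)) \<longlonglongrightarrow> 0"
    unfolding P_def by (rule expansion[OF f])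
  have "(\<lambda>n. l2norm leb_I (P n)) \<longlonglongrightarrow> l2norm leb_I f"
  proof (rule Lim_transform)
    show "(\<lambda>n. l2norm leb_I (P n) - l2norm leb_I f) \<longlonglongrightarrow> 0"
    proof (rule Lim_null_comparison[OF always_eventually lim], rule allI)
      fix n
      show "norm (l2norm leb_I (P n) - l2norm leb_I f) \<le> l2norm leb_I (\<lambda>x. f x - P n x)"
        using l2norm_triangle_diff[OF f sqP[of n]] l2norm_triangle_diff[OF sqP[of n] f]
          l2norm_minus_commute[of leb_I f "P n"] by auto
    qed
  qed simp
  then have "(\<lambda>n. (l2norm leb_I (P n))\<^sup>2) \<longlonglongrightarrow> (l2norm leb_I f)\<^sup>2"
    by (rule tendsto_power)
  then show ?thesis by (simp add: P_def l2norm_comb)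
qed

lemma Bessel_pswf:
  assumes "square_integrable leb_I f" "finite A"
  shows "(\<Sum>j\<in>A. (cmod (pswf_coeff \<psi> f j))\<^sup>2) \<le> (l2norm leb_I f)\<^sup>2"
proof -
  obtain n where "A \<subseteq> {..n}" using assms(2) finite_nat_iff_bounded_le by blast
  then have "(\<Sum>j\<in>A. (cmod (pswf_coeff \<psi> f j))\<^sup>2) \<le> (\<Sum>j\<le>n. (cmod (pswf_coeff \<psi> f j))\<^sup>2)"
    by (intro sum_mono2) auto
  also have "\<dots> \<le> (l2norm leb_I f)\<^sup>2"
    by (rule incseq_le[OF _ Parseval_pswf[OF assms(1)]]) (auto simp: incseq_def intro!: sum_mono2)
  finally show ?thesis .
qed

lemma pswf_coeff_Fop:
  assumes f: "square_integrable leb_I f"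
  shows "pswf_coeff \<psi> (Fop c f) j = ev j * pswf_coeff \<psi> f j"
proof -
  have "pswf_coeff \<psi> (Fop c f) j = (\<integral>y. Fop c (\<Psi> j) y * f y \<partial>leb_I)"
    unfolding pswf_coeff_def by (rule integral_Fop_symmetric[OF f square_integrable_\<Psi>])
  also have "\<dots> = (\<integral>y. (ev j * \<Psi> j y) * f y \<partial>leb_I)"
  proof (rule integral_cong_AE)
    show "AE y in leb_I. Fop c (\<Psi> j) y * f y = ev j * \<Psi> j y * f y"
      using eigenfunction[of j] by eventually_elim simp
    show "(\<lambda>y. Fop c (\<Psi> j) y * f y) \<in> borel_measurable leb_I"
      "(\<lambda>y. (ev j * \<Psi> j y) * f y) \<in> borel_measurable leb_I"
      using square_integrable_measurable[OF f] square_integrable_measurable[OF square_integrable_\<Psi>[of j]]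
        square_integrable_measurable[OF square_integrable_Fop[OF square_integrable_\<Psi>[of j], of c]]
      by (auto intro!: borel_measurable_times)
  qed
  also have "\<dots> = ev j * pswf_coeff \<psi> f j"
    unfolding pswf_coeff_def by (simp add: mult.assoc)
  finally show ?thesis .
qed

text \<open>
  On the coefficients \<open>Fop c\<close> acts as multiplication by the eigenvalues, of which only those with index at least \<open>n\<close> matter here.
\<close>

lemma l2norm_Fop_le:
  assumes f: "square_integrable leb_I f" and orth: "\<And>j. j < n \<Longrightarrow> pswf_coeff \<psi> f j = 0"
  shows "l2norm leb_I (Fop c f) \<le> cmod (ev n) * l2norm leb_I f"
proof -
  have "(l2norm leb_I (Fop c f))\<^sup>2 \<le> (cmod (ev n) * l2norm leb_I f)\<^sup>2"
  proof (rule LIMSEQ_le_const2[OF Parseval_pswf[OF square_integrable_Fop[OF f]]], intro exI allI impI)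
    fix m
    have "(\<Sum>j\<le>m. (cmod (pswf_coeff \<psi> (Fop c f) j))\<^sup>2) \<le> (\<Sum>j\<le>m. (cmod (ev n))\<^sup>2 * (cmod (pswf_coeff \<psi> f j))\<^sup>2)"
    proof (rule sum_mono)
      fix j
      show "(cmod (pswf_coeff \<psi> (Fop c f) j))\<^sup>2 \<le> (cmod (ev n))\<^sup>2 * (cmod (pswf_coeff \<psi> f j))\<^sup>2"
      proof (cases "j < n")
        case False
        then have "cmod (ev j) \<le> cmod (ev n)" by (intro ev_antimono) simp
        then show ?thesis
          by (simp add: pswf_coeff_Fop[OF f] norm_mult power_mult_distrib mult_right_mono power_mono)
      qed (simp add: pswf_coeff_Fop[OF f] orth)
    qed
    also have "\<dots> \<le> (cmod (ev n))\<^sup>2 * (l2norm leb_I f)\<^sup>2"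
      unfolding sum_distrib_left[symmetric] by (intro mult_left_mono Bessel_pswf[OF f]) auto
    finally show "(\<Sum>j\<le>m. (cmod (pswf_coeff \<psi> (Fop c f) j))\<^sup>2) \<le> (cmod (ev n) * l2norm leb_I f)\<^sup>2"
      by (simp add: power_mult_distrib)
  qed
  then show ?thesis by (rule power2_le_imp_le) simp
qed

text \<open>
  One direction of the min-max principle. Among the combinations of \<open>n + 1\<close> eigenfunctions there is some \<open>u \<noteq> 0\<close> whose first \<open>n\<close>
  moments vanish, so its image is just the Taylor remainder; on the other hand, \<open>Fop c\<close> shrinks no such combination by more than the factor
  \<open>\<bar>ev n\<bar>\<close>.
\<close>

lemma cmod_ev_le:
  assumes n: "n \<ge> 1"
  shows "cmod (ev n) \<le> 2 * c ^ n / fact n"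
proof -
  obtain a where a: "\<exists>j\<le>n. a j \<noteq> 0" "\<forall>k<n. (\<Sum>j\<le>n. moment (\<Psi> j) k * a j) = 0"
    using exists_nontrivial_solution[of n "\<lambda>k j. moment (\<Psi> j) k"] by auto
  define u where "u = (\<lambda>x. \<Sum>j\<le>n. a j * \<Psi> j x)"
  have sq: "square_integrable leb_I u" unfolding u_def by (rule square_integrable_comb)
  have mom: "moment u k = 0" if "k < n" for k
    using a(2) that by (simp add: u_def moment_sum square_integrable_\<Psi> mult.commute)
  have coeff: "pswf_coeff \<psi> u j = (if j \<le> n then a j else 0)" for j
    by (simp add: u_def pswf_coeff_comb)
  have nrm: "(l2norm leb_I u)\<^sup>2 = (\<Sum>j\<le>n. (cmod (a j))\<^sup>2)"
    unfolding u_def by (rule l2norm_comb) simp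
  obtain i where i: "i \<le> n" "a i \<noteq> 0" using a(1) by blast
  have "0 < (cmod (a i))\<^sup>2" using i by simp
  also have "\<dots> \<le> (l2norm leb_I u)\<^sup>2"
    unfolding nrm by (rule member_le_sum) (use i in auto)
  finally have pos: "0 < l2norm leb_I u"
    by (metis l2norm_nonneg less_eq_real_def less_irrefl power_zero_numeral)
  have "(cmod (ev n) * l2norm leb_I u)\<^sup>2 = (\<Sum>j\<le>n. (cmod (ev n))\<^sup>2 * (cmod (a j))\<^sup>2)"
    by (simp add: power_mult_distrib nrm sum_distrib_left)
  also have "\<dots> \<le> (\<Sum>j\<le>n. (cmod (pswf_coeff \<psi> (Fop c u) j))\<^sup>2)"
    by (intro sum_mono) (auto simp: pswf_coeff_Fop[OF sq] coeff norm_mult power_mult_distrib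
        intro!: mult_right_mono power_mono ev_antimono)
  also have "\<dots> \<le> (l2norm leb_I (Fop c u))\<^sup>2"
    by (intro Bessel_pswf square_integrable_Fop sq) simp
  finally have "cmod (ev n) * l2norm leb_I u \<le> l2norm leb_I (Fop c u)"
    by (rule power2_le_imp_le) simp
  also have "\<dots> \<le> 2 * c ^ n / fact n * l2norm leb_I u"
    using l2norm_Fop_minus_Taylor_le[OF sq n c_pos] by (simp add: mom)
  finally show ?thesis using pos by (rule mult_right_le_imp_le)
qed

lemma l2norm_Finv_le:
  assumes r: "square_integrable leb_I r"
  shows "l2norm leb_I (Finv \<psi> ev n r) \<le> l2norm leb_I r / cmod (ev n)"
proof (rule power2_le_imp_le)
  define b where "b j = pswf_coeff \<psi> r j / ev j" for j
  have "Finv \<psi> ev n r = (\<lambda>x. \<Sum>j\<le>n. b j * \<Psi> j x)"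
    by (simp add: fun_eq_iff Finv_def b_def mult.commute)
  then have "(l2norm leb_I (Finv \<psi> ev n r))\<^sup>2 = (\<Sum>j\<le>n. (cmod (b j))\<^sup>2)"
    by (simp add: l2norm_comb)
  also have "\<dots> \<le> (\<Sum>j\<le>n. (cmod (pswf_coeff \<psi> r j))\<^sup>2 / (cmod (ev n))\<^sup>2)"
    using ev_pos by (intro sum_mono) (auto simp: b_def norm_divide power_divide intro!: divide_left_mono power_mono ev_antimono)
  also have "\<dots> \<le> (l2norm leb_I r)\<^sup>2 / (cmod (ev n))\<^sup>2"
    unfolding sum_divide_distrib[symmetric] by (intro divide_right_mono Bessel_pswf r) auto
  finally show "(l2norm leb_I (Finv \<psi> ev n r))\<^sup>2 \<le> (l2norm leb_I r / cmod (ev n))\<^sup>2"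
    by (simp add: power_divide)
qed simp

lemma Finv_eq:
  assumes f: "square_integrable leb_I f" and w: "square_integrable leb_I w"
  shows "Finv \<psi> ev n w y = (\<Sum>j\<le>n. pswf_coeff \<psi> f j * \<Psi> j y) - Finv \<psi> ev n (\<lambda>x. Fop c f x - w x) y"
proof -
  have "ev j \<noteq> 0" for j using ev_pos[of j] by auto
  then show ?thesis
    by (simp add: Finv_def pswf_coeff_diff[OF square_integrable_Fop[OF f] w] pswf_coeff_Fop[OF f]
        sum_subtractf[symmetric] field_simps)
qed

text \<open>
  The truncated inverse of \<open>Fop c f\<close> is the truncated expansion of \<open>f\<close>.
\<close>

lemma error_decomposition:
  assumes f: "square_integrable leb_I f" and w: "square_integrable leb_I w"
  shows "l2norm leb_I (\<lambda>y. f y - Finv \<psi> ev n w y)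
    \<le> l2norm leb_I (\<lambda>y. f y - (\<Sum>j\<le>n. pswf_coeff \<psi> f j * \<Psi> j y))
      + l2norm leb_I (\<lambda>x. Fop c f x - w x) / cmod (ev n)"
proof -
  define r where "r = (\<lambda>x. Fop c f x - w x)"
  have r: "square_integrable leb_I r"
    unfolding r_def by (intro square_integrable_diff square_integrable_Fop f w)
  have sqF: "square_integrable leb_I (Finv \<psi> ev n r)"
  proof -
    have "Finv \<psi> ev n r = (\<lambda>x. \<Sum>j\<le>n. (pswf_coeff \<psi> r j / ev j) * \<Psi> j x)"
      by (simp add: fun_eq_iff Finv_def mult.commute)
    then show ?thesis by (simp only: square_integrable_comb)
  qed
  have "l2norm leb_I (\<lambda>y. f y - Finv \<psi> ev n w y)
    = l2norm leb_I (\<lambda>y. (f y - (\<Sum>j\<le>n. pswf_coeff \<psi> f j * \<Psi> j y)) + Finv \<psi> ev n r y)"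
    unfolding Finv_eq[OF f w] r_def by (simp add: algebra_simps)
  also have "\<dots> \<le> l2norm leb_I (\<lambda>y. f y - (\<Sum>j\<le>n. pswf_coeff \<psi> f j * \<Psi> j y)) + l2norm leb_I (Finv \<psi> ev n r)"
    by (intro l2norm_triangle square_integrable_diff f square_integrable_comb sqF)
  finally show ?thesis
    using l2norm_Finv_le[OF r, of n] by (simp add: r_def)
qed

end

section \<open>Plancherel inequality by Gaussian regularisation\<close>

lemma sigma_finite_leb_on: "sigma_finite_measure (lebesgue_on {a..b::real})"
proof -
  interpret finite_measure "lebesgue_on {a..b}" by simp
  show ?thesis ..
qed

lemma borel_measurable_fourier_int:
  "integrable (lebesgue_on {-R..R}) a \<Longrightarrow> fourier_int R a \<in> borel_measurable borel"
  by (intro borel_measurable_continuous_onI continuous_on_fourier_int)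

lemma cmod_fourier_int_le: "cmod (fourier_int R a \<xi>) \<le> (\<integral>x. cmod (a x) \<partial>lebesgue_on {-R..R})"
proof -
  have "cmod (fourier_int R a \<xi>) \<le> (\<integral>x. norm (exp (\<i> * complex_of_real (x * \<xi>)) * a x) \<partial>lebesgue_on {-R..R})"
    unfolding fourier_int_def by (rule integral_norm_bound)
  then show ?thesis by (simp add: norm_mult)
qed

text \<open>
  After Fubini the integral over \<open>z\<close> is the characteristic function of the standard normal distribution at \<open>\<sigma> (y - x)\<close>.
\<close>

lemma gaussian_Parseval_scaled:
  assumes a: "integrable (lebesgue_on {-R..R}) a" and b: "integrable (lebesgue_on {-S..S}) b"
  shows "(\<integral>z. fourier_int R a (- (\<sigma> * z)) * fourier_int S b (\<sigma> * z) \<partial>std_normal_distribution)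
    = (\<integral>x. (\<integral>y. complex_of_real (exp (- (\<sigma> * (y - x))\<^sup>2 / 2)) * (a x * b y) \<partial>lebesgue_on {-S..S}) \<partial>lebesgue_on {-R..R})"
proof -
  define MA where "MA = lebesgue_on {-R..R}"
  define MB where "MB = lebesgue_on {-S..S}"
  interpret A: sigma_finite_measure MA unfolding MA_def by (rule sigma_finite_leb_on)
  interpret B: sigma_finite_measure MB unfolding MB_def by (rule sigma_finite_leb_on)
  interpret AB: pair_sigma_finite MA MB ..
  interpret N: prob_space std_normal_distribution
    by (rule prob_space_normal_density) simp
  interpret NAB: pair_sigma_finite std_normal_distribution "MA \<Otimes>\<^sub>M MB"
    unfolding pair_sigma_finite_def
    using N.sigma_finite_measure_axioms AB.sigma_finite_measure_axioms by simp
  have a': "integrable MA a" and b': "integrable MB b" using a b by (auto simp: MA_def MB_def)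
  have [measurable]: "(\<lambda>x. x) \<in> borel_measurable MA" "(\<lambda>x. x) \<in> borel_measurable MB"
    unfolding MA_def MB_def by (rule id_borel_measurable_leb_on)+
  have [measurable]: "a \<in> borel_measurable MA" "b \<in> borel_measurable MB" using a' b' by auto
  define F where "F = (\<lambda>(x, y). a x * b y)"
  have F: "integrable (MA \<Otimes>\<^sub>M MB) F"
    using integrable_pair_mult_bounded_kernel[OF A.sigma_finite_measure_axioms B.sigma_finite_measure_axioms
        a' b', of "\<lambda>_. 1"] by (simp add: F_def)
  define k where "k = (\<lambda>(z, (x, y)). exp (\<i> * complex_of_real (\<sigma> * (y - x) * z)))"
  have [measurable]: "k \<in> borel_measurable (std_normal_distribution \<Otimes>\<^sub>M (MA \<Otimes>\<^sub>M MB))"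
    unfolding k_def by measurable
  have kF: "integrable (std_normal_distribution \<Otimes>\<^sub>M (MA \<Otimes>\<^sub>M MB)) (\<lambda>(z, p). k (z, p) * (1 * F p))"
    by (rule integrable_pair_mult_bounded_kernel)
       (auto intro: N.sigma_finite_measure_axioms AB.sigma_finite_measure_axioms F simp: k_def split_beta)
  have prod: "fourier_int R a (- (\<sigma> * z)) * fourier_int S b (\<sigma> * z) = (\<integral>p. k (z, p) * F p \<partial>(MA \<Otimes>\<^sub>M MB))" for z
  proof -
    have int: "integrable (MA \<Otimes>\<^sub>M MB) (\<lambda>(x, y). exp (\<i> * complex_of_real (\<sigma> * (y - x) * z)) * (a x * b y))"
      using integrable_pair_mult_bounded_kernel[OF A.sigma_finite_measure_axioms B.sigma_finite_measure_axioms
          a' b', of "\<lambda>(x, y). exp (\<i> * complex_of_real (\<sigma> * (y - x) * z))"]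
      by (auto simp: split_beta)
    have "fourier_int R a (- (\<sigma> * z)) * fourier_int S b (\<sigma> * z)
      = (\<integral>x. (\<integral>y. (exp (\<i> * complex_of_real (x * - (\<sigma> * z))) * a x) * (exp (\<i> * complex_of_real (y * (\<sigma> * z))) * b y) \<partial>MB) \<partial>MA)"
      by (simp add: fourier_int_def MA_def MB_def)
    also have "\<dots> = (\<integral>x. (\<integral>y. exp (\<i> * complex_of_real (\<sigma> * (y - x) * z)) * (a x * b y) \<partial>MB) \<partial>MA)"
      by (intro Bochner_Integration.integral_cong refl) (simp add: exp_diff exp_minus field_simps)
    also have "\<dots> = (\<integral>p. k (z, p) * F p \<partial>(MA \<Otimes>\<^sub>M MB))"
      using AB.integral_fst[OF int] by (simp add: k_def F_def case_prod_unfold)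
    finally show ?thesis .
  qed
  have "(\<integral>z. fourier_int R a (- (\<sigma> * z)) * fourier_int S b (\<sigma> * z) \<partial>std_normal_distribution)
      = (\<integral>z. (\<integral>p. k (z, p) * F p \<partial>(MA \<Otimes>\<^sub>M MB)) \<partial>std_normal_distribution)"
    by (simp only: prod)
  also have "\<dots> = (\<integral>p. (\<integral>z. k (z, p) * F p \<partial>std_normal_distribution) \<partial>(MA \<Otimes>\<^sub>M MB))"
    using NAB.Fubini_integral[of "\<lambda>z p. k (z, p) * F p"] kF by simp
  also have "\<dots> = (\<integral>p. (case p of (x, y) \<Rightarrow> complex_of_real (exp (- (\<sigma> * (y - x))\<^sup>2 / 2)) * (a x * b y)) \<partial>(MA \<Otimes>\<^sub>M MB))"
  proof (intro Bochner_Integration.integral_cong refl)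
    fix p :: "real \<times> real"
    obtain x y where p: "p = (x, y)" by (cases p)
    have "(\<integral>z. k (z, p) \<partial>std_normal_distribution) = char std_normal_distribution (\<sigma> * (y - x))"
      by (simp add: k_def p char_def)
    then show "(\<integral>z. k (z, p) * F p \<partial>std_normal_distribution)
      = (case p of (x, y) \<Rightarrow> complex_of_real (exp (- (\<sigma> * (y - x))\<^sup>2 / 2)) * (a x * b y))"
      by (simp add: p F_def char_std_normal_distribution)
  qed
  also have "\<dots> = (\<integral>x. (\<integral>y. complex_of_real (exp (- (\<sigma> * (y - x))\<^sup>2 / 2)) * (a x * b y) \<partial>MB) \<partial>MA)"
  proof -
    have "integrable (MA \<Otimes>\<^sub>M MB) (\<lambda>(x, y). complex_of_real (exp (- (\<sigma> * (y - x))\<^sup>2 / 2)) * (a x * b y))"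
      using integrable_pair_mult_bounded_kernel[OF A.sigma_finite_measure_axioms B.sigma_finite_measure_axioms
          a' b', of "\<lambda>(x, y). complex_of_real (exp (- (\<sigma> * (y - x))\<^sup>2 / 2))"]
      by (auto simp: split_beta)
    from AB.integral_fst[OF this] show ?thesis by (simp add: case_prod_unfold)
  qed
  finally show ?thesis unfolding MA_def MB_def .
qed

text \<open>
  The density of the normal distribution with standard deviation \<open>\<sigma>\<close>, normalised to have value \<open>1\<close> at \<open>0\<close>: as
  \<open>\<sigma>\<close> tends to infinity it increases to \<open>1\<close> everywhere.
\<close>

definition gauss_weight :: "real \<Rightarrow> real \<Rightarrow> real" where
  "gauss_weight \<sigma> \<xi> = exp (- (\<xi> / \<sigma>)\<^sup>2 / 2)"

lemma gauss_weight_bounds: "0 \<le> gauss_weight \<sigma> \<xi>" "gauss_weight \<sigma> \<xi> \<le> 1"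
  by (auto simp: gauss_weight_def)

lemma borel_measurable_gauss_weight [measurable]: "gauss_weight \<sigma> \<in> borel_measurable borel"
  unfolding gauss_weight_def by measurable

lemma gauss_weight_tendsto: "(\<lambda>n. gauss_weight (real (Suc n)) \<xi>) \<longlonglongrightarrow> 1"
proof -
  have "(\<lambda>n. \<xi> / real (Suc n)) \<longlonglongrightarrow> 0"
    using LIMSEQ_inverse_real_of_nat[THEN tendsto_mult_left, of \<xi>] by (simp add: divide_inverse)
  then have "(\<lambda>n. exp (- (\<xi> / real (Suc n))\<^sup>2 / 2)) \<longlonglongrightarrow> exp (- 0\<^sup>2 / 2)"
    by (intro tendsto_intros) auto
  then show ?thesis by (simp add: gauss_weight_def)
qed

text \<open>
  Damping high frequencies by a Gaussian of width \<open>\<sigma>\<close> corresponds to convolution of \<open>b\<close> with a Gaussian of width \<open>1/\<sigma>\<close>.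
  For \<open>\<sigma> \<longlonglongrightarrow> \<infinity>\<close> this becomes Parseval's identity.
\<close>

lemma gaussian_Parseval:
  fixes a b :: "real \<Rightarrow> complex"
  assumes a: "integrable (lebesgue_on {-R..R}) a" and b: "integrable (lebesgue_on {-S..S}) b"
    and \<sigma>: "\<sigma> > 0"
  shows "(\<integral>\<xi>. complex_of_real (gauss_weight \<sigma> \<xi>) * (fourier_int R a (-\<xi>) * fourier_int S b \<xi>) \<partial>lborel)
    = 2 * pi * (\<integral>x. a x * (\<integral>y. normal_density x (1/\<sigma>) y * b y \<partial>lebesgue_on {-S..S}) \<partial>lebesgue_on {-R..R})"
proof -
  define G where "G \<xi> = fourier_int R a (-\<xi>) * fourier_int S b \<xi>" for \<xi>
  have [measurable]: "fourier_int R a \<in> borel_measurable borel" "fourier_int S b \<in> borel_measurable borel"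
    using a b by (auto intro: borel_measurable_fourier_int)
  have [measurable]: "G \<in> borel_measurable borel"
    unfolding G_def by measurable
  have "(\<integral>\<xi>. complex_of_real (gauss_weight \<sigma> \<xi>) * G \<xi> \<partial>lborel)
      = \<sigma> *\<^sub>R (\<integral>z. complex_of_real (gauss_weight \<sigma> (\<sigma> * z)) * G (\<sigma> * z) \<partial>lborel)"
    using lborel_integral_real_affine[of \<sigma> "\<lambda>\<xi>. complex_of_real (gauss_weight \<sigma> \<xi>) * G \<xi>" 0] \<sigma> by simp
  also have "\<dots> = \<sigma> *\<^sub>R (\<integral>z. complex_of_real (sqrt (2 * pi)) * (std_normal_density z *\<^sub>R G (\<sigma> * z)) \<partial>lborel)"
    using \<sigma> by (simp add: gauss_weight_def std_normal_density_def scaleR_conv_of_real)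
  also have "\<dots> = \<sigma> *\<^sub>R (complex_of_real (sqrt (2 * pi)) * (\<integral>z. std_normal_density z *\<^sub>R G (\<sigma> * z) \<partial>lborel))"
    by (simp only: integral_mult_right_zero)
  also have "(\<integral>z. std_normal_density z *\<^sub>R G (\<sigma> * z) \<partial>lborel) = (\<integral>z. G (\<sigma> * z) \<partial>std_normal_distribution)"
    by (rule integral_density[symmetric]) auto
  also have "\<dots> = (\<integral>x. (\<integral>y. complex_of_real (exp (- (\<sigma> * (y - x))\<^sup>2 / 2)) * (a x * b y) \<partial>lebesgue_on {-S..S}) \<partial>lebesgue_on {-R..R})"
    unfolding G_def using gaussian_Parseval_scaled[OF a b, of \<sigma>] by simp
  also have "\<dots> = (\<integral>x. complex_of_real (sqrt (2 * pi) / \<sigma>) * (a x * (\<integral>y. normal_density x (1/\<sigma>) y * b y \<partial>lebesgue_on {-S..S})) \<partial>lebesgue_on {-R..R})"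
  proof (intro Bochner_Integration.integral_cong refl)
    fix x
    have n: "exp (- (\<sigma> * (y - x))\<^sup>2 / 2) = sqrt (2 * pi) / \<sigma> * normal_density x (1/\<sigma>) y" for y
      unfolding power_mult_distrib normal_density_def
      using \<sigma> by (simp add: real_sqrt_divide real_sqrt_mult field_simps)
    show "(\<integral>y. complex_of_real (exp (- (\<sigma> * (y - x))\<^sup>2 / 2)) * (a x * b y) \<partial>lebesgue_on {-S..S})
      = complex_of_real (sqrt (2 * pi) / \<sigma>) * (a x * (\<integral>y. normal_density x (1/\<sigma>) y * b y \<partial>lebesgue_on {-S..S}))"
      unfolding integral_mult_right_zero[symmetric] n
      by (intro Bochner_Integration.integral_cong refl) simp
  qed
  finally have eq: "(\<integral>\<xi>. complex_of_real (gauss_weight \<sigma> \<xi>) * G \<xi> \<partial>lborel)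
      = \<sigma> *\<^sub>R (complex_of_real (sqrt (2 * pi)) * (complex_of_real (sqrt (2 * pi) / \<sigma>) *
        (\<integral>x. a x * (\<integral>y. normal_density x (1/\<sigma>) y * b y \<partial>lebesgue_on {-S..S}) \<partial>lebesgue_on {-R..R})))"
    by (simp only: integral_mult_right_zero)
  have "\<sigma> * (sqrt (2 * pi) * (sqrt (2 * pi) / \<sigma>)) = 2 * pi"
    using \<sigma> by simp
  then show ?thesis
    using eq unfolding G_def scaleR_conv_of_real mult.assoc[symmetric] of_real_mult[symmetric]
    by (simp only: mult.assoc)
qed

lemma nn_integral_lebesgue_on_le_lborel:
  fixes f :: "real \<Rightarrow> ennreal"
  assumes [measurable]: "f \<in> borel_measurable borel"
  shows "(\<integral>\<^sup>+x. f x \<partial>lebesgue_on {a..b}) \<le> (\<integral>\<^sup>+x. f x \<partial>lborel)"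
proof -
  have "(\<integral>\<^sup>+x. f x \<partial>lebesgue_on {a..b}) = (\<integral>\<^sup>+x. f x * indicator {a..b} x \<partial>lebesgue)"
    by (rule nn_integral_restrict_space) auto
  also have "\<dots> \<le> (\<integral>\<^sup>+x. f x \<partial>lebesgue)"
    by (intro nn_integral_mono) (auto simp: indicator_def)
  also have "\<dots> = (\<integral>\<^sup>+x. f x \<partial>lborel)"
    by (rule nn_integral_completion)
  finally show ?thesis .
qed

text \<open>
  Schur's test: \<open>2 \<bar>u(x)\<bar> \<bar>u(y)\<bar> \<le> \<bar>u(x)\<bar>\<^sup>2 + \<bar>u(y)\<bar>\<^sup>2\<close>, and the Gaussian kernel is symmetric and has mass at most \<open>1\<close> in either variable.
\<close>

lemma gaussian_form_le:
  assumes u: "square_integrable (lebesgue_on {-R..R}) u" and s: "s > 0"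
  shows "(\<integral>\<^sup>+x. (\<integral>\<^sup>+y. ennreal (cmod (u x) * (normal_density x s y * cmod (u y))) \<partial>lebesgue_on {-R..R}) \<partial>lebesgue_on {-R..R})
    \<le> ennreal ((l2norm (lebesgue_on {-R..R}) u)\<^sup>2)"
proof -
  define M where "M = lebesgue_on {-R..R}"
  interpret sigma_finite_measure M unfolding M_def by (rule sigma_finite_leb_on)
  interpret P: pair_sigma_finite M M ..
  have [measurable]: "(\<lambda>x. x) \<in> borel_measurable M" unfolding M_def by (rule id_borel_measurable_leb_on)
  have [measurable]: "u \<in> borel_measurable M" using u by (auto simp: square_integrable_def M_def)
  have [measurable]: "(\<lambda>(x, y). normal_density x s y) \<in> borel_measurable (M \<Otimes>\<^sub>M M)"
    unfolding normal_density_def by measurable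
  define n where "n x y = normal_density x s y" for x y
  have [measurable]: "(\<lambda>(x, y). n x y) \<in> borel_measurable (M \<Otimes>\<^sub>M M)" unfolding n_def by measurable
  have n_mass: "(\<integral>\<^sup>+y. ennreal (n x y) \<partial>M) \<le> 1" for x
  proof -
    have "(\<integral>\<^sup>+y. ennreal (n x y) \<partial>M) \<le> (\<integral>\<^sup>+y. ennreal (n x y) \<partial>lborel)"
      unfolding M_def n_def by (rule nn_integral_lebesgue_on_le_lborel) measurable
    also have "\<dots> = ennreal (\<integral>y. n x y \<partial>lborel)"
      unfolding n_def by (rule nn_integral_eq_integral) (use s in auto)
    also have "\<dots> = 1" unfolding n_def using s by simp
    finally show ?thesis .
  qed
  have sym: "n x y = n y x" for x y
    by (simp add: n_def normal_density_def power2_commute)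
  define v where "v x = (cmod (u x))\<^sup>2 / 2" for x
  have [measurable]: "v \<in> borel_measurable M" unfolding v_def by measurable
  have v0: "0 \<le> v x" for x by (simp add: v_def)
  have n0: "0 \<le> n x y" for x y by (simp add: n_def)
  have half: "(\<integral>\<^sup>+x. (\<integral>\<^sup>+y. ennreal (v x) * ennreal (n x y) \<partial>M) \<partial>M) \<le> (\<integral>\<^sup>+x. ennreal (v x) \<partial>M)"
  proof (rule nn_integral_mono)
    fix x assume "x \<in> space M"
    then have [measurable]: "(\<lambda>y. n x y) \<in> borel_measurable M" by measurable
    have "(\<integral>\<^sup>+y. ennreal (v x) * ennreal (n x y) \<partial>M) = ennreal (v x) * (\<integral>\<^sup>+y. ennreal (n x y) \<partial>M)"
      by (rule nn_integral_cmult) measurable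
    also have "\<dots> \<le> ennreal (v x) * 1" by (intro mult_left_mono n_mass) simp
    finally show "(\<integral>\<^sup>+y. ennreal (v x) * ennreal (n x y) \<partial>M) \<le> ennreal (v x)" by simp
  qed
  have swap: "(\<integral>\<^sup>+x. (\<integral>\<^sup>+y. ennreal (v y) * ennreal (n x y) \<partial>M) \<partial>M)
      = (\<integral>\<^sup>+x. (\<integral>\<^sup>+y. ennreal (v x) * ennreal (n x y) \<partial>M) \<partial>M)"
  proof -
    have "(\<integral>\<^sup>+x. (\<integral>\<^sup>+y. ennreal (v y) * ennreal (n x y) \<partial>M) \<partial>M)
        = (\<integral>\<^sup>+y. (\<integral>\<^sup>+x. ennreal (v y) * ennreal (n x y) \<partial>M) \<partial>M)"
      by (rule P.Fubini'[symmetric]) measurable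
    then show ?thesis by (simp add: sym)
  qed
  have "(\<integral>\<^sup>+x. (\<integral>\<^sup>+y. ennreal (cmod (u x) * (n x y * cmod (u y))) \<partial>M) \<partial>M)
      \<le> (\<integral>\<^sup>+x. (\<integral>\<^sup>+y. ennreal (v x) * ennreal (n x y) + ennreal (v y) * ennreal (n x y) \<partial>M) \<partial>M)"
  proof (intro nn_integral_mono)
    fix x y
    have "cmod (u x) * cmod (u y) \<le> v x + v y"
      using sum_squares_bound[of "cmod (u x)" "cmod (u y)"] by (simp add: v_def)
    then have "cmod (u x) * cmod (u y) * n x y \<le> (v x + v y) * n x y"
      by (intro mult_right_mono n0)
    then have "ennreal (cmod (u x) * (n x y * cmod (u y))) \<le> ennreal (v x * n x y + v y * n x y)"
      by (intro ennreal_leI) (simp add: algebra_simps)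
    then show "ennreal (cmod (u x) * (n x y * cmod (u y)))
        \<le> ennreal (v x) * ennreal (n x y) + ennreal (v y) * ennreal (n x y)"
      by (simp add: ennreal_mult v0 n0)
  qed
  also have "\<dots> = (\<integral>\<^sup>+x. (\<integral>\<^sup>+y. ennreal (v x) * ennreal (n x y) \<partial>M) + (\<integral>\<^sup>+y. ennreal (v y) * ennreal (n x y) \<partial>M) \<partial>M)"
    by (intro nn_integral_cong nn_integral_add) measurable
  also have "\<dots> = (\<integral>\<^sup>+x. (\<integral>\<^sup>+y. ennreal (v x) * ennreal (n x y) \<partial>M) \<partial>M)
      + (\<integral>\<^sup>+x. (\<integral>\<^sup>+y. ennreal (v y) * ennreal (n x y) \<partial>M) \<partial>M)"
    by (intro nn_integral_add) measurable
  also have "\<dots> \<le> (\<integral>\<^sup>+x. ennreal (v x) \<partial>M) + (\<integral>\<^sup>+x. ennreal (v x) \<partial>M)"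
    unfolding swap by (intro add_mono half)
  also have "\<dots> = (\<integral>\<^sup>+x. ennreal (v x) + ennreal (v x) \<partial>M)"
    by (rule nn_integral_add[symmetric]) auto
  also have "\<dots> = (\<integral>\<^sup>+x. ennreal ((cmod (u x))\<^sup>2) \<partial>M)"
    by (intro nn_integral_cong) (simp add: v_def flip: ennreal_plus)
  also have "\<dots> = ennreal ((l2norm M u)\<^sup>2)"
    unfolding l2norm_power2 using u by (intro nn_integral_eq_integral) (auto simp: square_integrable_def M_def)
  finally show ?thesis unfolding M_def n_def .
qed

lemma cmod_integral_le_nn_integral:
  fixes f :: "'a \<Rightarrow> complex"
  shows "ennreal (cmod (\<integral>x. f x \<partial>M)) \<le> (\<integral>\<^sup>+x. ennreal (cmod (f x)) \<partial>M)"
  by (cases "integrable M f") (auto simp: integral_norm_bound_ennreal not_integrable_integral_eq)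

text \<open>
  Parseval's identity with Gaussian weight, for \<open>u\<close> and its conjugate, bounds the weighted integral of \<open>\<bar>U\<bar>\<^sup>2\<close> uniformly in
  \<open>\<sigma>\<close>. Fatou's lemma removes the weight and so shows that \<open>U\<close> is square-integrable.
\<close>

lemma Bessel_fourier_int:
  assumes u: "square_integrable (lebesgue_on {-R..R}) u"
  shows "square_integrable lebesgue (fourier_int R u)"
    and "l2norm lebesgue (fourier_int R u) \<le> sqrt (2 * pi) * l2norm (lebesgue_on {-R..R}) u"
proof -
  define M where "M = lebesgue_on {-R..R}"
  define B where "B = 2 * pi * (l2norm M u)\<^sup>2"
  have B0: "0 \<le> B" by (simp add: B_def)
  have ui: "integrable (lebesgue_on {-R..R}) u"
    by (rule integrable_of_square_integrable[OF _ u]) simp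
  have uic: "integrable (lebesgue_on {-R..R}) (\<lambda>x. cnj (u x))"
    by (rule integrable_of_square_integrable[OF _ square_integrable_cnj[OF u]]) simp
  define U where "U = fourier_int R u"
  have [measurable]: "U \<in> borel_measurable borel"
    unfolding U_def by (rule borel_measurable_fourier_int[OF ui])
  have Uc: "fourier_int R (\<lambda>x. cnj (u x)) (-\<xi>) = cnj (U \<xi>)" for \<xi>
    unfolding U_def fourier_int_def Bochner_Integration.integral_cnj[symmetric]
    by (intro Bochner_Integration.integral_cong refl) (simp add: exp_cnj)
  have weighted: "(\<integral>\<^sup>+\<xi>. ennreal (gauss_weight s \<xi> * (cmod (U \<xi>))\<^sup>2) \<partial>lborel) \<le> ennreal B" if s: "s > 0" for s
  proof -
    define C where "C = (\<integral>x. cmod (u x) \<partial>M)"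
    have wint: "integrable lborel (gauss_weight s)"
    proof -
      have "gauss_weight s = (\<lambda>\<xi>. sqrt (2 * pi * s\<^sup>2) * normal_density 0 s \<xi>)"
        using s by (simp add: fun_eq_iff gauss_weight_def normal_density_def power_divide)
      then show ?thesis using s by simp
    qed
    have int: "integrable lborel (\<lambda>\<xi>. gauss_weight s \<xi> * (cmod (U \<xi>))\<^sup>2)"
    proof (rule Bochner_Integration.integrable_bound[OF integrable_mult_left[OF wint, of "C\<^sup>2"]])
      show "AE \<xi> in lborel. norm (gauss_weight s \<xi> * (cmod (U \<xi>))\<^sup>2) \<le> norm (gauss_weight s \<xi> * C\<^sup>2)"
        using gauss_weight_bounds(1) cmod_fourier_int_le[of R u]
        by (intro AE_I2) (auto simp: abs_mult U_def C_def M_def intro!: mult_left_mono power_mono)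
    qed measurable
    have "complex_of_real (\<integral>\<xi>. gauss_weight s \<xi> * (cmod (U \<xi>))\<^sup>2 \<partial>lborel)
        = (\<integral>\<xi>. complex_of_real (gauss_weight s \<xi>) * (fourier_int R (\<lambda>x. cnj (u x)) (-\<xi>) * U \<xi>) \<partial>lborel)"
      unfolding integral_complex_of_real[symmetric] Uc
      by (intro Bochner_Integration.integral_cong refl)
         (simp add: complex_norm_square mult_ac del: of_real_power)
    also have "\<dots> = 2 * pi * (\<integral>x. cnj (u x) * (\<integral>y. normal_density x (1/s) y * u y \<partial>M) \<partial>M)"
      unfolding U_def M_def by (rule gaussian_Parseval[OF uic ui s])
    finally have eq: "complex_of_real (\<integral>\<xi>. gauss_weight s \<xi> * (cmod (U \<xi>))\<^sup>2 \<partial>lborel)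
      = 2 * pi * (\<integral>x. cnj (u x) * (\<integral>y. normal_density x (1/s) y * u y \<partial>M) \<partial>M)" .
    have nonneg: "0 \<le> (\<integral>\<xi>. gauss_weight s \<xi> * (cmod (U \<xi>))\<^sup>2 \<partial>lborel)"
      by (intro Bochner_Integration.integral_nonneg) (simp add: gauss_weight_bounds)
    have "ennreal (\<integral>\<xi>. gauss_weight s \<xi> * (cmod (U \<xi>))\<^sup>2 \<partial>lborel)
        = ennreal (cmod (complex_of_real (\<integral>\<xi>. gauss_weight s \<xi> * (cmod (U \<xi>))\<^sup>2 \<partial>lborel)))"
      using nonneg by simp
    also have "\<dots> = ennreal (2 * pi) * ennreal (cmod (\<integral>x. cnj (u x) * (\<integral>y. normal_density x (1/s) y * u y \<partial>M) \<partial>M))"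
      unfolding eq by (simp add: norm_mult ennreal_mult)
    also have "\<dots> \<le> ennreal (2 * pi) * (\<integral>\<^sup>+x. (\<integral>\<^sup>+y. ennreal (cmod (u x) * (normal_density x (1/s) y * cmod (u y))) \<partial>M) \<partial>M)"
    proof (rule mult_left_mono)
      have "ennreal (cmod (\<integral>x. cnj (u x) * (\<integral>y. normal_density x (1/s) y * u y \<partial>M) \<partial>M))
          \<le> (\<integral>\<^sup>+x. ennreal (cmod (cnj (u x) * (\<integral>y. normal_density x (1/s) y * u y \<partial>M))) \<partial>M)"
        by (rule cmod_integral_le_nn_integral)
      also have "\<dots> \<le> (\<integral>\<^sup>+x. (\<integral>\<^sup>+y. ennreal (cmod (u x) * (normal_density x (1/s) y * cmod (u y))) \<partial>M) \<partial>M)"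
      proof (rule nn_integral_mono)
        fix x
        have "cnj (u x) * (\<integral>y. normal_density x (1/s) y * u y \<partial>M) = (\<integral>y. cnj (u x) * (normal_density x (1/s) y * u y) \<partial>M)"
          by simp
        then have "ennreal (cmod (cnj (u x) * (\<integral>y. normal_density x (1/s) y * u y \<partial>M)))
          \<le> (\<integral>\<^sup>+y. ennreal (cmod (cnj (u x) * (normal_density x (1/s) y * u y))) \<partial>M)"
          by (simp only: cmod_integral_le_nn_integral)
        then show "ennreal (cmod (cnj (u x) * (\<integral>y. normal_density x (1/s) y * u y \<partial>M)))
          \<le> (\<integral>\<^sup>+y. ennreal (cmod (u x) * (normal_density x (1/s) y * cmod (u y))) \<partial>M)"
          by (simp add: norm_mult)
      qed
      finally show "ennreal (cmod (\<integral>x. cnj (u x) * (\<integral>y. normal_density x (1/s) y * u y \<partial>M) \<partial>M))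
        \<le> (\<integral>\<^sup>+x. (\<integral>\<^sup>+y. ennreal (cmod (u x) * (normal_density x (1/s) y * cmod (u y))) \<partial>M) \<partial>M)" .
    qed simp
    also have "\<dots> \<le> ennreal (2 * pi) * ennreal ((l2norm M u)\<^sup>2)"
      unfolding M_def by (intro mult_left_mono gaussian_form_le u) (use s in auto)
    also have "\<dots> = ennreal B" by (simp add: B_def ennreal_mult)
    finally show ?thesis
      by (subst nn_integral_eq_integral[OF int]) (auto simp: gauss_weight_bounds)
  qed
  have "(\<integral>\<^sup>+\<xi>. ennreal ((cmod (U \<xi>))\<^sup>2) \<partial>lborel)
      = (\<integral>\<^sup>+\<xi>. liminf (\<lambda>n. ennreal (gauss_weight (real (Suc n)) \<xi> * (cmod (U \<xi>))\<^sup>2)) \<partial>lborel)"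
  proof (intro nn_integral_cong lim_imp_Liminf[symmetric])
    fix \<xi>
    have "(\<lambda>n. gauss_weight (real (Suc n)) \<xi> * (cmod (U \<xi>))\<^sup>2) \<longlonglongrightarrow> 1 * (cmod (U \<xi>))\<^sup>2"
      by (intro tendsto_intros gauss_weight_tendsto)
    then show "(\<lambda>n. ennreal (gauss_weight (real (Suc n)) \<xi> * (cmod (U \<xi>))\<^sup>2)) \<longlonglongrightarrow> ennreal ((cmod (U \<xi>))\<^sup>2)"
      by (intro tendsto_ennrealI) simp
  qed simp
  also have "\<dots> \<le> liminf (\<lambda>n. \<integral>\<^sup>+\<xi>. ennreal (gauss_weight (real (Suc n)) \<xi> * (cmod (U \<xi>))\<^sup>2) \<partial>lborel)"
    by (intro nn_integral_liminf) measurable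
  also have "\<dots> \<le> ennreal B"
    by (rule Liminf_le) (auto intro!: always_eventually weighted)
  finally have fin: "(\<integral>\<^sup>+\<xi>. ennreal ((cmod (U \<xi>))\<^sup>2) \<partial>lborel) \<le> ennreal B" .
  have int: "integrable lborel (\<lambda>\<xi>. (cmod (U \<xi>))\<^sup>2)"
    using fin by (intro integrableI_bounded) (auto simp: le_less_trans[OF fin])
  then have int': "integrable lebesgue (\<lambda>\<xi>. (cmod (U \<xi>))\<^sup>2)"
    by (subst integrable_completion) auto
  show "square_integrable lebesgue (fourier_int R u)"
    using int' unfolding square_integrable_def U_def[symmetric] by (auto intro: measurable_completion)
  have "ennreal (\<integral>\<xi>. (cmod (U \<xi>))\<^sup>2 \<partial>lborel) \<le> ennreal B"
    using fin by (subst (asm) nn_integral_eq_integral[OF int]) auto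
  then have "(\<integral>\<xi>. (cmod (U \<xi>))\<^sup>2 \<partial>lborel) \<le> B" using B0 by simp
  then have "(\<integral>\<xi>. (cmod (U \<xi>))\<^sup>2 \<partial>lebesgue) \<le> B" by (subst integral_completion) auto
  then have "l2norm lebesgue U \<le> sqrt B" unfolding l2norm_def by (rule real_sqrt_le_mono)
  then show "l2norm lebesgue (fourier_int R u) \<le> sqrt (2 * pi) * l2norm (lebesgue_on {-R..R}) u"
    by (simp add: B_def U_def M_def real_sqrt_mult)
qed

section \<open>Parseval identity for the Fourier--Plancherel transform\<close>

lemma integral_leb_on_eq_lborel:
  fixes f :: "real \<Rightarrow> complex"
  assumes [measurable]: "f \<in> borel_measurable borel"
  shows "(\<integral>x. f x \<partial>lebesgue_on {a..b}) = (\<integral>x. indicator {a..b} x *\<^sub>R f x \<partial>lborel)"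
proof -
  have "(\<integral>x. f x \<partial>lebesgue_on {a..b}) = (\<integral>x. indicator {a..b} x *\<^sub>R f x \<partial>lebesgue)"
    by (rule integral_restrict_space) auto
  also have "\<dots> = (\<integral>x. indicator {a..b} x *\<^sub>R f x \<partial>lborel)"
    by (rule integral_completion) measurable
  finally show ?thesis .
qed

text \<open>
  Substituting \<open>y = x + s z\<close> makes the Gaussian independent of the width \<open>s\<close>, so that dominated convergence applies for \<open>s \<longlonglongrightarrow> 0\<close>.
\<close>

lemma gaussian_average_eq:
  fixes v :: "real \<Rightarrow> complex"
  assumes v: "continuous_on UNIV v" and s: "s > 0"
  shows "(\<integral>y. normal_density x s y * v y \<partial>leb_I)
    = (\<integral>z. std_normal_density z *\<^sub>R (indicator {-1..1} (x + s * z) *\<^sub>R v (x + s * z)) \<partial>lborel)"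
proof -
  have [measurable]: "v \<in> borel_measurable borel" by (rule borel_measurable_continuous_onI[OF v])
  have "(\<integral>y. normal_density x s y * v y \<partial>leb_I)
      = (\<integral>y. indicator {-1..1} y *\<^sub>R (normal_density x s y * v y) \<partial>lborel)"
    by (rule integral_leb_on_eq_lborel) measurable
  also have "\<dots> = \<bar>s\<bar> *\<^sub>R (\<integral>z. indicator {-1..1} (x + s * z) *\<^sub>R (normal_density x s (x + s * z) * v (x + s * z)) \<partial>lborel)"
    by (rule lborel_integral_real_affine) (use s in auto)
  also have "\<dots> = (\<integral>z. s *\<^sub>R (indicator {-1..1} (x + s * z) *\<^sub>R (normal_density x s (x + s * z) * v (x + s * z))) \<partial>lborel)"
    by (simp only: abs_of_pos[OF s] integral_scaleR_right)
  also have "\<dots> = (\<integral>z. std_normal_density z *\<^sub>R (indicator {-1..1} (x + s * z) *\<^sub>R v (x + s * z)) \<partial>lborel)"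
  proof (intro Bochner_Integration.integral_cong refl)
    fix z
    have "normal_density x s (x + s * z) = std_normal_density z / s"
      using s by (simp add: normal_density_def real_sqrt_mult power_mult_distrib)
    then show "s *\<^sub>R (indicator {-1..1} (x + s * z) *\<^sub>R (normal_density x s (x + s * z) * v (x + s * z)))
      = std_normal_density z *\<^sub>R (indicator {-1..1} (x + s * z) *\<^sub>R v (x + s * z))"
      using s by (simp add: scaleR_conv_of_real)
  qed
  finally show ?thesis .
qed

lemma gaussian_average_bounded:
  fixes v :: "real \<Rightarrow> complex"
  assumes v: "continuous_on UNIV v" and s: "s > 0"
    and B: "\<And>y. y \<in> {-1..1} \<Longrightarrow> cmod (v y) \<le> B"
  shows "cmod (\<integral>y. normal_density x s y * v y \<partial>leb_I) \<le> B"
proof -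
  have B0: "0 \<le> B" using B[of 0] norm_ge_zero[of "v 0"] by (simp del: norm_ge_zero)
  have [measurable]: "v \<in> borel_measurable borel" by (rule borel_measurable_continuous_onI[OF v])
  have bound: "norm (std_normal_density z *\<^sub>R (indicator {-1..1} (x + s * z) *\<^sub>R v (x + s * z)))
      \<le> std_normal_density z * B" for z
    using B[of "x + s * z"] B0 by (auto simp: indicator_def intro!: mult_left_mono)
  have "cmod (\<integral>z. std_normal_density z *\<^sub>R (indicator {-1..1} (x + s * z) *\<^sub>R v (x + s * z)) \<partial>lborel)
    \<le> (\<integral>z. std_normal_density z * B \<partial>lborel)"
  proof (rule order_trans[OF integral_norm_bound integral_mono])
    show "integrable lborel (\<lambda>z. std_normal_density z * B)" by simp
    then show "integrable lborel (\<lambda>z. norm (std_normal_density z *\<^sub>R (indicator {-1..1} (x + s * z) *\<^sub>R v (x + s * z))))"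
    proof (rule Bochner_Integration.integrable_bound)
      show "AE z in lborel. norm (norm (std_normal_density z *\<^sub>R (indicator {-1..1} (x + s * z) *\<^sub>R v (x + s * z))))
        \<le> norm (std_normal_density z * B)"
        unfolding real_norm_def abs_norm_cancel by (intro AE_I2 order_trans[OF bound abs_ge_self])
    qed measurable
  qed (rule bound)
  also have "\<dots> = B" by simp
  finally show ?thesis unfolding gaussian_average_eq[OF v s] .
qed

text \<open>
  At the end points the limit would be only half of \<open>v x\<close>, because \<open>v\<close> is cut off there.
\<close>

lemma gaussian_average_tendsto:
  fixes v :: "real \<Rightarrow> complex"
  assumes v: "continuous_on UNIV v" and x: "x \<noteq> -1" "x \<noteq> 1"
  shows "(\<lambda>n. \<integral>y. normal_density x (1 / real (Suc n)) y * v y \<partial>leb_I) \<longlonglongrightarrow> indicator {-1..1} x *\<^sub>R v x"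
proof -
  have [measurable]: "v \<in> borel_measurable borel" by (rule borel_measurable_continuous_onI[OF v])
  obtain B where B: "\<And>y. y \<in> {-1..1} \<Longrightarrow> cmod (v y) \<le> B"
    using continuous_bounded_on_I[OF v] by blast
  have B0: "0 \<le> B" using B[of 0] norm_ge_zero[of "v 0"] by (simp del: norm_ge_zero)
  have "(\<lambda>n. \<integral>z. std_normal_density z *\<^sub>R (indicator {-1..1} (x + 1 / real (Suc n) * z) *\<^sub>R v (x + 1 / real (Suc n) * z)) \<partial>lborel)
    \<longlonglongrightarrow> (\<integral>z. std_normal_density z *\<^sub>R (indicator {-1..1} x *\<^sub>R v x) \<partial>lborel)"
  proof (rule integral_dominated_convergence[where w = "\<lambda>z. std_normal_density z * B"])
    show "integrable lborel (\<lambda>z. std_normal_density z * B)" by simp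
    show "AE z in lborel. norm (std_normal_density z *\<^sub>R (indicator {-1..1} (x + 1 / real (Suc n) * z) *\<^sub>R v (x + 1 / real (Suc n) * z)))
      \<le> std_normal_density z * B" for n
      using B[of "x + 1 / real (Suc n) * z" for z] B0
      by (intro AE_I2) (auto simp: indicator_def intro!: mult_left_mono)
    show "AE z in lborel. (\<lambda>n. std_normal_density z *\<^sub>R (indicator {-1..1} (x + 1 / real (Suc n) * z) *\<^sub>R v (x + 1 / real (Suc n) * z)))
      \<longlonglongrightarrow> std_normal_density z *\<^sub>R (indicator {-1..1} x *\<^sub>R v x)"
    proof (rule AE_I2)
      fix z
      have lim: "(\<lambda>n. x + 1 / real (Suc n) * z) \<longlonglongrightarrow> x"
        using tendsto_add[OF tendsto_const[of x] tendsto_mult_right[OF LIMSEQ_inverse_real_of_nat, of z]]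
        by (simp add: divide_inverse)
      have vlim: "(\<lambda>n. v (x + 1 / real (Suc n) * z)) \<longlonglongrightarrow> v x"
        using continuous_on_tendsto_compose[OF v lim] by simp
      have "eventually (\<lambda>n. indicator {-1..1} (x + 1 / real (Suc n) * z) = (indicator {-1..1} x :: real)) sequentially"
      proof (cases "x \<in> {-1..1}")
        case True
        then have "x \<in> {-1<..<1}" using x by auto
        then have "eventually (\<lambda>n. x + 1 / real (Suc n) * z \<in> {-1<..<1}) sequentially"
          by (intro topological_tendstoD[OF lim]) auto
        then show ?thesis by eventually_elim (use True in \<open>auto simp: indicator_def\<close>)
      next
        case False
        then have "eventually (\<lambda>n. x + 1 / real (Suc n) * z \<in> - {-1..1}) sequentially"
          by (intro topological_tendstoD[OF lim]) auto
        then show ?thesis by eventually_elim (use False in \<open>auto simp: indicator_def\<close>)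
      qed
      then have "(\<lambda>n. indicator {-1..1} (x + 1 / real (Suc n) * z) :: real) \<longlonglongrightarrow> indicator {-1..1} x"
        by (rule tendsto_eventually)
      then show "(\<lambda>n. std_normal_density z *\<^sub>R (indicator {-1..1} (x + 1 / real (Suc n) * z) *\<^sub>R v (x + 1 / real (Suc n) * z)))
        \<longlonglongrightarrow> std_normal_density z *\<^sub>R (indicator {-1..1} x *\<^sub>R v x)"
        by (intro tendsto_intros vlim)
    qed
  qed measurable
  then show ?thesis by (simp add: gaussian_average_eq[OF v])
qed

text \<open>
  Both sides of the identity with Gaussian weight converge by dominated convergence: the frequency side because both transforms are
  square-integrable, the other one because \<open>v\<close> is bounded and its Gaussian averages converge except at \<open>-1\<close> and \<open>1\<close>.
\<close>

lemma Parseval_fourier_int: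
  fixes g v :: "real \<Rightarrow> complex"
  assumes g: "square_integrable (lebesgue_on {-R..R}) g" and R: "R \<ge> 1"
    and v: "continuous_on UNIV v"
  shows "(\<integral>\<xi>. fourier_int R g (-\<xi>) * fourier_int 1 v \<xi> \<partial>lebesgue) = 2 * pi * (\<integral>x. g x * v x \<partial>leb_I)"
proof -
  have gi: "integrable (lebesgue_on {-R..R}) g"
    by (rule integrable_of_square_integrable[OF _ g]) simp
  have sqv: "square_integrable leb_I v" by (rule square_integrable_continuous_leb_I[OF v])
  have vi: "integrable (lebesgue_on {-1..1}) v"
    by (rule integrable_of_square_integrable[OF _ sqv]) simp
  have [measurable]: "fourier_int R g \<in> borel_measurable borel" "fourier_int 1 v \<in> borel_measurable borel"
    using gi vi by (auto intro: borel_measurable_fourier_int)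
  have [measurable]: "v \<in> borel_measurable borel" by (rule borel_measurable_continuous_onI[OF v])
  obtain B where B: "\<And>y. y \<in> {-1..1} \<Longrightarrow> cmod (v y) \<le> B"
    using continuous_bounded_on_I[OF v] by blast
  define G where "G \<xi> = fourier_int R g (-\<xi>) * fourier_int 1 v \<xi>" for \<xi>
  have [measurable]: "G \<in> borel_measurable borel" unfolding G_def by measurable
  have G: "integrable lborel G"
  proof -
    have "integrable lborel (\<lambda>\<xi>. (cmod (fourier_int R g \<xi>))\<^sup>2)"
      using Bessel_fourier_int(1)[OF g] by (simp add: square_integrable_def integrable_completion)
    then have "integrable lborel (\<lambda>\<xi>. (cmod (fourier_int R g (0 + (-1) * \<xi>)))\<^sup>2)"
      by (rule lborel_integrable_real_affine) simp
    then have "square_integrable lborel (\<lambda>\<xi>. fourier_int R g (-\<xi>))"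
      by (simp add: square_integrable_def)
    moreover have "square_integrable lborel (fourier_int 1 v)"
      using Bessel_fourier_int(1)[OF sqv] by (simp add: square_integrable_def integrable_completion)
    ultimately show ?thesis unfolding G_def by (rule integrable_mult_square_integrable)
  qed
  have "(\<lambda>n. \<integral>\<xi>. complex_of_real (gauss_weight (real (Suc n)) \<xi>) * G \<xi> \<partial>lborel) \<longlonglongrightarrow> (\<integral>\<xi>. G \<xi> \<partial>lborel)"
  proof (rule integral_dominated_convergence[where w = "\<lambda>\<xi>. cmod (G \<xi>)"])
    show "AE \<xi> in lborel. (\<lambda>n. complex_of_real (gauss_weight (real (Suc n)) \<xi>) * G \<xi>) \<longlonglongrightarrow> G \<xi>"
    proof (rule AE_I2)
      fix \<xi>
      have "(\<lambda>n. complex_of_real (gauss_weight (real (Suc n)) \<xi>) * G \<xi>) \<longlonglongrightarrow> complex_of_real 1 * G \<xi>"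
        by (intro tendsto_intros gauss_weight_tendsto)
      then show "(\<lambda>n. complex_of_real (gauss_weight (real (Suc n)) \<xi>) * G \<xi>) \<longlonglongrightarrow> G \<xi>" by simp
    qed
    show "AE \<xi> in lborel. norm (complex_of_real (gauss_weight (real (Suc n)) \<xi>) * G \<xi>) \<le> cmod (G \<xi>)" for n
      using gauss_weight_bounds by (intro AE_I2) (auto simp: norm_mult intro!: mult_left_le_one_le)
  qed (use G in auto)
  moreover have "(\<lambda>n. \<integral>\<xi>. complex_of_real (gauss_weight (real (Suc n)) \<xi>) * G \<xi> \<partial>lborel)
    \<longlonglongrightarrow> 2 * pi * (\<integral>x. g x * (indicator {-1..1} x *\<^sub>R v x) \<partial>lebesgue_on {-R..R})"
  proof -
    have "(\<integral>\<xi>. complex_of_real (gauss_weight (real (Suc n)) \<xi>) * G \<xi> \<partial>lborel)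
      = 2 * pi * (\<integral>x. g x * (\<integral>y. normal_density x (1 / real (Suc n)) y * v y \<partial>leb_I) \<partial>lebesgue_on {-R..R})" for n
      unfolding G_def by (rule gaussian_Parseval[OF gi vi]) simp
    moreover have "(\<lambda>n. \<integral>x. g x * (\<integral>y. normal_density x (1 / real (Suc n)) y * v y \<partial>leb_I) \<partial>lebesgue_on {-R..R})
      \<longlonglongrightarrow> (\<integral>x. g x * (indicator {-1..1} x *\<^sub>R v x) \<partial>lebesgue_on {-R..R})"
    proof (rule integral_dominated_convergence[where w = "\<lambda>x. cmod (g x) * B"])
      have [measurable]: "g \<in> borel_measurable (lebesgue_on {-R..R})" using gi by auto
      have [measurable]: "(\<lambda>x. indicator {-1..1} x *\<^sub>R v x) \<in> borel_measurable (lebesgue_on {-R..R})"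
        by (rule borel_measurable_leb_on) measurable
      show "(\<lambda>x. g x * (indicator {-1..1} x *\<^sub>R v x)) \<in> borel_measurable (lebesgue_on {-R..R})"
        by measurable
      have "(\<lambda>x. \<integral>y. normal_density x (1 / real (Suc n)) y * v y \<partial>leb_I) \<in> borel_measurable borel" for n
      proof -
        have "(\<lambda>x. \<integral>y. normal_density x (1 / real (Suc n)) y * v y \<partial>leb_I)
          = (\<lambda>x. \<integral>z. std_normal_density z *\<^sub>R (indicator {-1..1} (x + 1 / real (Suc n) * z) *\<^sub>R v (x + 1 / real (Suc n) * z)) \<partial>lborel)"
          by (intro ext gaussian_average_eq v) simp
        then show ?thesis by simp
      qed
      then have [measurable]: "(\<lambda>x. \<integral>y. normal_density x (1 / real (Suc n)) y * v y \<partial>leb_I) \<in> borel_measurable (lebesgue_on {-R..R})" for n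
        by (rule borel_measurable_leb_on)
      show "(\<lambda>x. g x * (\<integral>y. normal_density x (1 / real (Suc n)) y * v y \<partial>leb_I)) \<in> borel_measurable (lebesgue_on {-R..R})" for n
        by measurable
      show "integrable (lebesgue_on {-R..R}) (\<lambda>x. cmod (g x) * B)" using gi by simp
      show "AE x in lebesgue_on {-R..R}. norm (g x * (\<integral>y. normal_density x (1 / real (Suc n)) y * v y \<partial>leb_I)) \<le> cmod (g x) * B" for n
        unfolding norm_mult by (intro AE_I2 mult_left_mono gaussian_average_bounded v B) auto
      have "AE x in lebesgue. x \<noteq> -1 \<and> x \<noteq> (1::real)"
        by (intro AE_conjI AE_completion AE_lborel_singleton)
      then have "AE x in lebesgue_on {-R..R}. x \<noteq> -1 \<and> x \<noteq> 1"
        by (subst AE_restrict_space_iff) auto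
      then show "AE x in lebesgue_on {-R..R}. (\<lambda>n. g x * (\<integral>y. normal_density x (1 / real (Suc n)) y * v y \<partial>leb_I))
        \<longlonglongrightarrow> g x * (indicator {-1..1} x *\<^sub>R v x)"
        by eventually_elim (intro tendsto_intros gaussian_average_tendsto v, auto)
    qed
    ultimately show ?thesis by (simp only:) (intro tendsto_intros)
  qed
  ultimately have "(\<integral>\<xi>. G \<xi> \<partial>lborel) = 2 * pi * (\<integral>x. g x * (indicator {-1..1} x *\<^sub>R v x) \<partial>lebesgue_on {-R..R})"
    by (rule LIMSEQ_unique)
  also have "(\<integral>x. g x * (indicator {-1..1} x *\<^sub>R v x) \<partial>lebesgue_on {-R..R}) = (\<integral>x. g x * v x \<partial>leb_I)"
  proof -
    have "(\<integral>x. g x * (indicator {-1..1} x *\<^sub>R v x) \<partial>lebesgue_on {-R..R})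
        = (\<integral>x. indicator {-R..R} x *\<^sub>R (g x * (indicator {-1..1} x *\<^sub>R v x)) \<partial>lebesgue)"
      by (rule integral_restrict_space) auto
    also have "\<dots> = (\<integral>x. indicator {-1..1} x *\<^sub>R (g x * v x) \<partial>lebesgue)"
      using R by (intro Bochner_Integration.integral_cong refl) (auto simp: indicator_def)
    also have "\<dots> = (\<integral>x. g x * v x \<partial>leb_I)"
      by (rule integral_restrict_space[symmetric]) auto
    finally show ?thesis .
  qed
  finally show ?thesis
    unfolding G_def[symmetric] by (simp add: integral_completion)
qed

text \<open>
  The transforms of the truncations of \<open>g\<close> to \<open>[-R,R]\<close> converge to \<open>h\<close> in \<open>L\<^sup>2\<close>. Their pairing with the
  transform of \<open>v\<close> is independent of \<open>R \<ge> 1\<close>, since only the values of \<open>g\<close> on \<open>[-1,1]\<close> enter. The sign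
  convention of the two transforms makes the pairing bilinear, without conjugates.
\<close>

lemma Parseval_has_fourier_transform:
  fixes g h v :: "real \<Rightarrow> complex"
  assumes gh: "has_fourier_transform g h" and v: "continuous_on UNIV v"
  shows "(\<integral>\<xi>. h \<xi> * fourier_int 1 v \<xi> \<partial>lebesgue) = sqrt (2 * pi) * (\<integral>x. g x * v x \<partial>leb_I)"
proof -
  define k where "k = complex_of_real (1 / sqrt (2 * pi))"
  define H where "H R \<xi> = k * fourier_int R g (-\<xi>)" for R \<xi>
  have sqh: "square_integrable lebesgue h" and sqg: "square_integrable lebesgue g"
    using gh by (auto simp: has_fourier_transform_def)
  have sqv: "square_integrable leb_I v" by (rule square_integrable_continuous_leb_I[OF v])
  have sqV: "square_integrable lebesgue (fourier_int 1 v)" by (rule Bessel_fourier_int(1)[OF sqv])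
  have lim: "((\<lambda>R. \<integral>\<^sup>+\<xi>. ennreal ((cmod (h \<xi> - H R \<xi>))\<^sup>2) \<partial>lebesgue) \<longlongrightarrow> 0) at_top"
    using gh by (simp add: has_fourier_transform_def H_def k_def fourier_int_def)
  have sqgR: "square_integrable (lebesgue_on {-R..R}) g" for R
    using sqg integrable_mult_indicator[of "{-R..R}" lebesgue "\<lambda>x. (cmod (g x))\<^sup>2"]
    by (auto simp: square_integrable_def measurable_restrict_space1 integrable_restrict_space)
  have sqH: "square_integrable lebesgue (H R)" for R
  proof -
    have "fourier_int R g \<in> borel_measurable borel"
      by (intro borel_measurable_fourier_int integrable_of_square_integrable sqgR) simp
    note [measurable] = this
    have "integrable lborel (\<lambda>\<xi>. (cmod (fourier_int R g \<xi>))\<^sup>2)"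
      using Bessel_fourier_int(1)[OF sqgR[of R]] by (simp add: square_integrable_def integrable_completion)
    then have "integrable lborel (\<lambda>\<xi>. (cmod (fourier_int R g (0 + (-1) * \<xi>)))\<^sup>2)"
      by (rule lborel_integrable_real_affine) simp
    then have "square_integrable lebesgue (\<lambda>\<xi>. fourier_int R g (-\<xi>))"
      by (auto simp: square_integrable_def integrable_completion intro: measurable_completion)
    then show ?thesis unfolding H_def by (rule square_integrable_cmult)
  qed
  have sqd: "square_integrable lebesgue (\<lambda>\<xi>. h \<xi> - H R \<xi>)" for R
    by (intro square_integrable_diff sqh sqH)
  have HR: "(\<integral>\<xi>. H R \<xi> * fourier_int 1 v \<xi> \<partial>lebesgue) = sqrt (2 * pi) * (\<integral>x. g x * v x \<partial>leb_I)" if "R \<ge> 1" for R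
  proof -
    have "(\<integral>\<xi>. H R \<xi> * fourier_int 1 v \<xi> \<partial>lebesgue) = k * (\<integral>\<xi>. fourier_int R g (-\<xi>) * fourier_int 1 v \<xi> \<partial>lebesgue)"
      unfolding H_def by (simp add: mult.assoc)
    also have "\<dots> = (k * (2 * pi)) * (\<integral>x. g x * v x \<partial>leb_I)"
      using Parseval_fourier_int[OF sqgR that v] by (simp add: mult.assoc)
    also have "k * (2 * pi) = complex_of_real (sqrt (2 * pi))"
      unfolding k_def of_real_mult[symmetric] of_real_eq_iff by (simp add: real_div_sqrt)
    finally show ?thesis .
  qed
  define D where "D = (\<integral>\<xi>. h \<xi> * fourier_int 1 v \<xi> \<partial>lebesgue) - sqrt (2 * pi) * (\<integral>x. g x * v x \<partial>leb_I)"
  have Dle: "cmod D \<le> l2norm lebesgue (\<lambda>\<xi>. h \<xi> - H R \<xi>) * l2norm lebesgue (fourier_int 1 v)" if "R \<ge> 1" for R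
  proof -
    have "D = (\<integral>\<xi>. (h \<xi> - H R \<xi>) * fourier_int 1 v \<xi> \<partial>lebesgue)"
      unfolding D_def HR[OF that, symmetric] left_diff_distrib
      by (intro Bochner_Integration.integral_diff[symmetric] integrable_mult_square_integrable sqh sqH sqV)
    then show ?thesis using Cauchy_Schwarz_l2norm[OF sqd sqV, of R] by simp
  qed
  have "((\<lambda>R. l2norm lebesgue (\<lambda>\<xi>. h \<xi> - H R \<xi>)) \<longlongrightarrow> 0) at_top"
  proof -
    have "ennreal ((l2norm lebesgue (\<lambda>\<xi>. h \<xi> - H R \<xi>))\<^sup>2) = (\<integral>\<^sup>+\<xi>. ennreal ((cmod (h \<xi> - H R \<xi>))\<^sup>2) \<partial>lebesgue)" for R
      unfolding l2norm_power2 using sqd[of R]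
      by (intro nn_integral_eq_integral[symmetric]) (auto simp: square_integrable_def)
    then have "((\<lambda>R. ennreal ((l2norm lebesgue (\<lambda>\<xi>. h \<xi> - H R \<xi>))\<^sup>2)) \<longlongrightarrow> ennreal 0) at_top"
      using lim by simp
    then have "((\<lambda>R. (l2norm lebesgue (\<lambda>\<xi>. h \<xi> - H R \<xi>))\<^sup>2) \<longlongrightarrow> 0) at_top"
      by (rule tendsto_ennrealD) auto
    from tendsto_real_sqrt[OF this] show ?thesis by simp
  qed
  then have "((\<lambda>R. l2norm lebesgue (\<lambda>\<xi>. h \<xi> - H R \<xi>) * l2norm lebesgue (fourier_int 1 v)) \<longlongrightarrow> 0) at_top"
    by (rule tendsto_mult_left_zero)
  then have "cmod D \<le> 0"
    by (rule tendsto_lowerbound) (auto intro!: eventually_at_top_linorderI[of 1] Dle)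
  then show ?thesis by (simp add: D_def)
qed

section \<open>Lower bound for the eigenvalues\<close>

lemma fact_mult_power_le_fact: "fact m * real m ^ k \<le> fact (m + k)"
proof (induction k)
  case (Suc k)
  have "fact m * real m ^ Suc k = real m * (fact m * real m ^ k)" by simp
  also have "\<dots> \<le> real (Suc (m + k)) * fact (m + k)"
    by (intro mult_mono Suc) auto
  finally show ?case by simp
qed simp

text \<open>
  The bound is \<open>ev_const c * ev_rate c ^ (n + 1) * fact (n + 1)\<close> for \<open>1 / \<bar>ev n\<bar>\<close>. The cube collects three factors
  \<open>(4e)\<^sup>m\<close>: one from the coefficients of the polynomial, two from a Taylor polynomial with \<open>2 m\<close> terms. The
  maximum bounds \<open>c\<^sup>-\<^sup>k\<close> for all \<open>k \<le> m\<close>.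
\<close>

definition ev_rate :: "real \<Rightarrow> real" where
  "ev_rate c = (4 * exp 1) ^ 3 * max 1 (1 / c)"

text \<open>
  From this index on, the Taylor error is dominated by the eigenvalue.
\<close>

definition ev_index :: "real \<Rightarrow> nat" where
  "ev_index c = nat \<lceil>4 * ev_rate c * c\<^sup>2\<rceil>"

text \<open>
  For smaller \<open>n\<close> the eigenvalues are bounded below by the eigenvalue at the threshold, as they decrease; the constant depends on \<open>c\<close> only.
\<close>

definition ev_const :: "real \<Rightarrow> real" where
  "ev_const c = 2 * ev_rate c ^ ev_index c * fact (ev_index c)"

lemma ev_rate_ge_1: "1 \<le> ev_rate c"
proof -
  have "1 \<le> (4 * exp (1::real)) ^ 3"
    by (rule one_le_power) (use exp_ge_add_one_self[of 1] in simp)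
  then have "1 * 1 \<le> (4 * exp (1::real)) ^ 3 * max 1 (1 / c)" by (intro mult_mono) auto
  then show ?thesis by (simp add: ev_rate_def)
qed

lemma ev_const_ge_2: "2 \<le> ev_const c"
proof -
  have "1 * 1 \<le> ev_rate c ^ ev_index c * (fact (ev_index c) :: real)"
    by (intro mult_mono one_le_power ev_rate_ge_1 fact_ge_1) (use ev_rate_ge_1[of c] in auto)
  then show ?thesis by (simp add: ev_const_def)
qed

context pswf begin

text \<open>
  For a polynomial \<open>p\<close> of degree at most \<open>n\<close> the square of its norm is a combination of its moments of order at most \<open>n\<close>, which are bounded
  through \<open>Fop c p\<close>. Taking \<open>p\<close> orthogonal to the first \<open>n\<close> eigenfunctions makes \<open>\<parallel>Fop c p\<parallel> \<le> \<bar>ev n\<bar> \<parallel>p\<parallel>\<close>. Expanding up to order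
  \<open>2 (n + 1)\<close>, twice the number of coefficients of \<open>p\<close>, leaves an error with \<open>(2m)!\<close> in the denominator, which beats the factor \<open>m!\<close> from the moments.
\<close>

lemma one_le_ev_plus_Taylor_error:
  defines "A \<equiv> ev_rate c"
  assumes m: "m = Suc n"
  shows "1 \<le> A ^ m * fact m * (cmod (ev n) + 2 * c ^ (2 * m) / fact (2 * m))"
proof -
  define K where "K = 4 * exp (1::real)"
  define b where "b = max 1 (1 / c)"
  have K: "1 \<le> K" using exp_ge_add_one_self[of 1] by (simp add: K_def)
  have b: "1 \<le> b" "1 / c \<le> b" by (auto simp: b_def)
  define X :: "nat \<Rightarrow> real \<Rightarrow> complex" where "X k = (\<lambda>x. of_real x ^ k)" for k
  have sqX: "square_integrable leb_I (X k)" for k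
    unfolding X_def by (intro square_integrable_continuous_leb_I continuous_intros)
  obtain a where a: "\<exists>k\<le>n. a k \<noteq> 0" "\<forall>j<n. (\<Sum>k\<le>n. pswf_coeff \<psi> (X k) j * a k) = 0"
    using exists_nontrivial_solution[of n "\<lambda>j k. pswf_coeff \<psi> (X k) j"] by auto
  define p where "p = (\<lambda>x. \<Sum>k\<le>n. a k * X k x)"
  define L where "L = l2norm leb_I p"
  have sq: "square_integrable leb_I p"
    unfolding p_def by (intro square_integrable_sum square_integrable_cmult sqX)
  have orth: "pswf_coeff \<psi> p j = 0" if "j < n" for j
    using a(2) that by (simp add: p_def pswf_coeff_sum[OF sqX] mult.commute)
  have coef: "cmod (a k) \<le> K ^ m * L" if "k \<le> n" for k
  proof -
    have "p = (\<lambda>x. \<Sum>k<m. a k * of_real x ^ k)"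
      by (simp add: p_def X_def m lessThan_Suc_atMost)
    then show ?thesis
      using cmod_coeff_le_l2norm[of k m a] that unfolding L_def K_def by (simp add: m)
  qed
  have L: "0 < L"
  proof -
    obtain k where "k \<le> n" "a k \<noteq> 0" using a(1) by blast
    then have "0 < K ^ m * L" using coef[of k] by (meson less_le_trans zero_less_norm_iff)
    moreover have "0 \<le> L" by (simp add: L_def)
    ultimately show ?thesis by (cases "L = 0") auto
  qed
  define q where "q = cmod (ev n) + 2 * c ^ (2 * m) / fact (2 * m)"
  have q0: "0 \<le> q" using c_pos by (simp add: q_def)
  have mom: "cmod (moment p k) \<le> fact n * b ^ n * K ^ (2 * m) * (q * L)" if k: "k \<le> n" for k
  proof -
    have "c ^ k / fact k * cmod (moment p k) \<le> K ^ (2 * m) * (l2norm leb_I (Fop c p) + 2 * c ^ (2 * m) / fact (2 * m) * L)"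
      unfolding K_def L_def by (rule cmod_moment_le) (use sq c_pos k m in auto)
    also have "\<dots> \<le> K ^ (2 * m) * (cmod (ev n) * L + 2 * c ^ (2 * m) / fact (2 * m) * L)"
      using K unfolding L_def by (intro mult_left_mono add_right_mono l2norm_Fop_le sq orth) auto
    also have "\<dots> = K ^ (2 * m) * (q * L)" by (simp add: q_def algebra_simps)
    finally have *: "c ^ k / fact k * cmod (moment p k) \<le> K ^ (2 * m) * (q * L)" .
    have "cmod (moment p k) = fact k * (1 / c) ^ k * (c ^ k / fact k * cmod (moment p k))"
      using c_pos by (simp add: power_divide)
    also have "\<dots> \<le> fact n * b ^ n * (K ^ (2 * m) * (q * L))"
    proof (rule mult_mono[OF mult_mono *])
      show "fact k \<le> (fact n :: real)" using k by (rule fact_mono)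
      have "(1 / c) ^ k \<le> b ^ k" using b c_pos by (intro power_mono) auto
      also have "\<dots> \<le> b ^ n" using b k by (intro power_increasing) auto
      finally show "(1 / c) ^ k \<le> b ^ n" .
    qed (use b c_pos in auto)
    finally show ?thesis by (simp add: mult.assoc)
  qed
  have "complex_of_real (L\<^sup>2) = (\<Sum>k\<le>n. cnj (a k) * moment p k)"
  proof -
    have "complex_of_real (L\<^sup>2) = (\<integral>x. (\<Sum>k\<le>n. cnj (a k) * (of_real x ^ k * p x)) \<partial>leb_I)"
      unfolding L_def complex_l2norm_power2
      by (intro Bochner_Integration.integral_cong refl) (simp add: p_def X_def sum_distrib_right mult.assoc)
    also have "\<dots> = (\<Sum>k\<le>n. cnj (a k) * moment p k)"
      unfolding moment_def using integrable_moment[OF sq]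
      by (subst Bochner_Integration.integral_sum) auto
    finally show ?thesis .
  qed
  then have "L\<^sup>2 = cmod (\<Sum>k\<le>n. cnj (a k) * moment p k)"
    by (metis abs_of_nonneg norm_of_real zero_le_power2)
  also have "\<dots> \<le> (\<Sum>k\<le>n. (K ^ m * L) * (fact n * b ^ n * K ^ (2 * m) * (q * L)))"
  proof (rule sum_norm_le)
    fix k assume "k \<in> {..n}"
    then show "cmod (cnj (a k) * moment p k) \<le> (K ^ m * L) * (fact n * b ^ n * K ^ (2 * m) * (q * L))"
      unfolding norm_mult complex_mod_cnj using L K by (intro mult_mono coef mom) auto
  qed
  also have "\<dots> = (K ^ m * K ^ (2 * m)) * b ^ n * (real m * fact n) * q * L\<^sup>2"
    by (simp add: m power2_eq_square)
  also have "\<dots> \<le> (K ^ m * K ^ (2 * m)) * b ^ m * (real m * fact n) * q * L\<^sup>2"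
    using b K q0 L by (intro mult_right_mono mult_left_mono) (auto simp: m)
  also have "\<dots> = (A ^ m * fact m * q) * L\<^sup>2"
  proof -
    have "K ^ m * K ^ (2 * m) = (K ^ 3) ^ m" by (simp flip: power_add power_mult)
    moreover have "real m * fact n = fact m" by (simp add: m)
    ultimately show ?thesis
      by (simp add: A_def ev_rate_def power_mult_distrib flip: K_def b_def)
  qed
  finally have "1 * L\<^sup>2 \<le> (A ^ m * fact m * q) * L\<^sup>2" by simp
  then have "1 \<le> A ^ m * fact m * q" using L by (simp only: mult_le_cancel_right_pos zero_less_power)
  then show ?thesis by (simp add: q_def)
qed

text \<open>
  As \<open>(2m)! \<ge> m! m\<^sup>m\<close>, the Taylor error contributes at most \<open>2 (A c\<^sup>2 / m)\<^sup>m \<le> 1/2\<close> once \<open>m \<ge> 4 A c\<^sup>2\<close>.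
\<close>

lemma inverse_ev_le_large_index:
  assumes m: "m = Suc n" "m \<ge> ev_index c"
  shows "1 / cmod (ev n) \<le> 2 * ev_rate c ^ m * fact m"
proof -
  define A where "A = ev_rate c"
  have A: "1 \<le> A" unfolding A_def by (rule ev_rate_ge_1)
  have mge: "4 * A * c\<^sup>2 \<le> real m"
    using m(2) unfolding ev_index_def A_def by linarith
  have m1: "m \<ge> 1" using m by simp
  have "A ^ m * fact m * (2 * c ^ (2 * m) / fact (2 * m)) \<le> 1 / 2"
  proof -
    have "fact m * real m ^ m \<le> fact (2 * m)"
      using fact_mult_power_le_fact[of m m] by (simp add: mult_2)
    then have "A ^ m * fact m * (2 * c ^ (2 * m) / fact (2 * m)) \<le> A ^ m * fact m * (2 * c ^ (2 * m) / (fact m * real m ^ m))"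
      using A m1 c_pos by (intro mult_left_mono divide_left_mono) auto
    also have "\<dots> = 2 * (A * c\<^sup>2 / real m) ^ m"
      by (simp add: power_divide power_mult_distrib power_mult)
    also have "\<dots> \<le> 2 * (1 / 4) ^ m"
      using mge m1 A by (intro mult_left_mono power_mono) (auto simp: divide_le_eq)
    also have "\<dots> \<le> 2 * (1 / 4) ^ 1"
      using m1 by (intro mult_left_mono power_decreasing) auto
    finally show ?thesis by simp
  qed
  moreover have "1 \<le> A ^ m * fact m * cmod (ev n) + A ^ m * fact m * (2 * c ^ (2 * m) / fact (2 * m))"
    using one_le_ev_plus_Taylor_error[OF m(1)] by (simp add: A_def distrib_left)
  ultimately have "1 \<le> 2 * (A ^ m * fact m * cmod (ev n))" by linarith
  then show ?thesis using ev_pos[of n] by (simp add: divide_le_eq A_def mult_ac)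
qed

lemma inverse_ev_le: "1 / cmod (ev n) \<le> ev_const c * ev_rate c ^ Suc n * fact (Suc n)"
proof -
  define A where "A = ev_rate c"
  define m0 where "m0 = ev_index c"
  have A: "1 \<le> A" unfolding A_def by (rule ev_rate_ge_1)
  have big: "1 \<le> A ^ k * fact k" for k
  proof -
    have "1 * 1 \<le> A ^ k * (fact k :: real)" using A by (intro mult_mono one_le_power fact_ge_1) auto
    then show ?thesis by simp
  qed
  show ?thesis
  proof (cases "Suc n \<ge> m0")
    case True
    have "1 / cmod (ev n) \<le> 2 * (A ^ Suc n * fact (Suc n))"
      using inverse_ev_le_large_index[OF refl True[unfolded m0_def]] unfolding A_def by (simp only: mult.assoc)
    also have "\<dots> \<le> ev_const c * (A ^ Suc n * fact (Suc n))"
      using ev_const_ge_2[of c] big[of "Suc n"] by (intro mult_right_mono) linarith+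
    finally show ?thesis unfolding A_def by (simp only: mult.assoc)
  next
    case False
    then obtain n' where n': "m0 = Suc n'" "n \<le> n'" by (cases m0) auto
    have "1 / cmod (ev n) \<le> 1 / cmod (ev n')"
      using n' ev_pos[of n] ev_pos[of n'] by (intro divide_left_mono ev_antimono mult_pos_pos) auto
    also have "\<dots> \<le> ev_const c"
      using inverse_ev_le_large_index[of m0 n'] n' by (simp only: ev_const_def m0_def)
    also have "\<dots> \<le> ev_const c * (A ^ Suc n * fact (Suc n))"
      using mult_left_mono[OF big[of "Suc n"], of "ev_const c"] ev_const_ge_2[of c] by linarith
    finally show ?thesis unfolding A_def by (simp only: mult.assoc)
  qed
qed

end

section \<open>Low frequencies of functions orthogonal to the first eigenfunctions\<close>

text \<open>
  Functions orthogonal to the first \<open>N\<close> eigenfunctions have almost no frequencies below \<open>band_ratio * N\<close>.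
  The value is chosen such that \<open>8 e * band_ratio = 1 / (2 e)\<close>: one factor \<open>e\<close> is consumed by \<open>N\<^sup>N / N! \<le> e\<^sup>N\<close>, and a factor
  \<open>1/2\<close> is left in each of the \<open>N\<close> factors.
\<close>

definition band_ratio :: real where "band_ratio = 1 / (16 * (exp 1)\<^sup>2)"

lemma band_ratio_pos: "band_ratio > 0" by (simp add: band_ratio_def)

context pswf begin

text \<open>
  \<open>Fop 1 u\<close> is the Fourier transform of \<open>u\<close> without normalisation. Because \<open>u\<close> is orthogonal to the first \<open>N\<close> eigenfunctions,
  \<open>\<parallel>Fop c u\<parallel>\<close> is at most \<open>\<bar>ev N\<bar> \<parallel>u\<parallel>\<close>, hence of the same size \<open>c\<^sup>N / N!\<close> as the Taylor error. So the moments of order below \<open>N\<close> are small,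
  and with them the Taylor polynomial of the Fourier transform.
\<close>

lemma cmod_Fop_orthogonal_le:
  assumes u: "square_integrable leb_I u" and orth: "\<And>j. j < N \<Longrightarrow> pswf_coeff \<psi> u j = 0"
    and N: "N \<ge> 1" and \<xi>: "\<bar>\<xi>\<bar> \<le> R"
  shows "cmod (Fop 1 u \<xi>) \<le> 6 * (8 * exp 1 * (R + c)) ^ N / fact N * l2norm leb_I u"
proof -
  define K where "K = 4 * exp (1::real)"
  define L where "L = l2norm leb_I u"
  have K: "1 \<le> K" using exp_ge_add_one_self[of 1] by (simp add: K_def)
  have L: "0 \<le> L" by (simp add: L_def)
  have R: "0 \<le> R" using \<xi> by linarith
  have mom: "\<bar>\<xi>\<bar> ^ k / fact k * cmod (moment u k) \<le> 4 * K ^ N * (R + c) ^ N / fact N * L" if k: "k < N" for k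
  proof -
    have "l2norm leb_I (Fop c u) \<le> 2 * c ^ N / fact N * L"
    proof -
      have "l2norm leb_I (Fop c u) \<le> cmod (ev N) * L"
        unfolding L_def by (rule l2norm_Fop_le[OF u orth])
      also have "\<dots> \<le> 2 * c ^ N / fact N * L" by (intro mult_right_mono cmod_ev_le N L)
      finally show ?thesis .
    qed
    then have "l2norm leb_I (Fop c u) + 2 * c ^ N / fact N * L
        \<le> 2 * c ^ N / fact N * L + 2 * c ^ N / fact N * L"
      by (rule add_right_mono)
    also have "\<dots> = 4 * c ^ N / fact N * L" by (simp flip: mult_2)
    finally have "l2norm leb_I (Fop c u) + 2 * c ^ N / fact N * L \<le> 4 * c ^ N / fact N * L" .
    then have "K ^ N * (l2norm leb_I (Fop c u) + 2 * c ^ N / fact N * L) \<le> K ^ N * (4 * c ^ N / fact N * L)"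
      using K by (intro mult_left_mono) auto
    then have *: "c ^ k / fact k * cmod (moment u k) \<le> K ^ N * (4 * c ^ N / fact N * L)"
      using cmod_moment_le[OF u k c_pos] unfolding K_def L_def by linarith
    have "\<bar>\<xi>\<bar> ^ k / fact k * cmod (moment u k) = (\<bar>\<xi>\<bar> / c) ^ k * (c ^ k / fact k * cmod (moment u k))"
      using c_pos by (simp add: power_divide)
    also have "\<dots> \<le> (R / c) ^ k * (K ^ N * (4 * c ^ N / fact N * L))"
      using \<xi> c_pos R by (intro mult_mono power_mono divide_right_mono *) auto
    also have "\<dots> = 4 * K ^ N * (R ^ k * c ^ (N - k)) / fact N * L"
      using k c_pos by (simp add: power_divide power_diff)
    also have "\<dots> \<le> 4 * K ^ N * ((R + c) ^ k * (R + c) ^ (N - k)) / fact N * L"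
      using K R c_pos L by (intro mult_right_mono divide_right_mono mult_left_mono mult_mono power_mono) auto
    also have "(R + c) ^ k * (R + c) ^ (N - k) = (R + c) ^ N"
      using k by (simp flip: power_add)
    finally show ?thesis .
  qed
  define T where "T = (\<Sum>k<N. (\<i> * of_real (1 * \<xi>)) ^ k / fact k * moment u k)"
  have "cmod T \<le> (\<Sum>k<N. 4 * K ^ N * (R + c) ^ N / fact N * L)"
    unfolding T_def
  proof (rule sum_norm_le)
    fix k assume "k \<in> {..<N}"
    then show "cmod ((\<i> * of_real (1 * \<xi>)) ^ k / fact k * moment u k) \<le> 4 * K ^ N * (R + c) ^ N / fact N * L"
      using mom[of k] by (simp add: norm_mult norm_power norm_divide)
  qed
  also have "\<dots> = real N * (4 * K ^ N) * ((R + c) ^ N / fact N * L)" by simp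
  finally have T: "cmod T \<le> real N * (4 * K ^ N) * ((R + c) ^ N / fact N * L)" .
  have "cmod (Fop 1 u \<xi> - T) \<le> \<bar>1 * \<xi>\<bar> ^ N / fact N * (sqrt 2 * L)"
    unfolding T_def L_def by (rule cmod_Fop_minus_Taylor_le[OF u N])
  also have "\<dots> \<le> (R + c) ^ N / fact N * (2 * L)"
    using \<xi> c_pos L by (intro mult_mono divide_right_mono power_mono) (auto intro: real_le_lsqrt)
  finally have rem: "cmod (Fop 1 u \<xi> - T) \<le> 2 * ((R + c) ^ N / fact N * L)" by (simp add: mult_ac)
  have "cmod (Fop 1 u \<xi>) \<le> cmod T + cmod (Fop 1 u \<xi> - T)"
    by (metis add_diff_cancel_left' diff_add_cancel norm_triangle_ineq add.commute)
  also have "\<dots> \<le> (real N * (4 * K ^ N) + 2) * ((R + c) ^ N / fact N * L)"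
    using add_mono[OF T rem] by (simp only: distrib_right)
  also have "\<dots> \<le> (6 * (2 * K) ^ N) * ((R + c) ^ N / fact N * L)"
  proof (rule mult_right_mono)
    have "real N \<le> 2 ^ N" using less_exp[of N] by (metis less_imp_le of_nat_le_iff of_nat_numeral of_nat_power)
    then have "real N * (4 * K ^ N) \<le> 2 ^ N * (4 * K ^ N)" using K by (intro mult_right_mono) auto
    moreover have "1 \<le> (2 * K) ^ N" using K by (intro one_le_power) auto
    ultimately show "real N * (4 * K ^ N) + 2 \<le> 6 * (2 * K) ^ N" by (simp add: power_mult_distrib)
    show "0 \<le> (R + c) ^ N / fact N * L" using R c_pos L by auto
  qed
  also have "\<dots> = 6 * (8 * exp 1 * (R + c)) ^ N / fact N * L"
    by (simp add: K_def power_mult_distrib)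
  finally show ?thesis by (simp add: L_def)
qed

text \<open>
  With \<open>R = band_ratio * N\<close> the preceding bound is exponentially small; the shift by \<open>c\<close> costs the constant
  factor \<open>(1 + (c / band_ratio) / N)\<^sup>N \<le> exp (c / band_ratio)\<close>.
\<close>

lemma cmod_Fop_low_frequency_le:
  assumes u: "square_integrable leb_I u" and orth: "\<And>j. j < N \<Longrightarrow> pswf_coeff \<psi> u j = 0"
    and N: "N \<ge> 1" and \<xi>: "\<bar>\<xi>\<bar> \<le> band_ratio * N"
  shows "cmod (Fop 1 u \<xi>) \<le> 6 * (1 / 2) ^ N * exp (c / band_ratio) * l2norm leb_I u"
proof -
  have k: "8 * exp 1 * band_ratio = 1 / (2 * exp (1::real))"
    by (simp add: band_ratio_def power2_eq_square)
  have "8 * exp 1 * (band_ratio * N + c) = (8 * exp 1 * band_ratio) * real N * (1 + c / band_ratio / real N)"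
    using N band_ratio_pos by (simp add: field_simps)
  also have "\<dots> = real N / (2 * exp 1) * (1 + c / band_ratio / real N)" by (simp add: k)
  finally have "(8 * exp 1 * (band_ratio * N + c)) ^ N / fact N
      = (real N ^ N / fact N) / (2 * exp 1) ^ N * (1 + c / band_ratio / real N) ^ N"
    by (simp only: power_mult_distrib power_divide) simp
  also have "\<dots> \<le> exp 1 ^ N / (2 * exp 1) ^ N * exp (c / band_ratio)"
  proof (intro mult_mono divide_right_mono)
    show "real N ^ N / fact N \<le> exp 1 ^ N"
      using power_self_le_exp_fact[of N] by (simp add: divide_le_eq)
    have "(1 + c / band_ratio / real N) ^ N \<le> exp (c / band_ratio / real N) ^ N"
      using c_pos band_ratio_pos by (intro power_mono exp_ge_add_one_self) auto
    also have "\<dots> = exp (c / band_ratio)" using N by (simp flip: exp_of_nat_mult)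
    finally show "(1 + c / band_ratio / real N) ^ N \<le> exp (c / band_ratio)" .
  qed (use c_pos band_ratio_pos in auto)
  also have "exp 1 ^ N / (2 * exp 1) ^ N = (1 / 2 :: real) ^ N"
    by (simp add: power_mult_distrib power_divide)
  finally have "6 * ((8 * exp 1 * (band_ratio * N + c)) ^ N / fact N) * l2norm leb_I u
      \<le> 6 * ((1 / 2) ^ N * exp (c / band_ratio)) * l2norm leb_I u"
    by (intro mult_right_mono mult_left_mono) auto
  then show ?thesis using cmod_Fop_orthogonal_le[OF u orth N \<xi>] by (simp add: mult.assoc)
qed

end

section \<open>Expansion of Sobolev functions\<close>

definition sobolev_weighted_norm :: "real \<Rightarrow> (real \<Rightarrow> complex) \<Rightarrow> real" where
  "sobolev_weighted_norm \<nu> h = sqrt (\<integral>\<xi>. (1 + \<xi>\<^sup>2) powr \<nu> * (cmod (h \<xi>))\<^sup>2 \<partial>lebesgue)"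

lemma square_integrable_cutoff:
  assumes "square_integrable lebesgue h" "S \<in> sets borel"
  shows "square_integrable lebesgue (\<lambda>\<xi>. if \<xi> \<in> S then h \<xi> else 0)"
proof -
  have [measurable]: "h \<in> borel_measurable lebesgue" using assms by (simp add: square_integrable_def)
  have [measurable]: "S \<in> sets lebesgue" using assms by simp
  have "integrable lebesgue (\<lambda>\<xi>. (cmod (if \<xi> \<in> S then h \<xi> else 0))\<^sup>2)"
  proof (rule Bochner_Integration.integrable_bound)
    show "integrable lebesgue (\<lambda>\<xi>. (cmod (h \<xi>))\<^sup>2)" using assms by (simp add: square_integrable_def)
    show "(\<lambda>\<xi>. (cmod (if \<xi> \<in> S then h \<xi> else 0))\<^sup>2) \<in> borel_measurable lebesgue" by measurable
  qed auto
  then show ?thesis by (simp add: square_integrable_def)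
qed

lemma l2norm_le_sobolev:
  assumes h: "square_integrable lebesgue h"
    and int: "integrable lebesgue (\<lambda>\<xi>. (1 + \<xi>\<^sup>2) powr \<nu> * (cmod (h \<xi>))\<^sup>2)"
    and S: "S \<in> sets borel" and B: "B > 0" "\<And>\<xi>. \<xi> \<in> S \<Longrightarrow> 1 \<le> B\<^sup>2 * (1 + \<xi>\<^sup>2) powr \<nu>"
  shows "l2norm lebesgue (\<lambda>\<xi>. if \<xi> \<in> S then h \<xi> else 0) \<le> B * sobolev_weighted_norm \<nu> h"
proof (rule power2_le_imp_le)
  have "(l2norm lebesgue (\<lambda>\<xi>. if \<xi> \<in> S then h \<xi> else 0))\<^sup>2
      \<le> (\<integral>\<xi>. B\<^sup>2 * ((1 + \<xi>\<^sup>2) powr \<nu> * (cmod (h \<xi>))\<^sup>2) \<partial>lebesgue)"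
    unfolding l2norm_power2
  proof (rule integral_mono)
    show "integrable lebesgue (\<lambda>\<xi>. (cmod (if \<xi> \<in> S then h \<xi> else 0))\<^sup>2)"
      using square_integrable_cutoff[OF h S] by (simp add: square_integrable_def)
    show "integrable lebesgue (\<lambda>\<xi>. B\<^sup>2 * ((1 + \<xi>\<^sup>2) powr \<nu> * (cmod (h \<xi>))\<^sup>2))"
      using int by simp
    fix \<xi> :: real
    show "(cmod (if \<xi> \<in> S then h \<xi> else 0))\<^sup>2 \<le> B\<^sup>2 * ((1 + \<xi>\<^sup>2) powr \<nu> * (cmod (h \<xi>))\<^sup>2)"
      using mult_right_mono[OF B(2), of \<xi> "(cmod (h \<xi>))\<^sup>2"] by (auto simp: mult.assoc)
  qed
  also have "\<dots> = B\<^sup>2 * (sobolev_weighted_norm \<nu> h)\<^sup>2"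
    by (simp add: sobolev_weighted_norm_def)
  finally show "(l2norm lebesgue (\<lambda>\<xi>. if \<xi> \<in> S then h \<xi> else 0))\<^sup>2 \<le> (B * sobolev_weighted_norm \<nu> h)\<^sup>2"
    by (simp add: power_mult_distrib)
next
  show "0 \<le> B * sobolev_weighted_norm \<nu> h"
    using B by (simp add: sobolev_weighted_norm_def)
qed

text \<open>
  The first summand comes from the frequencies up to \<open>band_ratio * N\<close>, the second from the ones above.
\<close>

definition approx_rate :: "real \<Rightarrow> real \<Rightarrow> nat \<Rightarrow> real" where
  "approx_rate c \<nu> N = 6 * (1 / 2) ^ N * exp (c / band_ratio) * sqrt (2 * band_ratio * N) + sqrt (2 * pi) * (band_ratio * N) powr (- \<nu>)"

context pswf begin

text \<open>
  An eigenfunction is its own image under \<open>Fop c\<close> up to the factor \<open>ev j\<close>, and images under \<open>Fop c\<close> are continuous.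
\<close>

lemma AE_eq_continuous:
  "\<exists>v. continuous_on UNIV v \<and> (AE x in leb_I. (\<Sum>j\<in>A. d j * \<Psi> j x) = v x)"
proof (intro exI conjI)
  show "continuous_on UNIV (\<lambda>x. \<Sum>j\<in>A. d j * (Fop c (\<Psi> j) x / ev j))"
  proof -
    have "ev j \<noteq> 0" for j using ev_pos[of j] by auto
    then show ?thesis by (intro continuous_intros continuous_on_Fop square_integrable_\<Psi>) auto
  qed
  have "AE x in leb_I. \<forall>j. Fop c (\<Psi> j) x = ev j * \<Psi> j x"
    using eigenfunction by (simp add: AE_all_countable)
  then show "AE x in leb_I. (\<Sum>j\<in>A. d j * \<Psi> j x) = (\<Sum>j\<in>A. d j * (Fop c (\<Psi> j) x / ev j))"
  proof eventually_elim
    case (elim x)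
    have "ev j \<noteq> 0" for j using ev_pos[of j] by auto
    then show ?case using elim by simp
  qed
qed

text \<open>
  By Parseval's identity the integral is a pairing of the Fourier transforms of \<open>g\<close> and \<open>u\<close>. Below the frequency \<open>R\<close> the transform of
  \<open>u\<close> is tiny, above it the transform \<open>h\<close> of \<open>g\<close> has norm at most \<open>R\<^sup>-\<^sup>\<nu>\<close> times the Sobolev norm.
\<close>

lemma cmod_integral_tail_le:
  fixes d :: "nat \<Rightarrow> complex" and A :: "nat set"
  defines "u \<equiv> \<lambda>x. \<Sum>j\<in>A. d j * \<Psi> j x"
  assumes \<nu>: "\<nu> > 0" and f: "square_integrable leb_I f"
    and gf: "AE x in leb_I. g x = f x" and gh: "has_fourier_transform g h"
    and int: "integrable lebesgue (\<lambda>\<xi>. (1 + \<xi>\<^sup>2) powr \<nu> * (cmod (h \<xi>))\<^sup>2)"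
    and A: "finite A" "A \<subseteq> {N..}" and N: "N \<ge> 1"
  shows "cmod (\<integral>x. f x * u x \<partial>leb_I) \<le> approx_rate c \<nu> N * sobolev_weighted_norm \<nu> h * l2norm leb_I u"
proof -
  define H where "H = sobolev_weighted_norm \<nu> h"
  define R where "R = band_ratio * real N"
  have R: "R > 0" using N band_ratio_pos by (simp add: R_def)
  define e where "e = 6 * (1 / 2) ^ N * exp (c / band_ratio) * l2norm leb_I u"
  have e0: "0 \<le> e" by (simp add: e_def)
  have sqh: "square_integrable lebesgue h" and sqg: "square_integrable lebesgue g"
    using gh by (auto simp: has_fourier_transform_def)
  have squ: "square_integrable leb_I u" unfolding u_def by (rule square_integrable_comb)
  have orth: "pswf_coeff \<psi> u j = 0" if "j < N" for j
    using A that by (auto simp: u_def pswf_coeff_comb)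
  obtain v where v: "continuous_on UNIV v" "AE x in leb_I. u x = v x"
    using AE_eq_continuous[of d A] unfolding u_def by blast
  have sqv: "square_integrable leb_I v" by (rule square_integrable_continuous_leb_I[OF v(1)])
  define U where "U = fourier_int 1 u"
  have sqU: "square_integrable lebesgue U"
    unfolding U_def by (rule Bessel_fourier_int(1)) (use squ in simp)
  have U_le: "l2norm lebesgue U \<le> sqrt (2 * pi) * l2norm leb_I u"
    unfolding U_def by (rule Bessel_fourier_int(2)) (use squ in simp)
  have Uv: "U = fourier_int 1 v"
  proof (rule ext)
    fix \<xi>
    show "U \<xi> = fourier_int 1 v \<xi>"
      unfolding U_def fourier_int_def
    proof (rule integral_cong_AE)
      show "AE x in leb_I. exp (\<i> * complex_of_real (x * \<xi>)) * u x = exp (\<i> * complex_of_real (x * \<xi>)) * v x"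
        using v(2) by eventually_elim simp
      have *: "(\<lambda>x. exp (\<i> * complex_of_real (x * \<xi>))) \<in> borel_measurable leb_I"
        by (intro borel_measurable_continuous_leb_on continuous_intros)
      show "(\<lambda>x. exp (\<i> * complex_of_real (x * \<xi>)) * u x) \<in> borel_measurable leb_I"
        "(\<lambda>x. exp (\<i> * complex_of_real (x * \<xi>)) * v x) \<in> borel_measurable leb_I"
        by (intro borel_measurable_times * square_integrable_measurable squ sqv)+
    qed
  qed
  have fu: "(\<integral>x. f x * u x \<partial>leb_I) = (\<integral>x. g x * v x \<partial>leb_I)"
  proof (rule integral_cong_AE)
    have gm: "g \<in> borel_measurable leb_I"
      using sqg by (auto simp: square_integrable_def intro: measurable_restrict_space1)
    show "AE x in leb_I. f x * u x = g x * v x"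
      using v(2) gf by eventually_elim simp
    show "(\<lambda>x. f x * u x) \<in> borel_measurable leb_I" "(\<lambda>x. g x * v x) \<in> borel_measurable leb_I"
      by (intro borel_measurable_times gm square_integrable_measurable squ sqv f)+
  qed
  have "cmod (\<integral>x. f x * u x \<partial>leb_I) = 1 * cmod (\<integral>x. g x * v x \<partial>leb_I)" by (simp add: fu)
  also have "\<dots> \<le> sqrt (2 * pi) * cmod (\<integral>x. g x * v x \<partial>leb_I)"
    by (intro mult_right_mono real_le_rsqrt) (use pi_gt3 in auto)
  also have "\<dots> = cmod (complex_of_real (sqrt (2 * pi)) * (\<integral>x. g x * v x \<partial>leb_I))"
    by (simp add: norm_mult)
  also have "complex_of_real (sqrt (2 * pi)) * (\<integral>x. g x * v x \<partial>leb_I) = (\<integral>\<xi>. h \<xi> * U \<xi> \<partial>lebesgue)"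
    unfolding Uv by (rule Parseval_has_fourier_transform[OF gh v(1), symmetric])
  finally have main: "cmod (\<integral>x. f x * u x \<partial>leb_I) \<le> cmod (\<integral>\<xi>. h \<xi> * U \<xi> \<partial>lebesgue)" .
  \<comment> \<open>The product \<open>h U\<close> is split at the frequency \<open>R\<close>, cutting off whichever factor is small there.\<close>
  define U1 where "U1 = (\<lambda>\<xi>. if \<xi> \<in> {-R..R} then U \<xi> else 0)"
  define h2 where "h2 = (\<lambda>\<xi>. if \<xi> \<in> - {-R..R} then h \<xi> else 0)"
  have sqU1: "square_integrable lebesgue U1" unfolding U1_def by (rule square_integrable_cutoff[OF sqU]) simp
  have sqh2: "square_integrable lebesgue h2" unfolding h2_def by (rule square_integrable_cutoff[OF sqh]) simp
  have split: "(\<integral>\<xi>. h \<xi> * U \<xi> \<partial>lebesgue) = (\<integral>\<xi>. h \<xi> * U1 \<xi> \<partial>lebesgue) + (\<integral>\<xi>. h2 \<xi> * U \<xi> \<partial>lebesgue)"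
  proof -
    have "(\<integral>\<xi>. h \<xi> * U \<xi> \<partial>lebesgue) = (\<integral>\<xi>. h \<xi> * U1 \<xi> + h2 \<xi> * U \<xi> \<partial>lebesgue)"
      by (intro Bochner_Integration.integral_cong refl) (auto simp: U1_def h2_def)
    also have "\<dots> = (\<integral>\<xi>. h \<xi> * U1 \<xi> \<partial>lebesgue) + (\<integral>\<xi>. h2 \<xi> * U \<xi> \<partial>lebesgue)"
      by (intro Bochner_Integration.integral_add integrable_mult_square_integrable sqh sqU1 sqh2 sqU)
    finally show ?thesis .
  qed
  have h_le: "l2norm lebesgue h \<le> H"
  proof -
    have "l2norm lebesgue (\<lambda>\<xi>. if \<xi> \<in> UNIV then h \<xi> else 0) \<le> 1 * sobolev_weighted_norm \<nu> h"
      using \<nu> by (intro l2norm_le_sobolev sqh int) (auto intro!: ge_one_powr_ge_zero)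
    then show ?thesis by (simp add: H_def)
  qed
  have h2_le: "l2norm lebesgue h2 \<le> R powr (-\<nu>) * H"
    unfolding h2_def H_def
  proof (rule l2norm_le_sobolev[OF sqh int])
    fix \<xi> assume "\<xi> \<in> - {-R..R}"
    then have "R < \<bar>\<xi>\<bar>" by auto
    then have "R\<^sup>2 \<le> \<xi>\<^sup>2" using R by (metis abs_le_square_iff abs_of_pos less_imp_le)
    then have "R\<^sup>2 powr \<nu> \<le> (1 + \<xi>\<^sup>2) powr \<nu>" using \<nu> by (intro powr_mono2) auto
    then have "(R powr (-\<nu>))\<^sup>2 * R\<^sup>2 powr \<nu> \<le> (R powr (-\<nu>))\<^sup>2 * (1 + \<xi>\<^sup>2) powr \<nu>"
      by (intro mult_left_mono) auto
    moreover have "(R powr (-\<nu>))\<^sup>2 * R\<^sup>2 powr \<nu> = 1"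
      using R by (simp add: powr_minus_divide power2_eq_square powr_mult)
    ultimately show "1 \<le> (R powr (-\<nu>))\<^sup>2 * (1 + \<xi>\<^sup>2) powr \<nu>" by simp
  qed (use R in auto)
  have U1_le: "l2norm lebesgue U1 \<le> e * sqrt (2 * R)"
  proof (rule power2_le_imp_le)
    have "(l2norm lebesgue U1)\<^sup>2 \<le> (\<integral>\<xi>. e\<^sup>2 * indicator {-R..R} \<xi> \<partial>lebesgue)"
      unfolding l2norm_power2
    proof (rule integral_mono)
      show "integrable lebesgue (\<lambda>\<xi>. (cmod (U1 \<xi>))\<^sup>2)" using sqU1 by (simp add: square_integrable_def)
      show "integrable lebesgue (\<lambda>\<xi>. e\<^sup>2 * indicator {-R..R} \<xi>)" using R by (intro integrable_mult_right) (simp add: integrable_indicator_iff)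
      fix \<xi>
      have "cmod (U \<xi>) \<le> e" if "\<bar>\<xi>\<bar> \<le> R"
        using cmod_Fop_low_frequency_le[OF squ orth N, of \<xi>] that
        by (simp add: U_def e_def Fop_eq_fourier_int R_def)
      then show "(cmod (U1 \<xi>))\<^sup>2 \<le> e\<^sup>2 * indicator {-R..R} \<xi>"
        by (auto simp: U1_def indicator_def abs_le_iff intro!: power_mono)
    qed
    also have "\<dots> = e\<^sup>2 * (2 * R)" using R by simp
    finally show "(l2norm lebesgue U1)\<^sup>2 \<le> (e * sqrt (2 * R))\<^sup>2" using R by (simp add: power_mult_distrib)
  qed (use e0 R in simp)
  have "cmod (\<integral>\<xi>. h \<xi> * U \<xi> \<partial>lebesgue) \<le> l2norm lebesgue h * l2norm lebesgue U1 + l2norm lebesgue h2 * l2norm lebesgue U"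
    unfolding split
    by (rule order_trans[OF norm_triangle_ineq add_mono]) (intro Cauchy_Schwarz_l2norm sqh sqU1 sqh2 sqU)+
  also have "\<dots> \<le> H * (e * sqrt (2 * R)) + (R powr (-\<nu>) * H) * (sqrt (2 * pi) * l2norm leb_I u)"
    using order_trans[OF l2norm_nonneg h_le]
    by (intro add_mono mult_mono h_le U1_le h2_le U_le) auto
  also have "\<dots> = approx_rate c \<nu> N * H * l2norm leb_I u"
    by (simp add: approx_rate_def e_def R_def algebra_simps)
  finally show ?thesis using main by (simp add: H_def)
qed

text \<open>
  Duality: the tail of the expansion of \<open>f\<close> is tested against its own conjugate, which gives the square of its norm. Finite
  parts of the tail suffice, by Parseval's identity for the expansion.
\<close>

lemma approximation_error_le:
  assumes \<nu>: "\<nu> > 0" and f: "square_integrable leb_I f"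
    and gf: "AE x in leb_I. g x = f x" and gh: "has_fourier_transform g h"
    and int: "integrable lebesgue (\<lambda>\<xi>. (1 + \<xi>\<^sup>2) powr \<nu> * (cmod (h \<xi>))\<^sup>2)"
  shows "l2norm leb_I (\<lambda>x. f x - (\<Sum>j\<le>n. pswf_coeff \<psi> f j * \<Psi> j x))
    \<le> approx_rate c \<nu> (Suc n) * sobolev_weighted_norm \<nu> h"
proof -
  define D where "D = approx_rate c \<nu> (Suc n) * sobolev_weighted_norm \<nu> h"
  define F where "F = pswf_coeff \<psi> f"
  have D0: "0 \<le> D" using band_ratio_pos by (simp add: D_def approx_rate_def sobolev_weighted_norm_def)
  have tail: "(\<Sum>j\<in>A. (cmod (F j))\<^sup>2) \<le> D\<^sup>2" if A: "finite A" "A \<subseteq> {Suc n..}" for A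
  proof -
    define u where "u = (\<lambda>x. \<Sum>j\<in>A. cnj (F j) * \<Psi> j x)"
    have nrm: "(l2norm leb_I u)\<^sup>2 = (\<Sum>j\<in>A. (cmod (F j))\<^sup>2)"
      unfolding u_def using l2norm_comb[OF A(1)] by simp
    have "(\<integral>x. f x * u x \<partial>leb_I) = (\<integral>x. u x * f x \<partial>leb_I)" by (simp add: mult.commute)
    also have "\<dots> = (\<Sum>j\<in>A. cnj (F j) * F j)"
      unfolding u_def F_def by (rule integral_comb_mult[OF f])
    also have "\<dots> = complex_of_real ((l2norm leb_I u)\<^sup>2)"
      by (simp add: nrm complex_norm_square mult.commute del: of_real_power)
    finally have "(l2norm leb_I u)\<^sup>2 = cmod (\<integral>x. f x * u x \<partial>leb_I)"
      by (metis abs_of_nonneg norm_of_real zero_le_power2)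
    also have "\<dots> \<le> D * l2norm leb_I u"
      unfolding u_def D_def by (rule cmod_integral_tail_le[OF \<nu> f gf gh int A]) simp
    finally have "l2norm leb_I u * l2norm leb_I u \<le> D * l2norm leb_I u" by (simp add: power2_eq_square)
    then have "l2norm leb_I u \<le> D"
      using D0 by (cases "l2norm leb_I u = 0") (auto simp: mult_le_cancel_right less_le)
    then show ?thesis unfolding nrm[symmetric] by (intro power_mono) auto
  qed
  define r where "r = (\<lambda>x. f x - (\<Sum>j\<le>n. F j * \<Psi> j x))"
  have r: "square_integrable leb_I r" unfolding r_def by (intro square_integrable_diff f square_integrable_comb)
  have rc: "pswf_coeff \<psi> r j = (if j \<le> n then 0 else F j)" for j
    unfolding r_def by (simp add: pswf_coeff_diff[OF f square_integrable_comb] pswf_coeff_comb F_def)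
  have "(l2norm leb_I r)\<^sup>2 \<le> D\<^sup>2"
  proof (rule LIMSEQ_le_const2[OF Parseval_pswf[OF r]], intro exI allI impI)
    fix m
    have "(\<Sum>j\<le>m. (cmod (pswf_coeff \<psi> r j))\<^sup>2) = (\<Sum>j\<in>{Suc n..m}. (cmod (F j))\<^sup>2)"
      by (rule sum.mono_neutral_cong_right) (auto simp: rc)
    also have "\<dots> \<le> D\<^sup>2" by (rule tail) auto
    finally show "(\<Sum>j\<le>m. (cmod (pswf_coeff \<psi> r j))\<^sup>2) \<le> D\<^sup>2" .
  qed
  then have "l2norm leb_I r \<le> D" by (rule power2_le_imp_le) (rule D0)
  then show ?thesis by (simp add: r_def D_def F_def)
qed

text \<open>
  The bound holds for every extension of \<open>f\<close> to the real line, so it passes to the infimum.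
\<close>

lemma approximation_error_sobolev:
  assumes \<nu>: "\<nu> > 0" and f: "square_integrable leb_I f" "f \<in> sobolev_space \<nu>"
  shows "l2norm leb_I (\<lambda>x. f x - (\<Sum>j\<le>n. pswf_coeff \<psi> f j * \<Psi> j x))
    \<le> approx_rate c \<nu> (Suc n) * sobolev_norm \<nu> f"
proof -
  define a where "a = approx_rate c \<nu> (Suc n)"
  have a: "a > 0" using band_ratio_pos unfolding a_def approx_rate_def by (intro add_nonneg_pos) auto
  define E where "E = l2norm leb_I (\<lambda>x. f x - (\<Sum>j\<le>n. pswf_coeff \<psi> f j * \<Psi> j x))"
  have "E / a \<le> Inf (sobolev_extension_norms \<nu> f)"
  proof (rule cInf_greatest)
    show "sobolev_extension_norms \<nu> f \<noteq> {}" using f(2) by (simp add: sobolev_space_def)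
    fix s assume "s \<in> sobolev_extension_norms \<nu> f"
    then obtain g h where gh: "s = sobolev_weighted_norm \<nu> h" "AE x in leb_I. g x = f x" "has_fourier_transform g h"
      "integrable lebesgue (\<lambda>\<xi>. (1 + \<xi>\<^sup>2) powr \<nu> * (cmod (h \<xi>))\<^sup>2)"
      unfolding sobolev_extension_norms_def sobolev_weighted_norm_def by blast
    then have "E \<le> a * s" unfolding E_def a_def gh(1) by (intro approximation_error_le[OF \<nu> f(1)])
    then show "E / a \<le> s" using a by (simp add: divide_le_eq mult.commute)
  qed
  then show ?thesis using a by (simp add: E_def a_def sobolev_norm_def divide_le_eq mult.commute)
qed

end

lemma sobolev_norm_nonneg:
  assumes "f \<in> sobolev_space \<nu>"
  shows "0 \<le> sobolev_norm \<nu> f"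
  unfolding sobolev_norm_def
proof (rule cInf_greatest)
  show "sobolev_extension_norms \<nu> f \<noteq> {}" using assms by (simp add: sobolev_space_def)
  show "0 \<le> s" if "s \<in> sobolev_extension_norms \<nu> f" for s
    using that by (auto simp: sobolev_extension_norms_def)
qed

text \<open>
  The exponentially small contribution of low frequencies is dominated by any power of \<open>N\<close>.
\<close>

lemma approx_rate_le:
  assumes "c > 0" "\<nu> > 0"
  shows "\<exists>C>0. \<forall>N\<ge>1. approx_rate c \<nu> N \<le> C * real N powr (- \<nu>)"
proof -
  have "(\<lambda>N. (1 / 2) ^ N * sqrt (real N) * real N powr \<nu>) \<longlonglongrightarrow> 0"
    using assms by real_asymp
  then have "Bseq (\<lambda>N. (1 / 2) ^ N * sqrt (real N) * real N powr \<nu>)"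
    by (rule convergent_imp_Bseq[OF convergentI])
  then obtain B where B: "B > 0" "\<And>N. norm ((1 / 2) ^ N * sqrt (real N) * real N powr \<nu>) \<le> B"
    by (auto simp: Bseq_def)
  define a where "a = 6 * exp (c / band_ratio) * sqrt (2 * band_ratio)"
  define b where "b = sqrt (2 * pi) * band_ratio powr (-\<nu>)"
  have ab: "a > 0" "b > 0" using band_ratio_pos by (auto simp: a_def b_def)
  show ?thesis
  proof (intro exI[of _ "a * B + b"] conjI allI impI)
    show "0 < a * B + b" using ab B(1) by (intro add_pos_pos mult_pos_pos)
    fix N :: nat assume N: "N \<ge> 1"
    have "(1 / 2) ^ N * sqrt (real N) * real N powr \<nu> \<le> B"
      using B(2)[of N] by simp
    then have "(1 / 2) ^ N * sqrt (real N) \<le> B * real N powr (-\<nu>)"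
      using N by (simp add: powr_minus field_simps)
    then have "a * ((1 / 2) ^ N * sqrt (real N)) \<le> a * (B * real N powr (-\<nu>))"
      using ab by (intro mult_left_mono) auto
    moreover have "approx_rate c \<nu> N = a * ((1 / 2) ^ N * sqrt (real N)) + b * real N powr (-\<nu>)"
      using band_ratio_pos by (simp add: approx_rate_def a_def b_def real_sqrt_mult powr_mult)
    ultimately show "approx_rate c \<nu> N \<le> (a * B + b) * real N powr (-\<nu>)"
      by (simp add: distrib_right)
  qed
qed

section \<open>The truncation index\<close>

lemma ex1_mult_ln_eq:
  assumes "y \<ge> (0::real)"
  shows "\<exists>!t. t \<ge> 1 \<and> t * ln t = y"
proof (rule ex_ex1I)
  define T where "T = exp 1 + y"
  have T: "exp 1 \<le> T" "1 \<le> T" using assms exp_ge_add_one_self[of "1::real"] by (auto simp: T_def)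
  have "1 \<le> ln T" using T by (subst ln_ge_iff) auto
  then have "y * 1 \<le> T * ln T" using assms by (intro mult_mono) (auto simp: T_def)
  moreover have "continuous_on {1..T} (\<lambda>t. t * ln t)" by (intro continuous_intros) auto
  ultimately show "\<exists>t. t \<ge> 1 \<and> t * ln t = y"
    using IVT'[of "\<lambda>t. t * ln t" 1 y T] T assms by auto
next
  have less: "s * ln s < t * ln t" if "1 \<le> s" "s < t" for s t :: real
    using that by (intro mult_strict_mono) auto
  fix s t assume "s \<ge> 1 \<and> s * ln s = y" "t \<ge> 1 \<and> t * ln t = y"
  then show "s = t" using less[of s t] less[of t s] by (cases s t rule: linorder_cases) auto
qed

lemma tau_properties:
  assumes "c > 0" "\<alpha> > 0" "0 < \<delta>" "\<delta> < 1"
  shows "tau c \<alpha> \<delta> \<ge> 1" "exp 1 * c / 4 * (tau c \<alpha> \<delta> * ln (tau c \<alpha> \<delta>)) = \<alpha> * ln (1 / \<delta>)"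
proof -
  have "0 \<le> 4 / (exp 1 * c) * \<alpha> * ln (1 / \<delta>)" using assms by simp
  from theI'[OF ex1_mult_ln_eq[OF this], folded tau_def]
  show "tau c \<alpha> \<delta> \<ge> 1" "exp 1 * c / 4 * (tau c \<alpha> \<delta> * ln (tau c \<alpha> \<delta>)) = \<alpha> * ln (1 / \<delta>)"
    using assms by auto
qed

lemma nstar_bounds:
  assumes "c > 0" "\<alpha> > 0" "0 < \<delta>" "\<delta> < 1"
  shows "exp 1 * c / 4 * tau c \<alpha> \<delta> \<le> nstar c \<alpha> \<delta>" "nstar c \<alpha> \<delta> \<le> exp 1 * c / 4 * tau c \<alpha> \<delta> + 3"
proof -
  have "0 \<le> exp 1 * c / 4 * tau c \<alpha> \<delta>" using tau_properties(1)[OF assms] assms by simp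
  then show "exp 1 * c / 4 * tau c \<alpha> \<delta> \<le> nstar c \<alpha> \<delta>" "nstar c \<alpha> \<delta> \<le> exp 1 * c / 4 * tau c \<alpha> \<delta> + 3"
    unfolding nstar_def mult.commute[of "tau c \<alpha> \<delta>"] by linarith+
qed

text \<open>
  The real variable \<open>x\<close> replaces \<open>m\<close> so that calculus can be applied to the bound.
\<close>

lemma power_fact_le_powr:
  fixes A x :: real
  assumes "A \<ge> 1" "real m \<le> x" "m \<ge> 1"
  shows "A ^ m * fact m \<le> exp (x * ln (A * x))"
proof -
  have x: "x \<ge> 1" using assms by linarith
  have Ax: "1 \<le> A * x" using mult_mono[of 1 A 1 x] assms x by simp
  have "A ^ m * fact m \<le> A ^ m * real m ^ m"
    using assms fact_le_power[of m, where 'a = real] by (intro mult_left_mono) auto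
  also have "\<dots> = (A * real m) ^ m" by (simp add: power_mult_distrib)
  also have "\<dots> \<le> (A * x) ^ m" using assms by (intro power_mono mult_left_mono) auto
  also have "\<dots> = (A * x) powr real m" using Ax by (simp add: powr_realpow)
  also have "\<dots> \<le> (A * x) powr x" using Ax assms by (intro powr_mono) auto
  also have "\<dots> = exp (x * ln (A * x))" using Ax by (auto simp: powr_def)
  finally show ?thesis .
qed

text \<open>
  With \<open>x = a t + 4\<close>, the quotient of \<open>x ln (A x)\<close> and \<open>a t ln t\<close> tends to \<open>1\<close>, so any \<open>\<gamma> > 1\<close> wins for large \<open>t\<close>, and on the remaining
  bounded range of \<open>t\<close> the left-hand side is bounded.
\<close>

lemma super_exponential_growth_bound:
  fixes a A \<gamma> :: real
  assumes a: "a > 0" and A: "A \<ge> 1" and \<gamma>: "\<gamma> > 1"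
  shows "\<exists>C>0. \<forall>t\<ge>1. \<forall>m. 1 \<le> m \<and> real m \<le> a * t + 4 \<longrightarrow> A ^ m * fact m \<le> C * exp (\<gamma> * (a * (t * ln t)))"
proof -
  define g where "g t = (a * t + 4) * ln (A * (a * t + 4))" for t
  have "((\<lambda>t. g t / (a * (t * ln t))) \<longlongrightarrow> 1) at_top"
    unfolding g_def using a A by real_asymp
  then have "eventually (\<lambda>t. g t / (a * (t * ln t)) < \<gamma>) at_top"
    using \<gamma> by (rule order_tendstoD)
  moreover have "eventually (\<lambda>t::real. t > 1) at_top" by (rule eventually_gt_at_top)
  ultimately have "eventually (\<lambda>t. g t \<le> \<gamma> * (a * (t * ln t))) at_top"
  proof eventually_elim
    case (elim t)
    then have "0 < a * (t * ln t)" using a by simp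
    then show ?case using elim by (simp add: divide_less_eq)
  qed
  then obtain T0 where T0: "\<And>t. t \<ge> T0 \<Longrightarrow> g t \<le> \<gamma> * (a * (t * ln t))"
    by (auto simp: eventually_at_top_linorder)
  define T where "T = max 1 T0"
  have T: "T \<ge> 1" "T \<ge> T0" by (auto simp: T_def)
  have gmono: "g s \<le> g t" if "1 \<le> s" "s \<le> t" for s t
  proof -
    have s: "1 \<le> a * s + 4" "a * s + 4 \<le> a * t + 4" using a that by auto
    have "1 * 1 \<le> A * (a * s + 4)" by (intro mult_mono A s) (use A in auto)
    moreover have "A * (a * s + 4) \<le> A * (a * t + 4)" using A s by (intro mult_left_mono) auto
    ultimately show ?thesis unfolding g_def using s A by (intro mult_mono ln_mono) auto
  qed
  have "exp (g t) \<le> exp (g T) * exp (\<gamma> * (a * (t * ln t)))" if t: "t \<ge> 1" for t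
  proof -
    have pos: "0 \<le> \<gamma> * (a * (t * ln t))" using \<gamma> a t by simp
    have gT: "0 \<le> g T"
    proof -
      have "1 \<le> a * T + 4" using a T by simp
      moreover from this have "1 * 1 \<le> A * (a * T + 4)" by (intro mult_mono A) (use A in auto)
      ultimately show ?thesis unfolding g_def by (intro mult_nonneg_nonneg) auto
    qed
    have "g t \<le> g T + \<gamma> * (a * (t * ln t))"
      using T0[of t] gmono[of t T] t T pos gT by (cases "t \<le> T") auto
    then show ?thesis by (simp flip: exp_add)
  qed
  then show ?thesis
    using power_fact_le_powr[OF A] unfolding g_def
    by (intro exI[of _ "exp (g T)"]) (auto simp: g_def intro: order_trans)
qed

text \<open>
  For \<open>\<gamma> = (1 - \<beta>) / \<alpha> > 1\<close>, the growth bound for \<open>1 / \<bar>ev n\<^sup>*\<bar>\<close> is \<open>exp (\<gamma> \<alpha> ln (1/\<delta>)) = \<delta> powr (\<beta> - 1)\<close>, by the equation that defines \<open>\<tau>\<close>.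
\<close>

lemma noise_amplification_bound:
  assumes c: "c > 0" and \<alpha>: "0 < \<alpha>" and \<beta>: "\<beta> < 1 - \<alpha>"
  shows "\<exists>C>0. \<forall>\<psi> ev \<delta>. is_pswf_system c \<psi> ev \<and> 0 < \<delta> \<and> \<delta> < 1 \<longrightarrow>
    \<delta> / cmod (ev (nstar c \<alpha> \<delta>)) \<le> C * \<delta> powr \<beta>"
proof -
  define a where "a = exp 1 * c / 4"
  define \<gamma> where "\<gamma> = (1 - \<beta>) / \<alpha>"
  have a: "a > 0" using c by (simp add: a_def)
  have \<gamma>: "\<gamma> > 1" using \<alpha> \<beta> by (simp add: \<gamma>_def)
  obtain C where C: "C > 0"
    "\<And>t m. t \<ge> 1 \<Longrightarrow> 1 \<le> m \<Longrightarrow> real m \<le> a * t + 4 \<Longrightarrow> ev_rate c ^ m * fact m \<le> C * exp (\<gamma> * (a * (t * ln t)))"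
    using super_exponential_growth_bound[OF a ev_rate_ge_1 \<gamma>, of c] by blast
  show ?thesis
  proof (intro exI[of _ "ev_const c * C"] conjI allI impI)
    show "0 < ev_const c * C" using C ev_const_ge_2[of c] by (intro mult_pos_pos) linarith+
    fix \<psi> ev \<delta> assume as: "is_pswf_system c \<psi> ev \<and> 0 < \<delta> \<and> \<delta> < (1::real)"
    then interpret pswf c \<psi> ev by unfold_locales (use c in auto)
    have \<delta>: "0 < \<delta>" "\<delta> < 1" using as by auto
    define t where "t = tau c \<alpha> \<delta>"
    define n where "n = nstar c \<alpha> \<delta>"
    have t: "t \<ge> 1" "a * (t * ln t) = \<alpha> * ln (1 / \<delta>)"
      using tau_properties[OF c \<alpha> \<delta>] by (simp_all add: t_def a_def)
    have n: "real (Suc n) \<le> a * t + 4"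
      using nstar_bounds(2)[OF c \<alpha> \<delta>] by (simp add: n_def a_def t_def)
    have "\<delta> / cmod (ev n) = \<delta> * (1 / cmod (ev n))" by simp
    also have "\<dots> \<le> \<delta> * (ev_const c * (ev_rate c ^ Suc n * fact (Suc n)))"
      using inverse_ev_le[of n] \<delta> by (intro mult_left_mono) (simp_all only: mult.assoc less_imp_le)
    also have "\<dots> \<le> \<delta> * (ev_const c * (C * exp (\<gamma> * (a * (t * ln t)))))"
      using \<delta> ev_const_ge_2[of c] by (intro mult_left_mono C t n) auto
    also have "exp (\<gamma> * (a * (t * ln t))) = \<delta> powr (\<beta> - 1)"
    proof -
      have "\<gamma> * (\<alpha> * ln (1 / \<delta>)) = (\<beta> - 1) * ln \<delta>"
        using \<alpha> \<delta> by (simp add: \<gamma>_def ln_div) (simp add: algebra_simps)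
      then show ?thesis unfolding t(2) using \<delta> by (simp add: powr_def)
    qed
    also have "\<delta> * (ev_const c * (C * \<delta> powr (\<beta> - 1))) = ev_const c * C * \<delta> powr \<beta>"
      using \<delta> by (simp add: powr_diff)
    finally show "\<delta> / cmod (ev (nstar c \<alpha> \<delta>)) \<le> ev_const c * C * \<delta> powr \<beta>"
      by (simp add: n_def)
  qed
qed

text \<open>
  Here \<open>ln (1/\<delta>)\<close> is a constant times \<open>t ln t\<close>, while \<open>n\<^sup>*\<close> is at least a constant times \<open>t\<close>. The logarithm is bounded by the power
  \<open>t powr s / s\<close>, where \<open>s\<close> is chosen such that \<open>(t powr (1 + s)) powr \<mu> = t powr \<nu>\<close>.
\<close>

lemma logarithmic_rate_bound:
  assumes c: "c > 0" and \<alpha>: "0 < \<alpha>" and \<mu>: "0 < \<mu>" "\<mu> < \<nu>"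
  shows "\<exists>C>0. \<forall>\<delta>. 0 < \<delta> \<and> \<delta> < 1 \<longrightarrow>
    approx_rate c \<nu> (Suc (nstar c \<alpha> \<delta>)) \<le> C * ln (1 / \<delta>) powr (- \<mu>)"
proof -
  define a where "a = exp 1 * c / 4"
  have a: "a > 0" using c by (simp add: a_def)
  have \<nu>: "\<nu> > 0" using \<mu> by simp
  define s where "s = (\<nu> - \<mu>) / \<mu>"
  have s: "s > 0" "\<mu> * (1 + s) = \<nu>" using \<mu> by (simp_all add: s_def field_simps)
  define q where "q = a / (\<alpha> * s)"
  have q: "q > 0" using a \<alpha> s by (simp add: q_def)
  obtain C where C: "C > 0" "\<And>N. N \<ge> 1 \<Longrightarrow> approx_rate c \<nu> N \<le> C * real N powr (- \<nu>)"
    using approx_rate_le[OF c \<nu>] by blast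
  show ?thesis
  proof (intro exI[of _ "C * (a powr (-\<nu>) * q powr \<mu>)"] conjI allI impI)
    show "0 < C * (a powr (-\<nu>) * q powr \<mu>)" using C a q by simp
    fix \<delta> :: real assume "0 < \<delta> \<and> \<delta> < 1"
    then have \<delta>: "0 < \<delta>" "\<delta> < 1" by auto
    define t where "t = tau c \<alpha> \<delta>"
    define L where "L = ln (1 / \<delta>)"
    have L: "L > 0" using \<delta> by (simp add: L_def)
    have t: "t \<ge> 1" "a * (t * ln t) = \<alpha> * L"
      using tau_properties[OF c \<alpha> \<delta>] by (simp_all add: t_def a_def L_def)
    have N: "a * t \<le> real (Suc (nstar c \<alpha> \<delta>))"
      using nstar_bounds(1)[OF c \<alpha> \<delta>] by (simp add: a_def t_def)
    have "L = a / \<alpha> * (t * ln t)" using t(2) \<alpha> by (simp add: field_simps)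
    also have "\<dots> \<le> a / \<alpha> * (t * (t powr s / s))"
      using a \<alpha> t s by (intro mult_left_mono ln_powr_bound) auto
    also have "\<dots> = q * t powr (1 + s)" using t by (simp add: q_def powr_add)
    finally have "L powr \<mu> \<le> (q * t powr (1 + s)) powr \<mu>"
      using L \<mu> by (intro powr_mono2) auto
    also have "\<dots> = q powr \<mu> * t powr \<nu>"
      using q s t by (simp add: powr_mult powr_powr mult.commute)
    finally have "t powr (-\<nu>) \<le> q powr \<mu> * L powr (-\<mu>)"
      using L t by (simp add: powr_minus field_simps)
    then have "a powr (-\<nu>) * t powr (-\<nu>) \<le> a powr (-\<nu>) * (q powr \<mu> * L powr (-\<mu>))"
      by (intro mult_left_mono) auto
    then have at: "(a * t) powr (-\<nu>) \<le> a powr (-\<nu>) * (q powr \<mu> * L powr (-\<mu>))"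
      using a t by (simp add: powr_mult)
    have "approx_rate c \<nu> (Suc (nstar c \<alpha> \<delta>)) \<le> C * real (Suc (nstar c \<alpha> \<delta>)) powr (-\<nu>)"
      by (rule C) simp
    also have "\<dots> \<le> C * (a * t) powr (-\<nu>)"
      using C a t \<nu> N by (intro mult_left_mono powr_mono2') auto
    also have "\<dots> \<le> C * (a powr (-\<nu>) * (q powr \<mu> * L powr (-\<mu>)))"
      using C at by (intro mult_left_mono) auto
    finally show "approx_rate c \<nu> (Suc (nstar c \<alpha> \<delta>)) \<le> C * (a powr (-\<nu>) * q powr \<mu>) * ln (1 / \<delta>) powr (-\<mu>)"
      by (simp add: L_def mult.assoc)
  qed
qed

section \<open>The error estimate\<close>

theorem corollary3p3:
  shows "\<exists>(C1 :: real \<Rightarrow> real \<Rightarrow> real \<Rightarrow> real) (C2 :: real \<Rightarrow> real \<Rightarrow> real \<Rightarrow> real \<Rightarrow> real).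
    \<forall>c \<alpha> \<nu> \<beta> \<mu>. 0 < c \<and> 0 < \<alpha> \<and> \<alpha> < 1 \<and> 0 < \<nu> \<and>
        0 < \<beta> \<and> \<beta> < 1 - \<alpha> \<and> 0 < \<mu> \<and> \<mu> < \<nu> \<longrightarrow>
      0 < C1 c \<alpha> \<beta> \<and> 0 < C2 c \<alpha> \<nu> \<mu> \<and>
      (\<forall>\<psi> ev f w \<delta> M.
        is_pswf_system c \<psi> ev \<and>
        square_integrable leb_I f \<and> square_integrable leb_I w \<and>
        0 < \<delta> \<and> \<delta> < 1 \<and> 0 < M \<and>
        l2norm leb_I (\<lambda>x. Fop c f x - w x) \<le> \<delta> * M \<and>
        f \<in> sobolev_space \<nu> \<longrightarrow>
        l2norm leb_I (\<lambda>y. f y - Finv \<psi> ev (nstar c \<alpha> \<delta>) w y)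
          \<le> C1 c \<alpha> \<beta> * M * \<delta> powr \<beta> + C2 c \<alpha> \<nu> \<mu> * sobolev_norm \<nu> f * ln (1 / \<delta>) powr (- \<mu>))"
proof -
  \<comment> \<open>The constants may depend on the listed parameters only, so they are chosen from properties that mention nothing else.\<close>
  define P1 where "P1 c \<alpha> \<beta> C \<longleftrightarrow> C > 0 \<and> (\<forall>\<psi> ev \<delta>. is_pswf_system c \<psi> ev \<and> 0 < \<delta> \<and> \<delta> < 1 \<longrightarrow>
    \<delta> / cmod (ev (nstar c \<alpha> \<delta>)) \<le> C * \<delta> powr \<beta>)" for c \<alpha> \<beta> C :: real
  define P2 where "P2 c \<alpha> \<nu> \<mu> C \<longleftrightarrow> C > 0 \<and> (\<forall>\<delta>. 0 < \<delta> \<and> \<delta> < 1 \<longrightarrow>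
    approx_rate c \<nu> (Suc (nstar c \<alpha> \<delta>)) \<le> C * ln (1 / \<delta>) powr (- \<mu>))" for c \<alpha> \<nu> \<mu> C :: real
  define C1 where "C1 c \<alpha> \<beta> = (SOME C. P1 c \<alpha> \<beta> C)" for c \<alpha> \<beta>
  define C2 where "C2 c \<alpha> \<nu> \<mu> = (SOME C. P2 c \<alpha> \<nu> \<mu> C)" for c \<alpha> \<nu> \<mu>
  show ?thesis
  proof (intro exI[of _ C1] exI[of _ C2] allI impI)
    fix c \<alpha> \<nu> \<beta> \<mu> :: real
    assume as: "0 < c \<and> 0 < \<alpha> \<and> \<alpha> < 1 \<and> 0 < \<nu> \<and> 0 < \<beta> \<and> \<beta> < 1 - \<alpha> \<and> 0 < \<mu> \<and> \<mu> < \<nu>"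
    have "\<exists>C. P1 c \<alpha> \<beta> C" unfolding P1_def using as by (intro noise_amplification_bound) auto
    then have C1: "P1 c \<alpha> \<beta> (C1 c \<alpha> \<beta>)" unfolding C1_def by (rule someI_ex)
    have "\<exists>C. P2 c \<alpha> \<nu> \<mu> C" unfolding P2_def using as by (intro logarithmic_rate_bound) auto
    then have C2: "P2 c \<alpha> \<nu> \<mu> (C2 c \<alpha> \<nu> \<mu>)" unfolding C2_def by (rule someI_ex)
    show "0 < C1 c \<alpha> \<beta> \<and> 0 < C2 c \<alpha> \<nu> \<mu> \<and>
      (\<forall>\<psi> ev f w \<delta> M.
        is_pswf_system c \<psi> ev \<and>
        square_integrable leb_I f \<and> square_integrable leb_I w \<and>
        0 < \<delta> \<and> \<delta> < 1 \<and> 0 < M \<and>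
        l2norm leb_I (\<lambda>x. Fop c f x - w x) \<le> \<delta> * M \<and>
        f \<in> sobolev_space \<nu> \<longrightarrow>
        l2norm leb_I (\<lambda>y. f y - Finv \<psi> ev (nstar c \<alpha> \<delta>) w y)
          \<le> C1 c \<alpha> \<beta> * M * \<delta> powr \<beta> + C2 c \<alpha> \<nu> \<mu> * sobolev_norm \<nu> f * ln (1 / \<delta>) powr (- \<mu>))"
    proof (intro conjI allI impI, goal_cases)
      case 1 then show ?case using C1 by (simp add: P1_def)
    next
      case 2 then show ?case using C2 by (simp add: P2_def)
    next
      case (3 \<psi> ev f w \<delta> M)
      then interpret pswf c \<psi> ev by unfold_locales (use as in auto)
      define n where "n = nstar c \<alpha> \<delta>"
      have f: "square_integrable leb_I f" "f \<in> sobolev_space \<nu>" and w: "square_integrable leb_I w"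
        and \<delta>: "0 < \<delta>" "\<delta> < 1" and M: "0 < M" and noise: "l2norm leb_I (\<lambda>x. Fop c f x - w x) \<le> \<delta> * M"
        using 3 by auto
      have "l2norm leb_I (\<lambda>x. Fop c f x - w x) / cmod (ev n) \<le> \<delta> * M / cmod (ev n)"
        by (intro divide_right_mono noise) simp
      also have "\<dots> = M * (\<delta> / cmod (ev n))" by simp
      also have "\<dots> \<le> M * (C1 c \<alpha> \<beta> * \<delta> powr \<beta>)"
        using C1 M \<delta> pswf_system unfolding P1_def n_def by (intro mult_left_mono) auto
      finally have A: "l2norm leb_I (\<lambda>x. Fop c f x - w x) / cmod (ev n) \<le> C1 c \<alpha> \<beta> * M * \<delta> powr \<beta>"
        by (simp add: mult_ac)
      have "l2norm leb_I (\<lambda>y. f y - (\<Sum>j\<le>n. pswf_coeff \<psi> f j * \<Psi> j y)) \<le> approx_rate c \<nu> (Suc n) * sobolev_norm \<nu> f"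
        using as by (intro approximation_error_sobolev f) auto
      also have "\<dots> \<le> (C2 c \<alpha> \<nu> \<mu> * ln (1 / \<delta>) powr (-\<mu>)) * sobolev_norm \<nu> f"
        using C2 \<delta> sobolev_norm_nonneg[OF f(2)] unfolding P2_def n_def by (intro mult_right_mono) auto
      finally have B: "l2norm leb_I (\<lambda>y. f y - (\<Sum>j\<le>n. pswf_coeff \<psi> f j * \<Psi> j y))
          \<le> C2 c \<alpha> \<nu> \<mu> * sobolev_norm \<nu> f * ln (1 / \<delta>) powr (-\<mu>)"
        by (simp add: mult_ac)
      show ?case
        using error_decomposition[OF f(1) w, of n] A B unfolding n_def by linarith
    qed
  qed
qed

end
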